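(* Let $\mathbb{G}$ be the metric completion of the Fraïssé limit $(G_1,d_1)$ of the category $\mathcal{G}_1$ (defined in the context). Let $\mathbb{H}$ be a group with a complete separable bi-invariant metric $d_{\mathbb{H}}$ bounded by $1$. Then $\mathbb{H}$ is isometrically isomorphic (as a metric group) to $\mathbb{G}$ if and only if the following two conditions hold: (1) a free group with countably infinitely many free generators, denoted by $H$, is a dense subgroup of $\mathbb{H}$; (2) (for this $H$) for all reals $\varepsilon>\varepsilon'>0$, all integers $0\leq m<n$, every bi-invariant metric $\rho$ bounded by $1$ on $F_n$, and every monomorphism $\iota:F_m\to\mathbb{H}$ such that $\mathrm{dist}(\rho\upharpoonright F_m,\iota^*d_{\mathbb{H}})<\varepsilon$, there exists a monomorphism $\bar\iota:F_n\to H\subseteq\mathbb{H}$ such that $d_{\mathbb{H}}(\bar\iota(f_i),\iota(f_i))<\varepsilon$ for every $1\leq i\leq m$ and $\mathrm{dist}(\rho,\bar\iota^*d_{\mathbb{H}})<\varepsilon'$.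
   Context: A metric $d$ on a group $G$ is bi-invariant if $d(xay,xby)=d(a,b)$ for all $x,y,a,b\in G$; the metric completion of a group with bi-invariant metric is again a group with bi-invariant metric. $F_n$ is the free group with free generators $f_1,\dots,f_n$ ($F_0$ is trivial); for $m\leq n$, $F_m\leq F_n$ is the subgroup generated by $f_1,\dots,f_m$. For $g\in F_n$, $|g|$ is the length of the reduced word in $f_1^{\pm1},\dots,f_n^{\pm 1}$ representing $g$. For bi-invariant metrics $p,q$ on $F_n$, $$\mathrm{dist}(p,q)=\inf\{\varepsilon>0: |p(g,1)-q(g,1)|\leq\varepsilon|g|\text{ for all }g\in F_n\}.$$ If $\iota:F_n\to H$ is a monomorphism into a group with bi-invariant metric $d_H$, then $\iota^*d_H$ is the metric $(x,y)\mapsto d_H(\iota(x),\iota(y))$ on $F_n$. Category $\mathcal{G}_1$. A metric $d$ on a group $G$ is a finitely generated metric bounded by $1$ if there is a finite set $A\subseteq G$ with $1\in A$, $A=A^{-1}$, which algebraically generates $G$, such that for all $a,b\in G$ $$d(a,b)=\min\Big\{1,\ \min\Big\{\sum_{i=1}^k d(a_i,b_i): k\in\mathbb{N},\ a_i,b_i\in A,\ a=a_1\cdots a_k,\ b=b_1\cdots b_k\Big\}\Big\}.$$ Such a metric is bi-invariant. It is rational if all its values are rational. An object of $\mathcal{G}_1$ is a free group on a finite set $F$ of free generators (the set $F$ being part of the data) together with a rational finitely generated metric bounded by $1$. A morphism is an isometric group embedding that sends free generators to free generators. Fraïssé limit. $(G_1,d_1)$ is the direct limit of a sequence $K_1\to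 K_2\to\cdots$ of objects and morphisms of $\mathcal{G}_1$ such that every object of $\mathcal{G}_1$ admits a morphism into some $K_n$ and such that for all morphisms $\iota_1:A_1\to K_n$ and $\rho:A_1\to A_2$ of $\mathcal{G}_1$ there exist $m>n$ and a morphism $\iota_2:A_2\to K_m$ with $\iota_2\circ\rho$ equal to $\iota_1$ followed by $K_n\to K_m$. Such a limit exists and is unique up to isometric isomorphism; it is a free group with countably infinitely many free generators equipped with a bi-invariant metric bounded by $1$. *)

theory Defs
  imports "HOL-Analysis.Analysis" "HOL-Algebra.Generated_Groups"
begin

section \<open>Free groups as groups of reduced words\<close>

text \<open>The letter \<^term>\<open>(x, True)\<close> is the generator \<open>x\<close>, and \<^term>\<open>(x, False)\<close> is its formal inverse.\<close>

type_synonym 'a word = "('a \<times> bool) list"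

definition letter_inv :: "'a \<times> bool \<Rightarrow> 'a \<times> bool" where
  "letter_inv l = (fst l, \<not> snd l)"

definition reduced_word :: "'a word \<Rightarrow> bool" where
  "reduced_word w \<longleftrightarrow> successively (\<lambda>l k. k \<noteq> letter_inv l) w"

definition prepend :: "'a \<times> bool \<Rightarrow> 'a word \<Rightarrow> 'a word" where
  "prepend l w = (if w \<noteq> [] \<and> hd w = letter_inv l then tl w else l # w)"

text \<open>\<^term>\<open>foldr prepend u v\<close> is the reduced form of the concatenation of the reduced words
  \<open>u\<close> and \<open>v\<close>.\<close>

definition free_group :: "'a set \<Rightarrow> 'a word monoid" where
  "free_group X =
     \<lparr>carrier = {w. reduced_word w \<and> fst ` set w \<subseteq> X}, mult = foldr prepend, one = []\<rparr>"

definition gen :: "'a \<Rightarrow> 'a word" where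
  "gen x = [(x, True)]"

lemma letter_inv_simps [simp]:
  "letter_inv (letter_inv l) = l" "fst (letter_inv l) = fst l" "letter_inv l \<noteq> l"
  by (cases l; simp add: letter_inv_def)+

lemma reduced_word_Nil [simp]: "reduced_word []"
  by (simp add: reduced_word_def)

lemma reduced_word_Cons: "reduced_word (l # w) \<longleftrightarrow> reduced_word w \<and> (w \<noteq> [] \<longrightarrow> hd w \<noteq> letter_inv l)"
  by (auto simp: reduced_word_def successively_Cons)

lemma reduced_word_prepend: "reduced_word w \<Longrightarrow> reduced_word (prepend l w)"
  by (cases w) (auto simp: prepend_def reduced_word_Cons)

lemma prepend_letter_inv:
  assumes "reduced_word w"
  shows "prepend l (prepend (letter_inv l) w) = w" "prepend (letter_inv l) (prepend l w) = w"
  using assms by (cases w; cases "tl w"; force simp: prepend_def reduced_word_Cons)+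

lemma letters_prepend: "fst ` set (prepend l w) \<subseteq> insert (fst l) (fst ` set w)"
  by (cases w) (auto simp: prepend_def)

lemma reduced_foldr_prepend: "reduced_word v \<Longrightarrow> reduced_word (foldr prepend u v)"
  by (induction u) (auto simp: reduced_word_prepend)

lemma letters_foldr_prepend: "fst ` set (foldr prepend u v) \<subseteq> fst ` set u \<union> fst ` set v"
proof (induction u)
  case (Cons l u)
  have "fst ` set (foldr prepend (l # u) v) \<subseteq> insert (fst l) (fst ` set (foldr prepend u v))"
    by (simp add: letters_prepend)
  also have "\<dots> \<subseteq> fst ` set (l # u) \<union> fst ` set v"
    using Cons by auto
  finally show ?case .
qed simp

lemma foldr_prepend_Nil: "reduced_word u \<Longrightarrow> foldr prepend u [] = u"
  by (induction u) (auto simp: reduced_word_Cons prepend_def)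

lemma foldr_prepend_prepend:
  assumes "reduced_word w"
  shows "foldr prepend (prepend l v) w = prepend l (foldr prepend v w)"
proof (cases "v \<noteq> [] \<and> hd v = letter_inv l")
  case True
  then obtain v' where "v = letter_inv l # v'" by (cases v) auto
  then show ?thesis
    using assms by (simp add: prepend_letter_inv reduced_foldr_prepend) (simp add: prepend_def)
next
  case False
  then have "prepend l v = l # v" by (auto simp: prepend_def)
  then show ?thesis by simp
qed

lemma foldr_prepend_assoc:
  assumes "reduced_word w"
  shows "foldr prepend (foldr prepend u v) w = foldr prepend u (foldr prepend v w)"
  using assms by (induction u) (simp_all add: foldr_prepend_prepend)

lemma foldr_prepend_inverse: "foldr prepend (rev (map letter_inv u)) (u @ v) = v"
  by (induction u) (auto simp: prepend_def)

lemma group_free_group: "group (free_group X)"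
proof (rule groupI)
  fix u assume u: "u \<in> carrier (free_group X)"
  let ?v = "foldr prepend (rev (map letter_inv u)) []"
  have "foldr prepend ?v u = []"
    using u foldr_prepend_assoc[of u "rev (map letter_inv u)" "[]"] foldr_prepend_inverse[of u "[]"]
    by (simp add: free_group_def)
  moreover have "?v \<in> carrier (free_group X)"
    using u letters_foldr_prepend[of "rev (map letter_inv u)" "[]"]
    by (force simp: free_group_def reduced_foldr_prepend)
  ultimately show "\<exists>v\<in>carrier (free_group X). v \<otimes>\<^bsub>free_group X\<^esub> u = \<one>\<^bsub>free_group X\<^esub>"
    by (auto simp: free_group_def)
next
  fix u v assume "u \<in> carrier (free_group X)" "v \<in> carrier (free_group X)"
  moreover from this have "fst ` set (foldr prepend u v) \<subseteq> X"
    using letters_foldr_prepend[of u v] by (simp add: free_group_def) (meson Un_least order_trans)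
  ultimately show "u \<otimes>\<^bsub>free_group X\<^esub> v \<in> carrier (free_group X)"
    by (simp add: free_group_def reduced_foldr_prepend)
qed (auto simp: free_group_def foldr_prepend_assoc)


section \<open>Groups with bi-invariant metrics\<close>

definition bi_invariant_metric :: "('a, 'b) monoid_scheme \<Rightarrow> ('a \<Rightarrow> 'a \<Rightarrow> real) \<Rightarrow> bool" where
  "bi_invariant_metric G d \<longleftrightarrow>
     Metric_space (carrier G) d \<and>
     (\<forall>x\<in>carrier G. \<forall>y\<in>carrier G. \<forall>a\<in>carrier G. \<forall>b\<in>carrier G.
        d (x \<otimes>\<^bsub>G\<^esub> a \<otimes>\<^bsub>G\<^esub> y) (x \<otimes>\<^bsub>G\<^esub> b \<otimes>\<^bsub>G\<^esub> y) = d a b)"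

definition bounded_by_1 :: "('a, 'b) monoid_scheme \<Rightarrow> ('a \<Rightarrow> 'a \<Rightarrow> real) \<Rightarrow> bool" where
  "bounded_by_1 G d \<longleftrightarrow> (\<forall>x\<in>carrier G. \<forall>y\<in>carrier G. d x y \<le> 1)"

definition isometric_on :: "'a set \<Rightarrow> ('a \<Rightarrow> 'a \<Rightarrow> real) \<Rightarrow> ('b \<Rightarrow> 'b \<Rightarrow> real) \<Rightarrow> ('a \<Rightarrow> 'b) \<Rightarrow> bool" where
  "isometric_on X d e f \<longleftrightarrow> (\<forall>x\<in>X. \<forall>y\<in>X. e (f x) (f y) = d x y)"

definition isometrically_isomorphic ::
  "('a, 'c) monoid_scheme \<Rightarrow> ('a \<Rightarrow> 'a \<Rightarrow> real) \<Rightarrow> ('b, 'd) monoid_scheme \<Rightarrow> ('b \<Rightarrow> 'b \<Rightarrow> real) \<Rightarrow> bool" where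
  "isometrically_isomorphic G d H e \<longleftrightarrow> (\<exists>f\<in>iso G H. isometric_on (carrier G) d e f)"

definition dense_in :: "('a, 'b) monoid_scheme \<Rightarrow> ('a \<Rightarrow> 'a \<Rightarrow> real) \<Rightarrow> 'a set \<Rightarrow> bool" where
  "dense_in G d S \<longleftrightarrow> Metric_space.mtopology (carrier G) d closure_of S = carrier G"

text \<open>\<open>(C, e)\<close> is a metric completion of the metric group \<open>(G, d)\<close>. This determines \<open>(C, e)\<close>
  up to isometric isomorphism, since multiplication is continuous for a bi-invariant metric.\<close>

definition metric_completion ::
  "('a, 'c) monoid_scheme \<Rightarrow> ('a \<Rightarrow> 'a \<Rightarrow> real) \<Rightarrow> ('b, 'd) monoid_scheme \<Rightarrow> ('b \<Rightarrow> 'b \<Rightarrow> real) \<Rightarrow> bool" where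
  "metric_completion G d C e \<longleftrightarrow>
     group C \<and> bi_invariant_metric C e \<and> Metric_space.mcomplete (carrier C) e \<and>
     (\<exists>j\<in>hom G C. isometric_on (carrier G) d e j \<and> dense_in C e (j ` carrier G))"


section \<open>Distance between metrics on \<open>F\<^sub>n\<close>\<close>

text \<open>The group \<open>F\<^sub>m\<close> is literally a subgroup of \<open>F\<^sub>n\<close> for \<open>m \<le> n\<close>, so restricting a metric from
  \<open>F\<^sub>n\<close> to \<open>F\<^sub>m\<close> leaves the function unchanged.\<close>

definition F :: "nat \<Rightarrow> nat word monoid" where
  "F n = free_group {1..n}"

text \<open>Elements of \<open>F n\<close> are reduced words, so \<^const>\<open>length\<close> is the word length. The infimum is
  over a nonempty set whenever \<open>p\<close> and \<open>q\<close> are bi-invariant metrics, as then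
  \<open>p(g,1)\<close> and \<open>q(g,1)\<close> grow at most linearly in the length of \<open>g\<close>.\<close>

definition metric_dist :: "nat \<Rightarrow> (nat word \<Rightarrow> nat word \<Rightarrow> real) \<Rightarrow> (nat word \<Rightarrow> nat word \<Rightarrow> real) \<Rightarrow> real" where
  "metric_dist n p q =
     Inf {\<epsilon>. \<epsilon> > 0 \<and> (\<forall>g\<in>carrier (F n). \<bar>p g \<one>\<^bsub>F n\<^esub> - q g \<one>\<^bsub>F n\<^esub>\<bar> \<le> \<epsilon> * real (length g))}"

definition pullback :: "('a \<Rightarrow> 'b) \<Rightarrow> ('b \<Rightarrow> 'b \<Rightarrow> real) \<Rightarrow> 'a \<Rightarrow> 'a \<Rightarrow> real" where
  "pullback f d = (\<lambda>x y. d (f x) (f y))"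


section \<open>The category of finitely generated free metric groups\<close>

definition group_prod :: "('a, 'b) monoid_scheme \<Rightarrow> 'a list \<Rightarrow> 'a" where
  "group_prod G xs = foldr (mult G) xs \<one>\<^bsub>G\<^esub>"

text \<open>The sums \<open>d(a\<^sub>1,b\<^sub>1) + \<dots> + d(a\<^sub>k,b\<^sub>k)\<close> over all pairs of factorizations of \<open>a\<close> and \<open>b\<close> of the
  same length with factors in \<open>A\<close>; a pair of factorizations is a list of pairs.\<close>

definition factorization_sums ::
  "('a, 'b) monoid_scheme \<Rightarrow> ('a \<Rightarrow> 'a \<Rightarrow> real) \<Rightarrow> 'a set \<Rightarrow> 'a \<Rightarrow> 'a \<Rightarrow> real set" where
  "factorization_sums G d A a b =
     {(\<Sum>(x, y)\<leftarrow>ps. d x y) |ps. set ps \<subseteq> A \<times> A \<and>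
        a = group_prod G (map fst ps) \<and> b = group_prod G (map snd ps)}"

text \<open>The inner minimum ranges over an infinite set, so it is spelled out as an attained least
  value \<open>s\<close>.\<close>

definition fg_metric_bounded_by_1 :: "('a, 'b) monoid_scheme \<Rightarrow> ('a \<Rightarrow> 'a \<Rightarrow> real) \<Rightarrow> bool" where
  "fg_metric_bounded_by_1 G d \<longleftrightarrow>
     Metric_space (carrier G) d \<and>
     (\<exists>A. finite A \<and> A \<subseteq> carrier G \<and> \<one>\<^bsub>G\<^esub> \<in> A \<and> m_inv G ` A = A \<and> generate G A = carrier G \<and>
        (\<forall>a\<in>carrier G. \<forall>b\<in>carrier G. \<exists>s\<in>factorization_sums G d A a b.
           (\<forall>t\<in>factorization_sums G d A a b. s \<le> t) \<and> d a b = min 1 s))"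

definition rational_metric :: "('a, 'b) monoid_scheme \<Rightarrow> ('a \<Rightarrow> 'a \<Rightarrow> real) \<Rightarrow> bool" where
  "rational_metric G d \<longleftrightarrow> (\<forall>a\<in>carrier G. \<forall>b\<in>carrier G. d a b \<in> \<rat>)"

text \<open>An object consists of a finite set \<open>X\<close> of free generators and a metric on \<^term>\<open>free_group X\<close>.
  Taking \<open>X\<close> to be a set of natural numbers yields every object up to isomorphism in the category.\<close>

type_synonym G1_data = "nat set \<times> (nat word \<Rightarrow> nat word \<Rightarrow> real)"

abbreviation grp :: "G1_data \<Rightarrow> nat word monoid" where
  "grp K \<equiv> free_group (fst K)"

abbreviation met :: "G1_data \<Rightarrow> nat word \<Rightarrow> nat word \<Rightarrow> real" where
  "met K \<equiv> snd K"

definition G1_object :: "G1_data \<Rightarrow> bool" where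
  "G1_object K \<longleftrightarrow>
     finite (fst K) \<and> fg_metric_bounded_by_1 (grp K) (met K) \<and> rational_metric (grp K) (met K)"

definition G1_morphism :: "G1_data \<Rightarrow> G1_data \<Rightarrow> (nat word \<Rightarrow> nat word) \<Rightarrow> bool" where
  "G1_morphism K L f \<longleftrightarrow>
     G1_object K \<and> G1_object L \<and>
     f \<in> mon (grp K) (grp L) \<and> isometric_on (carrier (grp K)) (met K) (met L) f \<and>
     f ` gen ` fst K \<subseteq> gen ` fst L"

text \<open>\<^term>\<open>bonding \<phi> n k\<close> is the composite \<open>K\<^sub>n \<rightarrow> K\<^sub>n\<^sub>+\<^sub>k\<close> of the bonding maps
  \<open>\<phi> i : K\<^sub>i \<rightarrow> K\<^sub>i\<^sub>+\<^sub>1\<close>.\<close>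

primrec bonding :: "(nat \<Rightarrow> 'a \<Rightarrow> 'a) \<Rightarrow> nat \<Rightarrow> nat \<Rightarrow> 'a \<Rightarrow> 'a" where
  "bonding \<phi> n 0 = id"
| "bonding \<phi> n (Suc k) = \<phi> (n + k) \<circ> bonding \<phi> n k"

definition fraisse_sequence :: "(nat \<Rightarrow> G1_data) \<Rightarrow> (nat \<Rightarrow> nat word \<Rightarrow> nat word) \<Rightarrow> bool" where
  "fraisse_sequence K \<phi> \<longleftrightarrow>
     (\<forall>n. G1_object (K n)) \<and> (\<forall>n. G1_morphism (K n) (K (Suc n)) (\<phi> n)) \<and>
     (\<forall>A. G1_object A \<longrightarrow> (\<exists>n f. G1_morphism A (K n) f)) \<and>
     (\<forall>n A1 A2 \<iota>1 \<rho>. G1_morphism A1 (K n) \<iota>1 \<and> G1_morphism A1 A2 \<rho> \<longrightarrow>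
        (\<exists>m>n. \<exists>\<iota>2. G1_morphism A2 (K m) \<iota>2 \<and>
           (\<forall>x\<in>carrier (grp A1). \<iota>2 (\<rho> x) = bonding \<phi> n (m - n) (\<iota>1 x))))"

text \<open>\<open>(G, d)\<close> is the direct limit of \<open>(K, \<phi>)\<close> with canonical maps \<open>\<psi> n\<close>: as the bonding maps are
  isometric embeddings, the limit is the increasing union of isometric copies of the \<open>K n\<close>.\<close>

definition is_direct_limit ::
  "(nat \<Rightarrow> G1_data) \<Rightarrow> (nat \<Rightarrow> nat word \<Rightarrow> nat word) \<Rightarrow>
   ('a, 'b) monoid_scheme \<Rightarrow> ('a \<Rightarrow> 'a \<Rightarrow> real) \<Rightarrow> (nat \<Rightarrow> nat word \<Rightarrow> 'a) \<Rightarrow> bool" where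
  "is_direct_limit K \<phi> G d \<psi> \<longleftrightarrow>
     group G \<and>
     (\<forall>n. \<psi> n \<in> hom (grp (K n)) G \<and> isometric_on (carrier (grp (K n))) (met (K n)) d (\<psi> n)) \<and>
     (\<forall>n. \<forall>x\<in>carrier (grp (K n)). \<psi> (Suc n) (\<phi> n x) = \<psi> n x) \<and>
     carrier G = (\<Union>n. \<psi> n ` carrier (grp (K n)))"

text \<open>The Fraisse limit is unique up to isometric isomorphism, so it is specified by a predicate.\<close>

definition fraisse_limit :: "('a, 'b) monoid_scheme \<Rightarrow> ('a \<Rightarrow> 'a \<Rightarrow> real) \<Rightarrow> bool" where
  "fraisse_limit G d \<longleftrightarrow> (\<exists>K \<phi> \<psi>. fraisse_sequence K \<phi> \<and> is_direct_limit K \<phi> G d \<psi>)"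

end

theory Submission
  imports Defs
begin

text \<open>Call a dense free subgroup of infinite rank with the extension property (2) generic.

  The image of \<open>G1\<close> in the completion is generic. A partial map \<open>F m \<rightarrow> GG\<close> is approximated on the
  generators by a map into some \<open>K N\<close>, and \<open>K N\<close> is enlarged by \<open>n\<close> new free generators: the new
  metric is the largest bi-invariant one bounded by 1 that satisfies finitely many rational
  inequalities, namely those defining the metric of \<open>K N\<close>, approximations of \<open>\<rho>\<close> on a ball of \<open>F n\<close>,
  and the closeness of corresponding generators. Such a metric is an object of the category, and
  it restricts to the right metrics on both factors because bi-invariant metrics on two groups
  can be amalgamated along homomorphisms \<open>p\<close>, \<open>q\<close> from \<open>F m\<close> with
  \<open>\<bar>d(p v, 1) - \<rho>(q v, 1)\<bar> \<le> \<epsilon> |v|\<close>, keeping \<open>p\<close> and \<open>q\<close> at distance at most \<open>\<epsilon>\<close> on generators.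
  The Fraisse property embeds the enlarged object into some later \<open>K M\<close>.

  Conversely, two complete groups with generic subgroups are isometrically isomorphic by back and
  forth. Property (2) only applies to monomorphisms, so arbitrary elements first have to be perturbed
  into free ones: if \<open>u\<close> is a small nontrivial element and the \<open>x\<^sub>i\<close> are fresh free generators,
  then \<open>b\<^sub>i x\<^sub>i\<^sup>-\<^sup>1 u x\<^sub>i\<close> are free generators close to the nontrivial elements \<open>b\<^sub>i\<close>, since
  conjugation does not change the distance to 1.\<close>

section \<open>Evaluating words\<close>

text \<open>The danger in the first half is that imposing closeness of generators shortens distances
  inside \<open>K N\<close>: a chain of cheap steps may leave \<open>K N\<close>, pass through the
  new generators and return. Its intermediate products lie in the free product, where no metric is
  available in advance, so no triangle inequality can be applied along the chain. Its cost is
  therefore bounded by a combinatorial evaluation procedure that does not see how an element of the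
  free product is factored; only at the very end is it compared with a distance in one factor.

  Only finitely many inequalities can be imposed, so \<rho> is approximated from above on a ball
  alone. This suffices because \<open>metric_dist\<close> weighs errors by word length and all
  metrics are bounded by 1: on sufficiently long words every error is permitted.

  In the second half the metric to be extended must be a genuine metric on a free group, while a
  tuple with a prescribed new entry may satisfy relations. Replacing the whole tuple by a nearby
  free one before pulling the metric back removes this obstacle, and the strictness of dist <
  \<epsilon> leaves room for the displacement.\<close>

definition word_eval :: "('b, 'z) monoid_scheme \<Rightarrow> ('a \<Rightarrow> 'b) \<Rightarrow> 'a word \<Rightarrow> 'b" where
  "word_eval G f w =
     foldr (\<lambda>l. mult G (if snd l then f (fst l) else m_inv G (f (fst l)))) w \<one>\<^bsub>G\<^esub>"

lemma carrier_free_group: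
  "w \<in> carrier (free_group X) \<longleftrightarrow> reduced_word w \<and> fst ` set w \<subseteq> X"
  and mult_free_group [simp]: "u \<otimes>\<^bsub>free_group X\<^esub> v = foldr prepend u v"
  and one_free_group [simp]: "\<one>\<^bsub>free_group X\<^esub> = []"
  by (simp_all add: free_group_def)

lemma gen_in_free_group [simp]: "gen x \<in> carrier (free_group X) \<longleftrightarrow> x \<in> X"
  by (simp add: gen_def reduced_word_def carrier_free_group)

lemma reduced_word_inverse: "reduced_word (rev (map letter_inv w)) \<longleftrightarrow> reduced_word w"
  unfolding reduced_word_def successively_rev successively_map
  by (intro successively_cong refl) auto

lemma inv_free_group:
  assumes "w \<in> carrier (free_group X)"
  shows "inv\<^bsub>free_group X\<^esub> w = rev (map letter_inv w)"
proof -
  interpret group "free_group X" by (rule group_free_group)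
  have "rev (map letter_inv w) \<otimes>\<^bsub>free_group X\<^esub> w = \<one>\<^bsub>free_group X\<^esub>"
    using foldr_prepend_inverse[of w "[]"] by simp
  moreover have "rev (map letter_inv w) \<in> carrier (free_group X)"
    using assms by (force simp: carrier_free_group reduced_word_inverse)
  ultimately show ?thesis
    using assms inv_equality by blast
qed

lemma inv_free_group_gen: "x \<in> X \<Longrightarrow> inv\<^bsub>free_group X\<^esub> (gen x) = [(x, False)]"
  by (subst inv_free_group) (auto simp: gen_def reduced_word_def prepend_def letter_inv_def carrier_free_group)

context group
begin

lemma word_eval_Nil [simp]: "word_eval G f [] = \<one>"
  by (simp add: word_eval_def)

lemma word_eval_Cons:
  "word_eval G f (l # w) = (if snd l then f (fst l) else inv f (fst l)) \<otimes> word_eval G f w"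
  by (simp add: word_eval_def)

lemma word_eval_closed [simp]:
  "(\<And>l. l \<in> set w \<Longrightarrow> f (fst l) \<in> carrier G) \<Longrightarrow> word_eval G f w \<in> carrier G"
  by (induction w) (auto simp: word_eval_Cons)

lemma word_eval_prepend:
  assumes "\<And>k. k \<in> set (l # w) \<Longrightarrow> f (fst k) \<in> carrier G"
  shows "word_eval G f (prepend l w) = word_eval G f (l # w)"
proof (cases "w \<noteq> [] \<and> hd w = letter_inv l")
  case True
  then obtain w' where w: "w = letter_inv l # w'" by (cases w) auto
  have "f (fst l) \<in> carrier G" "word_eval G f w' \<in> carrier G"
    using assms w by auto
  then show ?thesis
    using w by (auto simp: prepend_def word_eval_Cons letter_inv_def m_assoc[symmetric])
qed (auto simp: prepend_def)

lemma word_eval_foldr_prepend: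
  assumes "\<And>l. l \<in> set (u @ v) \<Longrightarrow> f (fst l) \<in> carrier G"
  shows "word_eval G f (foldr prepend u v) = word_eval G f u \<otimes> word_eval G f v"
  using assms
proof (induction u)
  case (Cons l u)
  have "f (fst k) \<in> carrier G" if "k \<in> set (l # foldr prepend u v)" for k
  proof -
    have "fst k \<in> fst ` set ((l # u) @ v)"
      using that letters_foldr_prepend[of u v] by auto
    then obtain k' where "k' \<in> set ((l # u) @ v)" "fst k = fst k'" by (meson imageE)
    then show ?thesis using Cons.prems by metis
  qed
  then have "word_eval G f (foldr prepend (l # u) v) = word_eval G f (l # foldr prepend u v)"
    using word_eval_prepend[of l "foldr prepend u v" f] by simp
  then show ?case
    using Cons by (auto simp: word_eval_Cons m_assoc)
qed auto

text \<open>Existence half of the universal property of the free group. Since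
  \<open>word_eval\<close> is defined on unreduced words too, inductions such as the one for
  \<open>word_eval_dist_le\<close> need no invariant about reducedness.\<close>

lemma word_eval_hom:
  assumes "f ` X \<subseteq> carrier G"
  shows "word_eval G f \<in> hom (free_group X) G"
proof (rule homI)
  have *: "f (fst l) \<in> carrier G" if "w \<in> carrier (free_group X)" "l \<in> set w" for w l
    using that assms by (force simp: carrier_free_group)
  show "word_eval G f w \<in> carrier G" if "w \<in> carrier (free_group X)" for w
    using *[OF that] by simp
  show "word_eval G f (u \<otimes>\<^bsub>free_group X\<^esub> v) = word_eval G f u \<otimes> word_eval G f v"
    if "u \<in> carrier (free_group X)" "v \<in> carrier (free_group X)" for u v
    using *[OF that(1)] *[OF that(2)] word_eval_foldr_prepend[of u v f] by auto
qed

lemma word_eval_gen [simp]: "f x \<in> carrier G \<Longrightarrow> word_eval G f (gen x) = f x"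
  by (simp add: gen_def word_eval_Cons)

text \<open>Uniqueness half of the universal property: a monomorphism given abstractly on
  \<open>F n\<close> is recovered from the tuple of its values on the generators, and it is this
  tuple that gets perturbed.\<close>

lemma hom_eq_word_eval:
  assumes h: "h \<in> hom (free_group X) G" and w: "w \<in> carrier (free_group X)"
  shows "h w = word_eval G (\<lambda>x. h (gen x)) w"
  using w
proof (induction w)
  case Nil
  interpret h: group_hom "free_group X" G h
    using h group_free_group is_group by (simp add: group_hom_def group_hom_axioms_def)
  show ?case using h.hom_one by simp
next
  case (Cons l w)
  interpret h: group_hom "free_group X" G h
    using h group_free_group is_group by (simp add: group_hom_def group_hom_axioms_def)
  have w: "w \<in> carrier (free_group X)" and l: "[l] \<in> carrier (free_group X)"
    using Cons.prems by (auto simp: reduced_word_Cons carrier_free_group)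
  have "l # w = [l] \<otimes>\<^bsub>free_group X\<^esub> w"
    using Cons.prems by (auto simp: prepend_def reduced_word_Cons carrier_free_group)
  then have "h (l # w) = h [l] \<otimes> h w"
    using w l h.hom_mult by metis
  moreover have "h [l] = (if snd l then h (gen (fst l)) else inv h (gen (fst l)))"
  proof (cases "snd l")
    case True
    then show ?thesis by (cases l) (simp add: gen_def)
  next
    case False
    then have "[l] = inv\<^bsub>free_group X\<^esub> gen (fst l)"
      using l by (cases l) (simp add: inv_free_group_gen carrier_free_group)
    moreover have "gen (fst l) \<in> carrier (free_group X)"
      using l by (simp add: carrier_free_group gen_def reduced_word_def)
    ultimately show ?thesis
      using False h.hom_inv[of "gen (fst l)"] by simp
  qed
  ultimately show ?case
    using Cons.IH w by (simp add: word_eval_Cons)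
qed

end

lemma word_eval_cong:
  assumes "\<And>l. l \<in> set w \<Longrightarrow> f (fst l) = g (fst l)"
  shows "word_eval G f w = word_eval G g w"
  using assms by (induction w) (auto simp: word_eval_def)

lemma word_eval_comp:
  assumes "group G" "group H" "h \<in> hom G H" "\<And>l. l \<in> set w \<Longrightarrow> f (fst l) \<in> carrier G"
  shows "h (word_eval G f w) = word_eval H (h \<circ> f) w"
  using assms(4)
proof (induction w)
  case Nil
  interpret group_hom G H h using assms by (simp add: group_hom_def group_hom_axioms_def)
  show ?case by simp
next
  case (Cons l w)
  interpret group_hom G H h using assms by (simp add: group_hom_def group_hom_axioms_def)
  show ?case using Cons by (simp add: G.word_eval_Cons H.word_eval_Cons)
qed


section \<open>Bi-invariant metrics\<close>

locale bi_metric_group = group G for G (structure) +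
  fixes d
  assumes bi_invariant: "bi_invariant_metric G d"
begin

sublocale Metric_space "carrier G" d
  using bi_invariant by (simp add: bi_invariant_metric_def)

lemma d_mult_left:
  assumes "x \<in> carrier G" "a \<in> carrier G" "b \<in> carrier G"
  shows "d (x \<otimes> a) (x \<otimes> b) = d a b"
proof -
  have "d (x \<otimes> a \<otimes> \<one>) (x \<otimes> b \<otimes> \<one>) = d a b"
    using bi_invariant assms unfolding bi_invariant_metric_def by blast
  then show ?thesis using assms by simp
qed

lemma d_mult_right:
  assumes "x \<in> carrier G" "a \<in> carrier G" "b \<in> carrier G"
  shows "d (a \<otimes> x) (b \<otimes> x) = d a b"
proof -
  have "d (\<one> \<otimes> a \<otimes> x) (\<one> \<otimes> b \<otimes> x) = d a b"
    using bi_invariant assms unfolding bi_invariant_metric_def by blast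
  then show ?thesis using assms by simp
qed

lemma d_mult_le:
  assumes "a \<in> carrier G" "b \<in> carrier G" "a' \<in> carrier G" "b' \<in> carrier G"
  shows "d (a \<otimes> b) (a' \<otimes> b') \<le> d a a' + d b b'"
  using triangle[of "a \<otimes> b" "a' \<otimes> b" "a' \<otimes> b'"] assms
  by (simp add: d_mult_left d_mult_right)

lemma d_norm:
  assumes "a \<in> carrier G" "b \<in> carrier G"
  shows "d a b = d (inv b \<otimes> a) \<one>" "d a b = d (a \<otimes> inv b) \<one>" "d a b = d \<one> (inv a \<otimes> b)"
    "d a b = d \<one> (b \<otimes> inv a)"
  using assms d_mult_left[of "inv b" a b] d_mult_right[of "inv b" a b]
    d_mult_left[of "inv a" a b] d_mult_right[of "inv a" a b] by simp_all

lemma d_inv: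
  assumes "a \<in> carrier G" "b \<in> carrier G"
  shows "d (inv a) (inv b) = d a b"
  using assms d_norm(1)[of a b] d_mult_right[of a "inv b" "inv a"] commute by simp

lemma norm_diff_le:
  assumes "x \<in> carrier G" "y \<in> carrier G"
  shows "\<bar>d x \<one> - d y \<one>\<bar> \<le> d x y"
  using triangle[OF assms one_closed] triangle[OF assms(2,1) one_closed] commute[of x y] by linarith

text \<open>Under a bi-invariant metric errors in the factors of a product add up and inversion is
  isometric, so each letter contributes at most \<open>c\<close>. This explains why
  \<open>metric_dist\<close> is normalised by word length.\<close>

lemma word_eval_dist_le:
  assumes "\<And>l. l \<in> set w \<Longrightarrow> f (fst l) \<in> carrier G \<and> g (fst l) \<in> carrier G \<and> d (f (fst l)) (g (fst l)) \<le> c"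
  shows "d (word_eval G f w) (word_eval G g w) \<le> c * real (length w)"
  using assms
proof (induction w)
  case (Cons l w)
  let ?f = "if snd l then f (fst l) else inv f (fst l)"
  let ?g = "if snd l then g (fst l) else inv g (fst l)"
  have l: "f (fst l) \<in> carrier G" "g (fst l) \<in> carrier G" "d (f (fst l)) (g (fst l)) \<le> c"
    using Cons.prems by auto
  have "d (?f \<otimes> word_eval G f w) (?g \<otimes> word_eval G g w)
      \<le> d ?f ?g + d (word_eval G f w) (word_eval G g w)"
    using l Cons.prems by (intro d_mult_le) auto
  also have "d ?f ?g \<le> c"
    using l by (simp add: d_inv)
  also have "d (word_eval G f w) (word_eval G g w) \<le> c * real (length w)"
    using Cons by auto
  finally show ?case by (simp add: word_eval_Cons algebra_simps)
qed simp

end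

lemma metric_dist_less:
  assumes "0 < e" "\<And>g. g \<in> carrier (F n) \<Longrightarrow> \<bar>p g [] - q g []\<bar> \<le> e * real (length g)" "e < c"
  shows "metric_dist n p q < c"
proof -
  have "metric_dist n p q \<le> e"
    unfolding metric_dist_def using assms
    by (intro cInf_lower bdd_belowI[of _ 0]) (auto simp: F_def)
  then show ?thesis using assms by simp
qed

text \<open>The infimum is informative only for a nonempty set; 1 is a member because nontrivial
  words have length at least 1 and both values lie in [0,1]. Strictness then yields an admissible
  constant below \<open>c\<close>, and the gap to \<open>c\<close> is the slack spent in later
  approximations.\<close>

lemma metric_dist_lessD:
  assumes "metric_dist n p q < c" "\<And>g. g \<in> carrier (F n) \<Longrightarrow> 0 \<le> p g [] \<and> p g [] \<le> 1"
    "\<And>g. g \<in> carrier (F n) \<Longrightarrow> 0 \<le> q g [] \<and> q g [] \<le> 1" "p [] [] = q [] []"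
  obtains e where "0 < e" "e < c"
    "\<And>g. g \<in> carrier (F n) \<Longrightarrow> \<bar>p g [] - q g []\<bar> \<le> e * real (length g)"
proof -
  let ?S = "{e. e > 0 \<and> (\<forall>g\<in>carrier (F n). \<bar>p g \<one>\<^bsub>F n\<^esub> - q g \<one>\<^bsub>F n\<^esub>\<bar> \<le> e * real (length g))}"
  have "\<bar>p g [] - q g []\<bar> \<le> 1 * real (length g)" if "g \<in> carrier (F n)" for g
  proof (cases "g = []")
    case False
    then have "1 \<le> real (length g)" by (cases g) auto
    then show ?thesis using assms(2,3)[OF that] by linarith
  qed (simp add: assms)
  then have "1 \<in> ?S" by (auto simp: F_def)
  then obtain e where "e \<in> ?S" "e < c"
    using assms(1) cInf_lessD[of ?S c] unfolding metric_dist_def by blast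
  then show ?thesis using that by (auto simp: F_def)
qed

section \<open>Amalgamation of bi-invariant metrics\<close>

text \<open>Indexing the two groups by \<open>bool\<close> makes every argument for one side an
  argument for the other. \<open>M\<close> is mapped into both groups, \<open>len v\<close> is the
  price of exchanging the two images of \<open>v\<close>, and \<open>norm_le\<close> says that an
  exchange changes a norm by no more than this price.\<close>

locale metric_amalgam =
  fixes G :: "bool \<Rightarrow> 'g monoid" and D :: "bool \<Rightarrow> 'g \<Rightarrow> 'g \<Rightarrow> real"
    and M :: "'m monoid" and p :: "bool \<Rightarrow> 'm \<Rightarrow> 'g" and len :: "'m \<Rightarrow> real"
  assumes bi_metric_group: "bi_metric_group (G s) (D s)"
    and group_M: "group M"
    and p_hom: "p s \<in> hom M (G s)"
    and len_one: "len \<one>\<^bsub>M\<^esub> = 0"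
    and len_inv: "v \<in> carrier M \<Longrightarrow> len (inv\<^bsub>M\<^esub> v) = len v"
    and len_mult: "\<lbrakk>v \<in> carrier M; w \<in> carrier M\<rbrakk> \<Longrightarrow> len (v \<otimes>\<^bsub>M\<^esub> w) \<le> len v + len w"
    and norm_le: "v \<in> carrier M \<Longrightarrow>
      D s \<one>\<^bsub>G s\<^esub> (p s v) \<le> D (\<not> s) \<one>\<^bsub>G (\<not> s)\<^esub> (p (\<not> s) v) + len v"
begin

sublocale M: group M by (rule group_M)
sublocale G: bi_metric_group "G s" "D s" for s by (rule bi_metric_group)
sublocale p: group_hom M "G s" "p s" for s
  using p_hom group_M G.is_group by (simp add: group_hom_def group_hom_axioms_def)

text \<open>\<open>deriv s w g c\<close>: the word \<open>w\<close> over the disjoint union of the two groups can be turned into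
  the element \<open>g\<close> of \<open>G s\<close> at cost \<open>c\<close>, by evaluating nested subwords. A subword may be evaluated
  on the other side, to \<open>p (\<not> s) v\<close>, and then be transferred to \<open>p s v\<close> at cost \<open>len v\<close>;
  derivations thus encode planar diagrams whose regions belong to one of the two groups.
  The key point is invariance under merging adjacent letters (\<open>deriv_merge\<close>): it makes the cost
  depend only on the product of \<open>w\<close> in the free product, whereas the cost of turning a
  single letter into \<open>g\<close> is bounded below by a distance because of \<open>norm_le\<close>.\<close>

inductive deriv :: "bool \<Rightarrow> (bool \<times> 'g) list \<Rightarrow> 'g \<Rightarrow> real \<Rightarrow> bool" where
  nil: "g \<in> carrier (G s) \<Longrightarrow> D s \<one>\<^bsub>G s\<^esub> g \<le> c \<Longrightarrow> deriv s [] g c"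
| single: "x \<in> carrier (G s) \<Longrightarrow> g \<in> carrier (G s) \<Longrightarrow> D s x g \<le> c \<Longrightarrow> deriv s [(s, x)] g c"
| concat: "deriv s u g a \<Longrightarrow> deriv s v h b \<Longrightarrow> deriv s (u @ v) (g \<otimes>\<^bsub>G s\<^esub> h) (a + b)"
| convert: "deriv (\<not> s) w (p (\<not> s) v) c \<Longrightarrow> v \<in> carrier M \<Longrightarrow> deriv s w (p s v) (c + len v)"

lemma deriv_closed: "deriv s w g c \<Longrightarrow> g \<in> carrier (G s)"
  by (induction rule: deriv.induct) auto

text \<open>The calculus has no weakening rule; surplus cost is spent on deriving the unit from an
  appended empty word.\<close>

lemma deriv_concat':
  assumes "deriv s u g a" "deriv s v h b" "k = g \<otimes>\<^bsub>G s\<^esub> h" "a + b \<le> c" "w = u @ v"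
  shows "deriv s w k c"
proof -
  have "deriv s [] \<one>\<^bsub>G s\<^esub> (c - (a + b))"
    using assms by (intro nil) auto
  with concat[OF assms(1,2)] have "deriv s ((u @ v) @ []) (g \<otimes>\<^bsub>G s\<^esub> h \<otimes>\<^bsub>G s\<^esub> \<one>\<^bsub>G s\<^esub>) (a + b + (c - (a + b)))"
    by (rule concat)
  then show ?thesis using assms deriv_closed[OF assms(1)] deriv_closed[OF assms(2)] by simp
qed

lemma deriv_mono: "deriv s w g a \<Longrightarrow> a \<le> c \<Longrightarrow> deriv s w g c"
  using deriv_concat'[of s w g a "[]" "\<one>\<^bsub>G s\<^esub>" 0] nil[of "\<one>\<^bsub>G s\<^esub>" s 0] deriv_closed[of s w g a]
  by simp

text \<open>Concatenation corresponds to subadditivity of the norm, and a conversion to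
  \<open>norm_le\<close>, which enters here.\<close>

lemma deriv_Nil_sound: "deriv s w g c \<Longrightarrow> w = [] \<Longrightarrow> D s \<one>\<^bsub>G s\<^esub> g \<le> c"
proof (induction rule: deriv.induct)
  case (concat s u g a v h b)
  then have "D s (\<one>\<^bsub>G s\<^esub> \<otimes>\<^bsub>G s\<^esub> \<one>\<^bsub>G s\<^esub>) (g \<otimes>\<^bsub>G s\<^esub> h) \<le> a + b"
    using G.d_mult_le[of "\<one>\<^bsub>G s\<^esub>" s "\<one>\<^bsub>G s\<^esub>" g h] deriv_closed by fastforce
  then show ?case by simp
next
  case (convert s w v c)
  then show ?case using norm_le[of v s] by simp
qed auto

text \<open>Inversion reverses products and preserves both \<open>D\<close> and \<open>len\<close>,
  so derivations can be mirrored. This turns statements about the last letter of a word into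
  statements about the first.\<close>

lemma deriv_inv:
  "deriv s w g c \<Longrightarrow> deriv s (rev (map (\<lambda>(t, x). (t, inv\<^bsub>G t\<^esub> x)) w)) (inv\<^bsub>G s\<^esub> g) c"
proof (induction rule: deriv.induct)
  case (nil g s c)
  then show ?case using G.d_inv[of "\<one>\<^bsub>G s\<^esub>" s g] by (auto intro!: deriv.nil)
next
  case (single x s g c)
  then show ?case by (auto intro!: deriv.single simp: G.d_inv)
next
  case (concat s u g a v h b)
  then show ?case
    using deriv_closed[OF concat.hyps(1)] deriv_closed[OF concat.hyps(2)]
    by (intro deriv_concat'[OF concat.IH(2,1)]) (auto simp: G.inv_mult_group)
next
  case (convert s w v c)
  have "deriv s (rev (map (\<lambda>(t, x). (t, inv\<^bsub>G t\<^esub> x)) w)) (p s (inv\<^bsub>M\<^esub> v)) (c + len (inv\<^bsub>M\<^esub> v))"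
    using convert by (intro deriv.convert) auto
  then show ?case using convert by (simp add: len_inv)
qed

text \<open>The final letter, of type \<open>s\<close>, can be evaluated at the top level of the derivation if
  \<open>t = s\<close>, and directly below a single top-level conversion otherwise.\<close>

lemma deriv_snoc:
  assumes "deriv t W g c" "W = w @ [(s, x)]"
  shows "(t = s \<longrightarrow> (\<exists>g' g'' c'. deriv s w g' c' \<and> g'' \<in> carrier (G s) \<and>
            g = g' \<otimes>\<^bsub>G s\<^esub> g'' \<and> c' + D s x g'' \<le> c)) \<and>
         (t \<noteq> s \<longrightarrow> (\<exists>w0 w1 g0 c0 v g' g'' c1. w = w0 @ w1 \<and> deriv t w0 g0 c0 \<and> v \<in> carrier M \<and>
            g = g0 \<otimes>\<^bsub>G t\<^esub> p t v \<and> deriv s w1 g' c1 \<and> g'' \<in> carrier (G s) \<and>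
            p s v = g' \<otimes>\<^bsub>G s\<^esub> g'' \<and> c0 + c1 + D s x g'' + len v \<le> c)) \<and> x \<in> carrier (G s)"
  using assms
proof (induction arbitrary: w s x rule: deriv.induct)
  case (nil g s c)
  then show ?case by simp
next
  case (single y t g c)
  then have "deriv s w \<one>\<^bsub>G s\<^esub> 0" "g = \<one>\<^bsub>G s\<^esub> \<otimes>\<^bsub>G s\<^esub> g" "0 + D s x g \<le> c" "t = s"
    "g \<in> carrier (G s)" "x \<in> carrier (G s)"
    by (auto intro!: deriv.nil)
  then show ?case by blast
next
  case (concat t u g a v h b)
  have gh: "g \<in> carrier (G t)" "h \<in> carrier (G t)"
    using concat.hyps deriv_closed by auto
  show ?case
  proof (cases "v = []")
    case True
    then have u: "u = w @ [(s, x)]" using concat.prems by simp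
    have h: "D t \<one>\<^bsub>G t\<^esub> h \<le> b" using deriv_Nil_sound[OF concat.hyps(2)] True by simp
    note IH = concat.IH(1)[OF u]
    show ?thesis
    proof (cases "t = s")
      case [simp]: True
      from IH obtain g' g'' c' where *: "deriv s w g' c'" "g'' \<in> carrier (G s)"
        "g = g' \<otimes>\<^bsub>G s\<^esub> g''" "c' + D s x g'' \<le> a" "x \<in> carrier (G s)" by auto
      have g': "g' \<in> carrier (G s)" using * deriv_closed by auto
      have "D s (x \<otimes>\<^bsub>G s\<^esub> \<one>\<^bsub>G s\<^esub>) (g'' \<otimes>\<^bsub>G s\<^esub> h) \<le> D s x g'' + D s \<one>\<^bsub>G s\<^esub> h"
        using * gh by (intro G.d_mult_le) auto
      then have "c' + D s x (g'' \<otimes>\<^bsub>G s\<^esub> h) \<le> a + b" using * h by simp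
      then have "\<exists>g' g'' c'. deriv s w g' c' \<and> g'' \<in> carrier (G s) \<and>
            g \<otimes>\<^bsub>G s\<^esub> h = g' \<otimes>\<^bsub>G s\<^esub> g'' \<and> c' + D s x g'' \<le> a + b"
        using * gh g' by (intro exI[of _ g'] exI[of _ "g'' \<otimes>\<^bsub>G s\<^esub> h"] exI[of _ c']) (auto simp: G.m_assoc)
      then show ?thesis using * by simp
    next
      case False
      with IH obtain w0 w1 g0 c0 v1 g' g'' c1 where *: "w = w0 @ w1" "deriv t w0 g0 c0"
        "v1 \<in> carrier M" "g = g0 \<otimes>\<^bsub>G t\<^esub> p t v1" "deriv s w1 g' c1" "g'' \<in> carrier (G s)"
        "p s v1 = g' \<otimes>\<^bsub>G s\<^esub> g''" "c0 + c1 + D s x g'' + len v1 \<le> a" "x \<in> carrier (G s)" by blast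
      have g0: "g0 \<in> carrier (G t)" using * deriv_closed by auto
      \<comment> \<open>The factor \<open>h\<close>, derived from the empty word, stands to the
        right of the conversion that contains the last letter. Conjugation moves it to the left of
        that conversion, and bi-invariance keeps its norm.\<close>
      let ?k = "p t v1 \<otimes>\<^bsub>G t\<^esub> h \<otimes>\<^bsub>G t\<^esub> inv\<^bsub>G t\<^esub> p t v1"
      have "D t (p t v1 \<otimes>\<^bsub>G t\<^esub> \<one>\<^bsub>G t\<^esub> \<otimes>\<^bsub>G t\<^esub> inv\<^bsub>G t\<^esub> p t v1) ?k = D t \<one>\<^bsub>G t\<^esub> h"
        using * gh by (simp only: G.d_mult_left G.d_mult_right G.inv_closed G.m_closed G.one_closed p.hom_closed)
      then have "D t \<one>\<^bsub>G t\<^esub> ?k \<le> b" using h * by simp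
      then have dk: "deriv t [] ?k b" using * gh by (intro deriv.nil) auto
      have "deriv t w0 (g0 \<otimes>\<^bsub>G t\<^esub> ?k) (c0 + b)"
        using deriv.concat[OF *(2) dk] by simp
      moreover have "g \<otimes>\<^bsub>G t\<^esub> h = (g0 \<otimes>\<^bsub>G t\<^esub> ?k) \<otimes>\<^bsub>G t\<^esub> p t v1"
        using * gh g0 by (simp add: G.m_assoc)
      moreover have "(c0 + b) + c1 + D s x g'' + len v1 \<le> a + b" using * by simp
      ultimately show ?thesis using * False by blast
    qed
  next
    case False
    then obtain v0 where v: "v = v0 @ [(s, x)]" "w = u @ v0"
      using concat.prems by (metis append_assoc append_butlast_last_id butlast_append last_appendR snoc_eq_iff_butlast)
    note IH = concat.IH(2)[OF v(1)]
    show ?thesis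
    proof (cases "t = s")
      case [simp]: True
      from IH obtain g' g'' c' where *: "deriv s v0 g' c'" "g'' \<in> carrier (G s)"
        "h = g' \<otimes>\<^bsub>G s\<^esub> g''" "c' + D s x g'' \<le> b" "x \<in> carrier (G s)" by auto
      have g': "g' \<in> carrier (G s)" using * deriv_closed by auto
      have "deriv s w (g \<otimes>\<^bsub>G s\<^esub> g') (a + c')"
        using deriv.concat[OF concat.hyps(1)] * v by simp
      moreover have "g \<otimes>\<^bsub>G s\<^esub> h = (g \<otimes>\<^bsub>G s\<^esub> g') \<otimes>\<^bsub>G s\<^esub> g''" using * g' gh by (simp add: G.m_assoc)
      moreover have "(a + c') + D s x g'' \<le> a + b" using * by simp
      ultimately have "\<exists>g' g'' c'. deriv s w g' c' \<and> g'' \<in> carrier (G s) \<and>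
            g \<otimes>\<^bsub>G s\<^esub> h = g' \<otimes>\<^bsub>G s\<^esub> g'' \<and> c' + D s x g'' \<le> a + b"
        using *(2) by blast
      then show ?thesis using * by simp
    next
      case False
      with IH obtain w0 w1 g0 c0 v1 g' g'' c1 where *: "v0 = w0 @ w1" "deriv t w0 g0 c0"
        "v1 \<in> carrier M" "h = g0 \<otimes>\<^bsub>G t\<^esub> p t v1" "deriv s w1 g' c1" "g'' \<in> carrier (G s)"
        "p s v1 = g' \<otimes>\<^bsub>G s\<^esub> g''" "c0 + c1 + D s x g'' + len v1 \<le> b" "x \<in> carrier (G s)" by blast
      have g0: "g0 \<in> carrier (G t)" using * deriv_closed by auto
      have "deriv t (u @ w0) (g \<otimes>\<^bsub>G t\<^esub> g0) (a + c0)"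
        using deriv.concat[OF concat.hyps(1) *(2)] .
      moreover have "g \<otimes>\<^bsub>G t\<^esub> h = (g \<otimes>\<^bsub>G t\<^esub> g0) \<otimes>\<^bsub>G t\<^esub> p t v1" using * g0 gh by (simp add: G.m_assoc)
      moreover have "(a + c0) + c1 + D s x g'' + len v1 \<le> a + b" using * by simp
      moreover have "w = (u @ w0) @ w1" using v * by simp
      ultimately show ?thesis using * False by blast
    qed
  qed
next
  case (convert t W v c)
  note IH = convert.IH[OF convert.prems]
  show ?case
  proof (cases "t = s")
    case True
    then have neq: "(\<not> t) \<noteq> s" by simp
    obtain w0 w1 g0 c0 v1 g' g'' c1 where *: "w = w0 @ w1" "deriv (\<not> t) w0 g0 c0"
      "v1 \<in> carrier M" "p (\<not> t) v = g0 \<otimes>\<^bsub>G (\<not> t)\<^esub> p (\<not> t) v1" "deriv s w1 g' c1"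
      "g'' \<in> carrier (G s)" "p s v1 = g' \<otimes>\<^bsub>G s\<^esub> g''" "c0 + c1 + D s x g'' + len v1 \<le> c"
      using conjunct1[OF conjunct2[OF IH], THEN mp, OF neq] by (elim exE conjE) blast
    note * = *[unfolded True] conjunct2[OF conjunct2[OF IH]]
    \<comment> \<open>Two nested conversions collapse: \<open>g0\<close> is the image of
      \<open>?v\<close> on the other side, so the prefix \<open>w0\<close> can be converted by
      itself. The prices \<open>len v\<close> and \<open>len v1\<close> together cover this single
      conversion.\<close>
    let ?v = "v \<otimes>\<^bsub>M\<^esub> inv\<^bsub>M\<^esub> v1"
    have g: "g0 \<in> carrier (G (\<not> s))" "g' \<in> carrier (G s)" using * deriv_closed by auto
    have v: "v \<in> carrier M" "?v \<in> carrier M" using * convert by auto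
    have "g0 = p (\<not> s) ?v"
      using * g v by (simp add: G.m_assoc)
    then have "deriv s w0 (p s ?v) (c0 + len ?v)"
      using * v by (intro deriv.convert) auto
    then have "deriv s w (p s ?v \<otimes>\<^bsub>G s\<^esub> g') (c0 + len ?v + c1)"
      using deriv.concat * by blast
    moreover have "p s v = p s ?v \<otimes>\<^bsub>G s\<^esub> g' \<otimes>\<^bsub>G s\<^esub> g''"
    proof -
      have "v = ?v \<otimes>\<^bsub>M\<^esub> v1" using v * by (simp add: M.m_assoc)
      then have "p s v = p s ?v \<otimes>\<^bsub>G s\<^esub> p s v1" using v * by (metis p.hom_mult)
      then show ?thesis using * g v by (simp add: G.m_assoc del: p.hom_mult)
    qed
    moreover have "len ?v \<le> len v + len v1"
      using len_mult[of v "inv\<^bsub>M\<^esub> v1"] v * len_inv by simp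
    ultimately have "\<exists>g' g'' c'. deriv s w g' c' \<and> g'' \<in> carrier (G s) \<and>
            p s v = g' \<otimes>\<^bsub>G s\<^esub> g'' \<and> c' + D s x g'' \<le> c + len v"
      using *(6,8)
      by (intro exI[of _ "p s ?v \<otimes>\<^bsub>G s\<^esub> g'"] exI[of _ "g''"] exI[of _ "c0 + len ?v + c1"]) simp
    then show ?thesis using True *(9) by simp
  next
    case False
    then have t [simp]: "t = (\<not> s)" by auto
    from IH obtain g' g'' c' where *: "deriv s w g' c'" "g'' \<in> carrier (G s)"
      "p s v = g' \<otimes>\<^bsub>G s\<^esub> g''" "c' + D s x g'' \<le> c" "x \<in> carrier (G s)" by auto
    have "deriv t [] \<one>\<^bsub>G t\<^esub> 0" by (intro deriv.nil) auto
    then have "\<exists>w0 w1 g0 c0 v' g' g'' c1. w = w0 @ w1 \<and> deriv t w0 g0 c0 \<and> v' \<in> carrier M \<and>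
            p t v = g0 \<otimes>\<^bsub>G t\<^esub> p t v' \<and> deriv s w1 g' c1 \<and> g'' \<in> carrier (G s) \<and>
            p s v' = g' \<otimes>\<^bsub>G s\<^esub> g'' \<and> c0 + c1 + D s x g'' + len v' \<le> c + len v"
      using *(1-4) convert.hyps(2)
      by (rule_tac exI[of _ "[]"], rule_tac exI[of _ w], rule_tac exI[of _ "\<one>\<^bsub>G t\<^esub>"],
          rule_tac exI[of _ 0], rule_tac exI[of _ v], rule_tac exI[of _ g'], rule_tac exI[of _ g''],
          rule_tac exI[of _ c']) simp
    then show ?thesis using *(5) False by simp
  qed
qed

lemma deriv_letters: "deriv t w g c \<Longrightarrow> (s, x) \<in> set w \<Longrightarrow> x \<in> carrier (G s)"
  by (induction rule: deriv.induct) auto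

definition word_inv :: "(bool \<times> 'g) list \<Rightarrow> (bool \<times> 'g) list" where
  "word_inv w = rev (map (\<lambda>(t, x). (t, inv\<^bsub>G t\<^esub> x)) w)"

lemma word_inv_word_inv:
  "(\<And>s x. (s, x) \<in> set w \<Longrightarrow> x \<in> carrier (G s)) \<Longrightarrow> word_inv (word_inv w) = w"
  by (induction w) (auto simp: word_inv_def)

text \<open>This is \<open>deriv_snoc\<close> for the inverse word.\<close>

lemma deriv_Cons:
  assumes "deriv t ((s, x) # w) g c"
  shows "(t = s \<longrightarrow> (\<exists>g' g'' c'. deriv s w g' c' \<and> g'' \<in> carrier (G s) \<and>
            g = g'' \<otimes>\<^bsub>G s\<^esub> g' \<and> c' + D s x g'' \<le> c)) \<and>
         (t \<noteq> s \<longrightarrow> (\<exists>w0 w1 g0 c0 v g' g'' c1. w = w1 @ w0 \<and> deriv t w0 g0 c0 \<and> v \<in> carrier M \<and>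
            g = p t v \<otimes>\<^bsub>G t\<^esub> g0 \<and> deriv s w1 g' c1 \<and> g'' \<in> carrier (G s) \<and>
            p s v = g'' \<otimes>\<^bsub>G s\<^esub> g' \<and> c0 + c1 + D s x g'' + len v \<le> c)) \<and> x \<in> carrier (G s)"
proof -
  have x: "x \<in> carrier (G s)" using deriv_letters[OF assms] by simp
  have g: "g \<in> carrier (G t)" using deriv_closed[OF assms] .
  have w: "word_inv (word_inv w) = w"
    using deriv_letters[OF assms] by (intro word_inv_word_inv) auto
  have inv: "deriv r (word_inv u) (inv\<^bsub>G r\<^esub> h) e" if "deriv r u h e" for r u h e
    using deriv_inv[OF that] by (simp add: word_inv_def)
  have "deriv t (word_inv ((s, x) # w)) (inv\<^bsub>G t\<^esub> g) c"
    using inv[OF assms] .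
  moreover have "word_inv ((s, x) # w) = word_inv w @ [(s, inv\<^bsub>G s\<^esub> x)]"
    by (simp add: word_inv_def)
  ultimately have *: "(t = s \<longrightarrow> (\<exists>g' g'' c'. deriv s (word_inv w) g' c' \<and> g'' \<in> carrier (G s) \<and>
            inv\<^bsub>G t\<^esub> g = g' \<otimes>\<^bsub>G s\<^esub> g'' \<and> c' + D s (inv\<^bsub>G s\<^esub> x) g'' \<le> c)) \<and>
         (t \<noteq> s \<longrightarrow> (\<exists>w0 w1 g0 c0 v g' g'' c1. word_inv w = w0 @ w1 \<and> deriv t w0 g0 c0 \<and> v \<in> carrier M \<and>
            inv\<^bsub>G t\<^esub> g = g0 \<otimes>\<^bsub>G t\<^esub> p t v \<and> deriv s w1 g' c1 \<and> g'' \<in> carrier (G s) \<and>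
            p s v = g' \<otimes>\<^bsub>G s\<^esub> g'' \<and> c0 + c1 + D s (inv\<^bsub>G s\<^esub> x) g'' + len v \<le> c))"
    using deriv_snoc by blast
  have Dinv: "D s (inv\<^bsub>G s\<^esub> x) g'' = D s x (inv\<^bsub>G s\<^esub> g'')" if "g'' \<in> carrier (G s)" for g''
    using G.d_inv[of "inv\<^bsub>G s\<^esub> x" s g''] that x by simp
  show ?thesis
  proof (cases "t = s")
    case True
    with * obtain g' g'' c' where 1: "deriv s (word_inv w) g' c'" "g'' \<in> carrier (G s)"
            "inv\<^bsub>G t\<^esub> g = g' \<otimes>\<^bsub>G s\<^esub> g''" "c' + D s (inv\<^bsub>G s\<^esub> x) g'' \<le> c" by blast
    have "g' \<in> carrier (G s)" using 1 deriv_closed by blast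
    moreover have "g = inv\<^bsub>G s\<^esub> (g' \<otimes>\<^bsub>G s\<^esub> g'')" 
      using arg_cong[OF 1(3), of "m_inv (G t)"] G.inv_inv[OF g] True by simp
    ultimately have "g = inv\<^bsub>G s\<^esub> g'' \<otimes>\<^bsub>G s\<^esub> inv\<^bsub>G s\<^esub> g'"
      using 1 by (simp add: G.inv_mult_group)
    moreover have "deriv s w (inv\<^bsub>G s\<^esub> g') c'" using inv[OF 1(1)] w by simp
    moreover have "inv\<^bsub>G s\<^esub> g'' \<in> carrier (G s)" "c' + D s x (inv\<^bsub>G s\<^esub> g'') \<le> c"
      using 1 Dinv by auto
    ultimately show ?thesis using x True by blast
  next
    case False
    with * obtain w0 w1 g0 c0 v g' g'' c1 where 1: "word_inv w = w0 @ w1" "deriv t w0 g0 c0"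
      "v \<in> carrier M" "inv\<^bsub>G t\<^esub> g = g0 \<otimes>\<^bsub>G t\<^esub> p t v" "deriv s w1 g' c1" "g'' \<in> carrier (G s)"
      "p s v = g' \<otimes>\<^bsub>G s\<^esub> g''" "c0 + c1 + D s (inv\<^bsub>G s\<^esub> x) g'' + len v \<le> c" by blast
    have g0: "g0 \<in> carrier (G t)" and g': "g' \<in> carrier (G s)" using 1 deriv_closed by auto
    have "g = inv\<^bsub>G t\<^esub> (g0 \<otimes>\<^bsub>G t\<^esub> p t v)"
      using arg_cong[OF 1(4), of "m_inv (G t)"] G.inv_inv[OF g] by simp
    then have 2: "g = p t (inv\<^bsub>M\<^esub> v) \<otimes>\<^bsub>G t\<^esub> inv\<^bsub>G t\<^esub> g0"
      using 1 g0 by (simp add: G.inv_mult_group)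
    have 3: "p s (inv\<^bsub>M\<^esub> v) = inv\<^bsub>G s\<^esub> g'' \<otimes>\<^bsub>G s\<^esub> inv\<^bsub>G s\<^esub> g'"
      using 1 g' by (simp add: G.inv_mult_group)
    have 4: "w = word_inv w1 @ word_inv w0"
      using w 1(1) by (simp add: word_inv_def)
    have 5: "c0 + c1 + D s x (inv\<^bsub>G s\<^esub> g'') + len (inv\<^bsub>M\<^esub> v) \<le> c"
      using 1 Dinv len_inv by simp
    have "\<exists>w0 w1 g0 c0 v g' g'' c1. w = w1 @ w0 \<and> deriv t w0 g0 c0 \<and> v \<in> carrier M \<and>
            g = p t v \<otimes>\<^bsub>G t\<^esub> g0 \<and> deriv s w1 g' c1 \<and> g'' \<in> carrier (G s) \<and>
            p s v = g'' \<otimes>\<^bsub>G s\<^esub> g' \<and> c0 + c1 + D s x g'' + len v \<le> c"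
      by (rule exI[of _ "word_inv w0"], rule exI[of _ "word_inv w1"], rule exI[of _ "inv\<^bsub>G t\<^esub> g0"],
          rule exI[of _ c0], rule exI[of _ "inv\<^bsub>M\<^esub> v"], rule exI[of _ "inv\<^bsub>G s\<^esub> g'"],
          rule exI[of _ "inv\<^bsub>G s\<^esub> g''"], rule exI[of _ c1], intro conjI)
        (fact 2 3 4 5 inv[OF 1(2)] inv[OF 1(5)] M.inv_closed[OF 1(3)] G.inv_closed[OF 1(6)])+
    then show ?thesis using x False by simp
  qed
qed

text \<open>Only a concatenation whose boundary separates the two letters needs an argument. There
  \<open>deriv_snoc\<close> and \<open>deriv_Cons\<close> expose both letters. If the derivation
  lives on the other side, each letter sits below one conversion, by \<open>v1\<close> and by
  \<open>v2\<close>; these fuse into one conversion by the product, which costs no more because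
  \<open>len\<close> is subadditive.\<close>

lemma deriv_merge:
  assumes "deriv t W g c" "W = u @ (s, x) # (s, y) # v"
  shows "deriv t (u @ (s, x \<otimes>\<^bsub>G s\<^esub> y) # v) g c"
  using assms
proof (induction arbitrary: u v rule: deriv.induct)
  case (concat t u1 g a v1 h b)
  have gh: "g \<in> carrier (G t)" "h \<in> carrier (G t)"
    using concat.hyps deriv_closed by auto
  consider us where "u1 = u @ (s, x) # (s, y) # us" "v = us @ v1"
    | us where "u = u1 @ us" "v1 = us @ (s, x) # (s, y) # v"
    | "u1 = u @ [(s, x)]" "v1 = (s, y) # v"
    using concat.prems
    by (auto simp: append_eq_append_conv2 append_eq_Cons_conv Cons_eq_append_conv)
  then show ?case
  proof cases
    case 1
    then show ?thesis using concat.IH(1)[OF 1(1)] deriv.concat[OF _ concat.hyps(2)] by fastforce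
  next
    case 2
    then show ?thesis using concat.IH(2)[OF 2(2)] deriv.concat[OF concat.hyps(1)] by fastforce
  next
    case 3
    note R = deriv_snoc[OF concat.hyps(1) 3(1)]
    note L = deriv_Cons[OF concat.hyps(2)[unfolded 3(2)]]
    have xy: "x \<in> carrier (G s)" "y \<in> carrier (G s)" using R L by blast+
    have D_le: "D s (x \<otimes>\<^bsub>G s\<^esub> y) (k \<otimes>\<^bsub>G s\<^esub> l) \<le> D s x k + D s y l"
      if "k \<in> carrier (G s)" "l \<in> carrier (G s)" for k l
      using that xy by (intro G.d_mult_le)
    show ?thesis
    proof (cases "t = s")
      case True
      from True R obtain g' g'' c' where 1: "deriv s u g' c'" "g'' \<in> carrier (G s)"
            "g = g' \<otimes>\<^bsub>G s\<^esub> g''" "c' + D s x g'' \<le> a" by blast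
      from True L obtain h' h'' e' where 2: "deriv s v h' e'" "h'' \<in> carrier (G s)"
            "h = h'' \<otimes>\<^bsub>G s\<^esub> h'" "e' + D s y h'' \<le> b" by blast
      have c: "g' \<in> carrier (G s)" "h' \<in> carrier (G s)" using 1 2 deriv_closed by auto
      have "deriv s [(s, x \<otimes>\<^bsub>G s\<^esub> y)] (g'' \<otimes>\<^bsub>G s\<^esub> h'') (D s x g'' + D s y h'')"
        using 1 2 xy D_le by (intro deriv.single) auto
      from deriv.concat[OF deriv.concat[OF 1(1) this] 2(1)]
      have "deriv s (u @ (s, x \<otimes>\<^bsub>G s\<^esub> y) # v)
         (g' \<otimes>\<^bsub>G s\<^esub> (g'' \<otimes>\<^bsub>G s\<^esub> h'') \<otimes>\<^bsub>G s\<^esub> h') (c' + (D s x g'' + D s y h'') + e')"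
        by simp
      then show ?thesis
        using 1 2 c True by (auto simp: G.m_assoc elim: deriv_mono)
    next
      case False
      from False R obtain w0 w1 g0 c0 v1 g' g'' c1 where 1: "u = w0 @ w1" "deriv t w0 g0 c0"
        "v1 \<in> carrier M" "g = g0 \<otimes>\<^bsub>G t\<^esub> p t v1" "deriv s w1 g' c1" "g'' \<in> carrier (G s)"
        "p s v1 = g' \<otimes>\<^bsub>G s\<^esub> g''" "c0 + c1 + D s x g'' + len v1 \<le> a" by blast
      from False L obtain w2 w3 h0 e0 v2 h' h'' e1 where 2: "v = w3 @ w2" "deriv t w2 h0 e0"
        "v2 \<in> carrier M" "h = p t v2 \<otimes>\<^bsub>G t\<^esub> h0" "deriv s w3 h' e1" "h'' \<in> carrier (G s)"
        "p s v2 = h'' \<otimes>\<^bsub>G s\<^esub> h'" "e0 + e1 + D s y h'' + len v2 \<le> b" by blast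
      have c: "g' \<in> carrier (G s)" "h' \<in> carrier (G s)" "g0 \<in> carrier (G t)" "h0 \<in> carrier (G t)"
        using 1 2 deriv_closed by auto
      have "deriv s [(s, x \<otimes>\<^bsub>G s\<^esub> y)] (g'' \<otimes>\<^bsub>G s\<^esub> h'') (D s x g'' + D s y h'')"
        using 1 2 xy D_le by (intro deriv.single) auto
      from deriv.concat[OF deriv.concat[OF 1(5) this] 2(5)]
      have "deriv s (w1 @ (s, x \<otimes>\<^bsub>G s\<^esub> y) # w3)
         (g' \<otimes>\<^bsub>G s\<^esub> (g'' \<otimes>\<^bsub>G s\<^esub> h'') \<otimes>\<^bsub>G s\<^esub> h') (c1 + (D s x g'' + D s y h'') + e1)"
        by simp
      moreover have "g' \<otimes>\<^bsub>G s\<^esub> (g'' \<otimes>\<^bsub>G s\<^esub> h'') \<otimes>\<^bsub>G s\<^esub> h' = p s (v1 \<otimes>\<^bsub>M\<^esub> v2)"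
        using 1(3,6,7) 2(3,6,7) c by (simp add: G.m_assoc)
      moreover have "s = (\<not> t)" using False by auto
      ultimately have "deriv (\<not> t) (w1 @ (s, x \<otimes>\<^bsub>G s\<^esub> y) # w3) (p (\<not> t) (v1 \<otimes>\<^bsub>M\<^esub> v2))
          (c1 + (D s x g'' + D s y h'') + e1)" by simp
      from deriv.convert[OF this]
      have "deriv t (w1 @ (s, x \<otimes>\<^bsub>G s\<^esub> y) # w3) (p t (v1 \<otimes>\<^bsub>M\<^esub> v2))
          (c1 + (D s x g'' + D s y h'') + e1 + len (v1 \<otimes>\<^bsub>M\<^esub> v2))"
        using 1 2 by simp
      from deriv.concat[OF deriv.concat[OF 1(2) this] 2(2)]
      have 3: "deriv t (u @ (s, x \<otimes>\<^bsub>G s\<^esub> y) # v) (g0 \<otimes>\<^bsub>G t\<^esub> p t (v1 \<otimes>\<^bsub>M\<^esub> v2) \<otimes>\<^bsub>G t\<^esub> h0)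
          (c0 + (c1 + (D s x g'' + D s y h'') + e1 + len (v1 \<otimes>\<^bsub>M\<^esub> v2)) + e0)"
        using 1(1) 2(1) by simp
      have 4: "g0 \<otimes>\<^bsub>G t\<^esub> p t (v1 \<otimes>\<^bsub>M\<^esub> v2) \<otimes>\<^bsub>G t\<^esub> h0 = g \<otimes>\<^bsub>G t\<^esub> h"
        using 1(3,4) 2(3,4) c by (simp add: G.m_assoc)
      have "len (v1 \<otimes>\<^bsub>M\<^esub> v2) \<le> len v1 + len v2" using len_mult 1 2 by simp
      then show ?thesis
        using 3 1(8) 2(8) unfolding 4 by (elim deriv_mono) simp
    qed
  qed
qed (auto simp: append_eq_Cons_conv Cons_eq_append_conv intro: deriv.convert)

section \<open>Substitution in derivations and the relations of the free product\<close>

text \<open>An occurrence of a letter is consumed by exactly one use of the rule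
  \<open>single\<close>, so a word \<open>L\<close> that can replace the letter there at excess cost
  \<open>e\<close> can replace it in the whole derivation at that excess.\<close>

lemma deriv_subst:
  assumes "deriv t W g c" "W = u @ (s, x) # v" "0 \<le> e"
    and "\<And>g. g \<in> carrier (G s) \<Longrightarrow> deriv s L g (D s x g + e)"
  shows "deriv t (u @ L @ v) g (c + e)"
  using assms
proof (induction arbitrary: u v rule: deriv.induct)
  case (single y t g c)
  then have "u = []" "v = []" "y = x" "t = s"
    by (auto simp: append_eq_Cons_conv Cons_eq_append_conv)
  then show ?case
    using deriv_mono[OF single.prems(3)[of g]] single by simp
next
  case (concat t u1 g a v1 h b)
  consider us where "u1 = u @ (s, x) # us" "v = us @ v1"
    | us where "u = u1 @ us" "v1 = us @ (s, x) # v"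
    using concat.prems(1)
    by (auto simp: append_eq_append_conv2 append_eq_Cons_conv Cons_eq_append_conv)
  then show ?case
  proof cases
    case 1
    then show ?thesis
      using deriv.concat[OF concat.IH(1)[OF 1(1) concat.prems(2,3)] concat.hyps(2)]
      by (auto elim: deriv_mono)
  next
    case 2
    then show ?thesis
      using deriv.concat[OF concat.hyps(1) concat.IH(2)[OF 2(2) concat.prems(2,3)]]
      by (auto simp: add.assoc elim: deriv_mono)
  qed
next
  case (convert t w v' c)
  then show ?case
    using deriv.convert[OF convert.IH[OF convert.prems]] by (auto elim: deriv_mono)
qed simp

lemma deriv_one: "deriv t [(s, \<one>\<^bsub>G s\<^esub>)] \<one>\<^bsub>G t\<^esub> 0"
proof (cases "t = s")
  case True
  then show ?thesis by (auto intro: deriv.single)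
next
  case False
  then have "deriv (\<not> t) [(s, \<one>\<^bsub>G s\<^esub>)] (p (\<not> t) \<one>\<^bsub>M\<^esub>) 0"
    by (auto intro: deriv.single)
  from deriv.convert[OF this] show ?thesis by (simp add: len_one)
qed

text \<open>Deletion substitutes the empty word. Insertion attaches the trivial letter to a
  neighbouring letter, on whichever side there is one, and substitutes the pair for that
  neighbour.\<close>

lemma deriv_delete_one_iff:
  "deriv t (u @ (s, \<one>\<^bsub>G s\<^esub>) # v) g c \<longleftrightarrow> deriv t (u @ v) g c"
proof
  assume "deriv t (u @ (s, \<one>\<^bsub>G s\<^esub>) # v) g c"
  from deriv_subst[OF this refl, of 0 "[]"] show "deriv t (u @ v) g c"
    by (auto intro: deriv.nil)
next
  assume *: "deriv t (u @ v) g c"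
  have sub: "deriv r [(s, \<one>\<^bsub>G s\<^esub>), (r, x)] g (D r x g + 0) \<and> deriv r [(r, x), (s, \<one>\<^bsub>G s\<^esub>)] g (D r x g + 0)"
    if "g \<in> carrier (G r)" "x \<in> carrier (G r)" for r x g
    using deriv.concat[OF deriv_one deriv.single[OF that(2,1) order_refl], of s]
      deriv.concat[OF deriv.single[OF that(2,1) order_refl] deriv_one, of s] that by simp
  show "deriv t (u @ (s, \<one>\<^bsub>G s\<^esub>) # v) g c"
  proof (cases v)
    case (Cons a v')
    then obtain r x where a: "a = (r, x)" "x \<in> carrier (G r)"
      using deriv_letters[OF *] by (cases a) auto
    then show ?thesis
      using deriv_subst[OF *, of u r x v' 0 "[(s, \<one>\<^bsub>G s\<^esub>), (r, x)]"] sub Cons by simp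
  next
    case Nil
    show ?thesis
    proof (cases u rule: rev_cases)
      case (snoc u' a)
      then obtain r x where a: "a = (r, x)" "x \<in> carrier (G r)"
        using deriv_letters[OF *] by (cases a) auto
      then show ?thesis
        using deriv_subst[OF *, of u' r x "[]" 0 "[(r, x), (s, \<one>\<^bsub>G s\<^esub>)]"] sub Nil snoc by simp
    next
      case Nil': Nil
      have "g \<in> carrier (G t)" using deriv_closed[OF *] .
      then show ?thesis
        using deriv.concat[OF deriv_one *, of s] Nil Nil' by simp
    qed
  qed
qed

text \<open>Together with the deletion of trivial letters, these are the defining relations of the
  free product; derivability thus depends on a word only through its product there.\<close>

lemma deriv_merge_iff:
  assumes "x \<in> carrier (G s)" "y \<in> carrier (G s)"
  shows "deriv t (u @ (s, x) # (s, y) # v) g c \<longleftrightarrow> deriv t (u @ (s, x \<otimes>\<^bsub>G s\<^esub> y) # v) g c"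
proof
  assume *: "deriv t (u @ (s, x \<otimes>\<^bsub>G s\<^esub> y) # v) g c"
  have "deriv s [(s, x), (s, y)] h (D s (x \<otimes>\<^bsub>G s\<^esub> y) h + 0)" if h: "h \<in> carrier (G s)" for h
  proof -
    \<comment> \<open>The letter \<open>x\<close> is evaluated exactly, and the letter
      \<open>y\<close> absorbs the whole error.\<close>
    let ?k = "inv\<^bsub>G s\<^esub> x \<otimes>\<^bsub>G s\<^esub> h"
    have "D s (x \<otimes>\<^bsub>G s\<^esub> y) (x \<otimes>\<^bsub>G s\<^esub> ?k) = D s y ?k"
      using assms h by (intro G.d_mult_left) auto
    moreover have k: "x \<otimes>\<^bsub>G s\<^esub> ?k = h" using assms h by (simp add: G.m_assoc[symmetric])
    ultimately have "deriv s [(s, y)] ?k (D s (x \<otimes>\<^bsub>G s\<^esub> y) h)"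
      using assms h by (intro deriv.single) auto
    moreover have "deriv s [(s, x)] x 0" using assms by (intro deriv.single) auto
    ultimately show ?thesis using deriv.concat k by fastforce
  qed
  from deriv_subst[OF * refl _ this]
  show "deriv t (u @ (s, x) # (s, y) # v) g c" by simp
qed (rule deriv_merge, auto)

end

section \<open>Free products of free groups on disjoint sets of generators\<close>

lemma group_prod_free_group:
  "group_prod (free_group X) ws = foldr prepend (List.concat ws) []"
  by (induction ws) (auto simp: group_prod_def)

locale free_metric_amalgam =
  metric_amalgam "\<lambda>s. free_group (X s)" D M p len
  for X :: "bool \<Rightarrow> 'a set" and D :: "bool \<Rightarrow> 'a word \<Rightarrow> 'a word \<Rightarrow> real"
    and M :: "'m monoid" and p :: "bool \<Rightarrow> 'm \<Rightarrow> 'a word" and len :: "'m \<Rightarrow> real" +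
  assumes disjoint: "X True \<inter> X False = {}"
begin

definition side :: "'a \<Rightarrow> bool" where
  "side x \<longleftrightarrow> x \<in> X True"

text \<open>The factorization into single letters serves as a normal form: every word over the two
  groups can be brought into it by splitting, merging and deleting.\<close>

definition typed :: "'a word \<Rightarrow> (bool \<times> 'a word) list" where
  "typed w = map (\<lambda>l. (side (fst l), [l])) w"

lemma typed_simps [simp]:
  "typed [] = []" "typed (l # w) = (side (fst l), [l]) # typed w" "typed (u @ v) = typed u @ typed v"
  by (simp_all add: typed_def)

lemma side_eq: "x \<in> X s \<Longrightarrow> side x = s"
  using disjoint by (cases s) (auto simp: side_def)

lemma side_mem: "x \<in> X True \<union> X False \<Longrightarrow> x \<in> X (side x)"
  using side_eq[of x True] side_eq[of x False] by auto

lemma letter_carrier: "fst l \<in> X True \<union> X False \<Longrightarrow> [l] \<in> carrier (free_group (X (side (fst l))))"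
  using side_mem[of "fst l"] by (simp add: carrier_free_group reduced_word_def)

lemma deriv_typed_word:
  assumes "x \<in> carrier (free_group (X s))"
  shows "deriv t (u @ (s, x) # v) g c \<longleftrightarrow> deriv t (u @ typed x @ v) g c"
  using assms
proof (induction x arbitrary: u)
  case Nil
  then show ?case using deriv_delete_one_iff[of t u s v g c] by simp
next
  case (Cons l x)
  have x: "x \<in> carrier (free_group (X s))" "[l] \<in> carrier (free_group (X s))"
    using Cons.prems by (auto simp: carrier_free_group reduced_word_Cons)
  have "[l] \<otimes>\<^bsub>free_group (X s)\<^esub> x = l # x"
    using Cons.prems by (auto simp: carrier_free_group reduced_word_Cons prepend_def)
  then have "deriv t (u @ (s, l # x) # v) g c \<longleftrightarrow> deriv t ((u @ [(s, [l])]) @ (s, x) # v) g c"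
    using deriv_merge_iff[OF x(2,1), of t u v g c] by simp
  also have "\<dots> \<longleftrightarrow> deriv t ((u @ [(s, [l])]) @ typed x @ v) g c"
    by (rule Cons.IH[OF x(1)])
  finally show ?case
    using Cons.prems side_eq[of "fst l" s] by (simp add: carrier_free_group)
qed

lemma deriv_typed_words:
  assumes "\<And>s x. (s, x) \<in> set W \<Longrightarrow> x \<in> carrier (free_group (X s))"
  shows "deriv t (u @ W @ v) g c \<longleftrightarrow> deriv t (u @ typed (List.concat (map snd W)) @ v) g c"
  using assms
proof (induction W arbitrary: u)
  case (Cons a W)
  obtain s x where a: "a = (s, x)" by (cases a)
  have "deriv t (u @ (a # W) @ v) g c \<longleftrightarrow> deriv t ((u @ typed x) @ W @ v) g c"
    using deriv_typed_word[of x s t u "W @ v" g c] Cons.prems a by simp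
  also have "\<dots> \<longleftrightarrow> deriv t ((u @ typed x) @ typed (List.concat (map snd W)) @ v) g c"
    using Cons.prems by (intro Cons.IH) auto
  finally show ?case using a by simp
qed simp

lemma deriv_typed_prepend:
  assumes "fst ` set (l # w) \<subseteq> X True \<union> X False"
  shows "deriv t (u @ typed (prepend l w)) g c \<longleftrightarrow> deriv t (u @ typed (l # w)) g c"
proof (cases "w \<noteq> [] \<and> hd w = letter_inv l")
  case True
  then obtain w' where w: "w = letter_inv l # w'" by (cases w) auto
  have l: "[l] \<in> carrier (free_group (X (side (fst l))))"
     "[letter_inv l] \<in> carrier (free_group (X (side (fst l))))"
    using letter_carrier[of l] letter_carrier[of "letter_inv l"] assms by auto
  have "[l] \<otimes>\<^bsub>free_group (X (side (fst l)))\<^esub> [letter_inv l] = \<one>\<^bsub>free_group (X (side (fst l)))\<^esub>"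
    by (simp add: prepend_def)
  with deriv_merge_iff[OF l, of t u "typed w'" g c]
  show ?thesis
    using w deriv_delete_one_iff[of t u "side (fst l)" "typed w'" g c]
    by (simp add: prepend_def del: mult_free_group one_free_group)
qed (auto simp: prepend_def)

lemma deriv_typed_reduce:
  assumes "fst ` set w \<subseteq> X True \<union> X False"
  shows "deriv t (u @ typed (foldr prepend w [])) g c \<longleftrightarrow> deriv t (u @ typed w) g c"
  using assms
proof (induction w arbitrary: u)
  case (Cons l w)
  have "fst ` set (foldr prepend w []) \<subseteq> fst ` set w"
    using letters_foldr_prepend[of w "[]"] by simp
  then have "fst ` set (l # foldr prepend w []) \<subseteq> X True \<union> X False"
    using Cons.prems by auto
  then have "deriv t (u @ typed (foldr prepend (l # w) [])) g c \<longleftrightarrow>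
      deriv t ((u @ typed [l]) @ typed (foldr prepend w [])) g c"
    using deriv_typed_prepend[of l "foldr prepend w []" t u g c] by simp
  also have "\<dots> \<longleftrightarrow> deriv t ((u @ typed [l]) @ typed w) g c"
    using Cons.prems by (intro Cons.IH) auto
  finally show ?case by simp
qed simp

text \<open>Splitting all factors into letters and reducing freely are both reversible for
  derivability. Hence two factorizations of one element of the free group on the union may be
  exchanged for each other.\<close>

lemma deriv_group_prod:
  assumes "\<And>s x. (s, x) \<in> set W \<Longrightarrow> x \<in> carrier (free_group (X s))"
  shows "deriv t W g c \<longleftrightarrow> deriv t (typed (group_prod (free_group (X True \<union> X False)) (map snd W))) g c"
proof -
  have "fst ` set x \<subseteq> X True \<union> X False" if x: "x \<in> set (map snd W)" for x
  proof -
    obtain q where "q \<in> set W" "x = snd q" using x by auto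
    then have "(fst q, x) \<in> set W" by simp
    then obtain s where "(s, x) \<in> set W" ..
    then show ?thesis using assms[of s x] by (cases s) (auto simp: carrier_free_group)
  qed
  then have "fst ` set (List.concat (map snd W)) \<subseteq> X True \<union> X False"
    by fastforce
  from deriv_typed_reduce[OF this, of t "[]" g c] deriv_typed_words[OF assms, of W t "[]" "[]" g c]
  show ?thesis by (simp add: group_prod_free_group)
qed

text \<open>These are the replacements of one letter by another that a derivation can absorb: a move
  inside one group, paid by its distance, or an exchange of the two images of an element of
  \<open>M\<close>, paid by its length.\<close>

definition admissible :: "bool \<times> 'a word \<Rightarrow> bool \<times> 'a word \<Rightarrow> real \<Rightarrow> bool" where
  "admissible a b e \<longleftrightarrow> snd a \<in> carrier (free_group (X (fst a))) \<and> snd b \<in> carrier (free_group (X (fst b))) \<and>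
     (fst a = fst b \<and> D (fst a) (snd a) (snd b) \<le> e \<or>
      fst b = (\<not> fst a) \<and> (\<exists>v\<in>carrier M. snd a = p (fst a) v \<and> snd b = p (fst b) v \<and> len v \<le> e))"

lemma len_nonneg: "v \<in> carrier M \<Longrightarrow> 0 \<le> len v"
  using len_mult[of v "inv\<^bsub>M\<^esub> v"] len_inv len_one by simp

lemma admissible_nonneg: "admissible a b e \<Longrightarrow> 0 \<le> e"
  unfolding admissible_def using len_nonneg G.nonneg order_trans by metis

lemma deriv_admissible:
  assumes "admissible a b e" "deriv t (u @ b # v) g c"
  shows "deriv t (u @ a # v) g (c + e)"
proof -
  obtain s x r y where ab: "a = (s, x)" "b = (r, y)" by (cases a, cases b)
  have xy: "x \<in> carrier (free_group (X s))" "y \<in> carrier (free_group (X r))"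
    using assms(1) ab by (auto simp: admissible_def)
  have "deriv r [(s, x)] h (D r y h + e)" if h: "h \<in> carrier (free_group (X r))" for h
  proof (cases "s = r")
    case True
    then have "D r x y \<le> e" using assms(1) ab by (auto simp: admissible_def)
    then have "D r x h \<le> D r y h + e"
      using G.triangle[of x r y h] xy h True by simp
    then have "deriv r [(r, x)] h (D r y h + e)"
      using True xy h by (intro deriv.single) auto
    then show ?thesis using True by simp
  next
    case False
    then obtain v where v: "v \<in> carrier M" "x = p s v" "y = p r v" "len v \<le> e" and r: "s = (\<not> r)"
      using assms(1) ab by (auto simp: admissible_def)
    \<comment> \<open>The letter is evaluated exactly on its own side and then converted into
      \<open>y\<close>.\<close>
    have "deriv (\<not> r) [(s, x)] (p (\<not> r) v) 0"
      using v r by (auto intro!: deriv.single)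
    from deriv.convert[OF this v(1)] have 1: "deriv r [(s, x)] y (len v)" using v by simp
    \<comment> \<open>The remaining difference between \<open>y\<close> and the target
      \<open>h\<close> is derived from the empty word.\<close>
    let ?k = "inv\<^bsub>free_group (X r)\<^esub> y \<otimes>\<^bsub>free_group (X r)\<^esub> h"
    have "?k \<in> carrier (free_group (X r))" using xy h by (intro G.m_closed G.inv_closed)
    moreover have "D r \<one>\<^bsub>free_group (X r)\<^esub> ?k \<le> D r y h"
      using G.d_norm(3)[OF xy(2) h] by linarith
    ultimately have 2: "deriv r [] ?k (D r y h)" by (rule deriv.nil)
    have "y \<otimes>\<^bsub>free_group (X r)\<^esub> ?k = h"
      using G.inv_solve_left[of "inv\<^bsub>free_group (X r)\<^esub> y \<otimes>\<^bsub>free_group (X r)\<^esub> h" r y h] xy h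
      by (metis G.inv_closed G.m_closed)
    then have "deriv r [(s, x)] h (len v + D r y h)"
      using deriv.concat[OF 1 2] by simp
    then show ?thesis using deriv_mono v(4) by fastforce
  qed
  from deriv_subst[OF assms(2)[unfolded ab(2)] refl admissible_nonneg[OF assms(1)] this]
  show ?thesis using ab by simp
qed

lemma deriv_admissible_list:
  assumes "\<And>a b e. (a, b, e) \<in> set ps \<Longrightarrow> admissible a b e"
    and "deriv t (u @ map (fst \<circ> snd) ps) g c"
  shows "deriv t (u @ map fst ps) g (c + (\<Sum>q\<leftarrow>ps. snd (snd q)))"
  using assms
proof (induction ps arbitrary: u c)
  case (Cons x ps)
  obtain a b e where x: "x = (a, b, e)" by (cases x)
  have "deriv t (u @ a # map (fst \<circ> snd) ps) g (c + e)"
    using Cons.prems x by (intro deriv_admissible[of a b]) (auto simp: comp_def)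
  then have "deriv t ((u @ [a]) @ map (fst \<circ> snd) ps) g (c + e)" by simp
  then have "deriv t ((u @ [a]) @ map fst ps) g (c + e + (\<Sum>q\<leftarrow>ps. snd (snd q)))"
    using Cons.prems by (intro Cons.IH) (auto simp: comp_def)
  then show ?case using x by (simp add: add.assoc)
qed simp

theorem dist_le_sum_admissible:
  assumes ps: "\<And>a b e. (a, b, e) \<in> set ps \<Longrightarrow> admissible a b e"
    and xy: "x \<in> carrier (free_group (X s))" "y \<in> carrier (free_group (X s))"
    and x: "x = group_prod (free_group (X True \<union> X False)) (map (snd \<circ> fst) ps)"
    and y: "y = group_prod (free_group (X True \<union> X False)) (map (snd \<circ> (fst \<circ> snd)) ps)"
  shows "D s x y \<le> (\<Sum>q\<leftarrow>ps. snd (snd q))"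
proof -
  let ?A = "map fst ps" and ?B = "map (fst \<circ> snd) ps"
  have AB: "z \<in> carrier (free_group (X r))" if "(r, z) \<in> set ?A \<union> set ?B" for r z
    using that ps by (force simp: admissible_def)
  have snd: "map snd ?A = map (snd \<circ> fst) ps" "map snd ?B = map (snd \<circ> (fst \<circ> snd)) ps"
    by auto
  have prod: "group_prod (free_group (X True \<union> X False)) (map snd ?A) = x"
    "group_prod (free_group (X True \<union> X False)) (map snd ?B) = y"
    by (simp_all only: snd x[symmetric] y[symmetric])
  have iff: "deriv s ?A g c \<longleftrightarrow> deriv s (typed x) g c" "deriv s ?B g c \<longleftrightarrow> deriv s (typed y) g c" for g c
    using deriv_group_prod[of ?A s g c, unfolded prod] deriv_group_prod[of ?B s g c, unfolded prod] AB
    by blast+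
  have "deriv s [(s, y)] y 0"
    using xy by (auto intro!: deriv.single)
  then have B: "deriv s ([] @ ?B) y 0"
    using deriv_typed_word[OF xy(2), of s "[]" "[]" y 0] iff by simp
  have "deriv s ([] @ ?A) y (0 + (\<Sum>q\<leftarrow>ps. snd (snd q)))"
    by (rule deriv_admissible_list[OF ps B])
  then have "deriv s ([] @ [(s, x)]) y (\<Sum>q\<leftarrow>ps. snd (snd q))"
    using deriv_typed_word[OF xy(1), of s "[]" "[]"] iff by simp
  \<comment> \<open>The prefix before the only letter is empty, so its value \<open>g'\<close> has
    norm at most \<open>c'\<close> by soundness, and the rest of the budget bounds the distance from
    \<open>x\<close> to \<open>g''\<close>.\<close>
  from deriv_snoc[OF this refl]
  obtain g' g'' c' where *: "deriv s [] g' c'" "g'' \<in> carrier (free_group (X s))"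
    "y = g' \<otimes>\<^bsub>free_group (X s)\<^esub> g''" "c' + D s x g'' \<le> (\<Sum>q\<leftarrow>ps. snd (snd q))"
    by (auto simp del: mult_free_group)
  have g': "g' \<in> carrier (free_group (X s))" "D s \<one>\<^bsub>free_group (X s)\<^esub> g' \<le> c'"
    using * deriv_closed deriv_Nil_sound by blast+
  have "D s (\<one>\<^bsub>free_group (X s)\<^esub> \<otimes>\<^bsub>free_group (X s)\<^esub> x) y \<le> D s \<one>\<^bsub>free_group (X s)\<^esub> g' + D s x g''"
    unfolding *(3) by (intro G.d_mult_le G.one_closed g'(1) *(2) xy(1))
  then show ?thesis
    using g' * G.l_one[OF xy(1)] by (simp del: mult_free_group one_free_group)
qed

corollary dist_le_sum:
  assumes ps: "\<And>a b e. (a, b, e) \<in> set ps \<Longrightarrow> \<exists>s r. admissible (s, a) (r, b) e"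
    and xy: "x \<in> carrier (free_group (X s))" "y \<in> carrier (free_group (X s))"
    and x: "x = group_prod (free_group (X True \<union> X False)) (map fst ps)"
    and y: "y = group_prod (free_group (X True \<union> X False)) (map (fst \<circ> snd) ps)"
  shows "D s x y \<le> (\<Sum>q\<leftarrow>ps. snd (snd q))"
proof -
  have "\<forall>q\<in>set ps. \<exists>s r. admissible (s, fst q) (r, fst (snd q)) (snd (snd q))"
    using ps by auto
  then obtain s' r' where *: "\<And>q. q \<in> set ps \<Longrightarrow>
      admissible (s' q, fst q) (r' q, fst (snd q)) (snd (snd q))"
    by metis
  let ?f = "\<lambda>q. ((s' q, fst q), (r' q, fst (snd q)), snd (snd q))"
  have "D s x y \<le> (\<Sum>q\<leftarrow>map ?f ps. snd (snd q))"
  proof (rule dist_le_sum_admissible[OF _ xy])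
    show "admissible a b e" if "(a, b, e) \<in> set (map ?f ps)" for a b e
      using that * by auto
  qed (simp_all add: x y comp_def)
  then show ?thesis by (simp add: comp_def)
qed

end

section \<open>Metrics generated by finitely many rational relations\<close>

text \<open>Finitely many rational costs have a common denominator, so the costs of all chains lie
  in one such discrete set. There infima are attained, as the definition of a finitely generated
  metric demands.\<close>

definition multiples :: "nat \<Rightarrow> real set" where
  "multiples n = {real k / real n |k. True}"

lemma multiples_add: "x \<in> multiples n \<Longrightarrow> y \<in> multiples n \<Longrightarrow> x + y \<in> multiples n"
proof -
  assume "x \<in> multiples n" "y \<in> multiples n"
  then obtain j k where "x = real j / real n" "y = real k / real n" unfolding multiples_def by auto
  then have "x + y = real (j + k) / real n" by (simp add: add_divide_distrib)
  then show ?thesis unfolding multiples_def by blast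
qed

lemma multiples_0 [simp]: "0 \<in> multiples n"
  unfolding multiples_def by (auto intro: exI[of _ 0])

lemma multiples_1 [simp]: "n > 0 \<Longrightarrow> 1 \<in> multiples n"
  unfolding multiples_def by (auto intro!: exI[of _ n])

lemma multiples_nonneg: "x \<in> multiples n \<Longrightarrow> 0 \<le> x"
  unfolding multiples_def by auto

lemma multiples_rat: "x \<in> multiples n \<Longrightarrow> x \<in> \<rat>"
  unfolding multiples_def by auto

lemma multiples_sum_list:
  "(\<And>q. q \<in> set qs \<Longrightarrow> f q \<in> multiples n) \<Longrightarrow> (\<Sum>q\<leftarrow>qs. f q) \<in> multiples n"
  by (induction qs) (auto intro: multiples_add)

lemma multiples_least:
  assumes "S \<subseteq> multiples n" "S \<noteq> {}" "n > 0"
  shows "\<exists>s\<in>S. \<forall>t\<in>S. s \<le> t"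
proof -
  let ?P = "\<lambda>k. real k / real n \<in> S"
  obtain k where "?P k" using assms unfolding multiples_def by auto
  then have "?P (LEAST k. ?P k)" by (rule LeastI)
  moreover have "real (LEAST k. ?P k) / real n \<le> t" if t: "t \<in> S" for t
  proof -
    obtain j where "t = real j / real n" using t assms unfolding multiples_def by auto
    then show ?thesis using t Least_le[of ?P j] by (simp add: divide_right_mono)
  qed
  ultimately show ?thesis by blast
qed

lemma finite_rat_multiples:
  assumes "finite S" "S \<subseteq> \<rat>" "\<And>x. x \<in> S \<Longrightarrow> 0 \<le> x"
  obtains n where "n > 0" "S \<subseteq> multiples n"
proof -
  have "\<exists>n>0. S \<subseteq> multiples n"
    using assms
  proof (induction S rule: finite_induct)
    case empty
    then show ?case by auto
  next
    case (insert x S)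
    then obtain n where n: "n > 0" "S \<subseteq> multiples n" by auto
    obtain a b where b: "b \<noteq> 0" "\<bar>x\<bar> = real a / real b"
      using insert.prems by (metis Rats_abs_nat_div_natE insertI1 subsetD)
    then have x: "x = real a / real b" using insert.prems by simp
    have "x = real (a * n) / real (b * n)" using x n by simp
    moreover have "real k / real n = real (k * b) / real (b * n)" for k using b by simp
    ultimately have "insert x S \<subseteq> multiples (b * n)"
      using n unfolding multiples_def by fastforce
    then show ?case using n b by (intro exI[of _ "b * n"]) simp
  qed
  then show ?thesis using that by blast
qed

context group
begin

lemma group_prod_simps [simp]:
  "group_prod G [] = \<one>" "group_prod G (x # xs) = x \<otimes> group_prod G xs"
  by (simp_all add: group_prod_def)

lemma group_prod_closed [simp]: "set xs \<subseteq> carrier G \<Longrightarrow> group_prod G xs \<in> carrier G"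
  by (induction xs) auto

lemma group_prod_append:
  "set xs \<subseteq> carrier G \<Longrightarrow> set ys \<subseteq> carrier G \<Longrightarrow> group_prod G (xs @ ys) = group_prod G xs \<otimes> group_prod G ys"
  by (induction xs) (auto simp: m_assoc)

lemma generate_group_prod:
  assumes "A \<subseteq> carrier G" "m_inv G ` A \<subseteq> A" "x \<in> generate G A"
  shows "\<exists>xs. set xs \<subseteq> A \<and> x = group_prod G xs"
  using assms(3)
proof (induction rule: generate.induct)
  case one
  show ?case by (intro exI[of _ "[]"]) simp
next
  case (incl h)
  then show ?case using assms by (intro exI[of _ "[h]"]) auto
next
  case (inv h)
  then show ?case using assms by (intro exI[of _ "[inv h]"]) auto
next
  case (eng h1 h2)
  then obtain xs ys where "set xs \<subseteq> A" "h1 = group_prod G xs" "set ys \<subseteq> A" "h2 = group_prod G ys"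
    by blast
  then show ?case
    using assms by (intro exI[of _ "xs @ ys"]) (auto simp: group_prod_append)
qed

end

section \<open>The metric defined by finitely many inequalities\<close>

text \<open>A triple in \<open>R\<close> prescribes an upper bound \<open>e\<close> for the distance
  of \<open>a\<close> and \<open>b\<close>. Positivity of \<open>e\<close> prevents distinct
  elements from being identified, and rationality provides the common denominator. The symmetric
  generating set \<open>C\<close> supplies free diagonal steps.\<close>

locale relation_metric = group G for G (structure) +
  fixes C :: "'a set" and R :: "('a \<times> 'a \<times> real) set"
  assumes C: "finite C" "C \<subseteq> carrier G" "m_inv G ` C \<subseteq> C" "generate G C = carrier G"
    and R: "finite R" "\<And>a b e. (a, b, e) \<in> R \<Longrightarrow> a \<in> carrier G \<and> b \<in> carrier G \<and> 0 < e \<and> e \<in> \<rat>"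
begin

definition steps :: "('a \<times> 'a \<times> real) set" where
  "steps = R \<union> (\<lambda>(a, b, e). (b, a, e)) ` R \<union> (\<lambda>c. (c, c, 0)) ` C"

definition chain :: "'a \<Rightarrow> 'a \<Rightarrow> ('a \<times> 'a \<times> real) list \<Rightarrow> bool" where
  "chain a b ps \<longleftrightarrow> set ps \<subseteq> steps \<and> a = group_prod G (map fst ps) \<and> b = group_prod G (map (fst \<circ> snd) ps)"

definition cost :: "('a \<times> 'a \<times> real) list \<Rightarrow> real" where
  "cost ps = (\<Sum>q\<leftarrow>ps. snd (snd q))"

text \<open>Inserting 1 truncates the metric and also keeps the set nonempty when no chain joins the
  two elements.\<close>

definition gdist :: "'a \<Rightarrow> 'a \<Rightarrow> real" where
  "gdist a b = Inf (insert 1 {cost ps |ps. chain a b ps})"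

lemma finite_steps: "finite steps"
  using C R by (simp add: steps_def)

lemma steps_mem: "(a, b, e) \<in> steps \<Longrightarrow> a \<in> carrier G \<and> b \<in> carrier G \<and> 0 \<le> e \<and> e \<in> \<rat> \<and> (e = 0 \<longrightarrow> a = b)"
  using C(2) R(2)[of a b e] R(2)[of b a e] unfolding steps_def by (auto simp: less_imp_le)

lemma steps_sym: "(a, b, e) \<in> steps \<Longrightarrow> (b, a, e) \<in> steps"
  unfolding steps_def by (auto simp: image_iff intro: bexI[rotated])

lemma chain_carrier:
  assumes "chain a b ps"
  shows "set (map fst ps) \<subseteq> carrier G" "set (map (fst \<circ> snd) ps) \<subseteq> carrier G"
proof -
  have "fst q \<in> carrier G \<and> fst (snd q) \<in> carrier G" if "q \<in> set ps" for q
    using that assms steps_mem[of "fst q" "fst (snd q)" "snd (snd q)"] by (auto simp: chain_def)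
  then show "set (map fst ps) \<subseteq> carrier G" "set (map (fst \<circ> snd) ps) \<subseteq> carrier G" by auto
qed

lemma chain_append:
  assumes "chain a b ps" "chain a' b' qs"
  shows "chain (a \<otimes> a') (b \<otimes> b') (ps @ qs)"
  using assms group_prod_append chain_carrier[OF assms(1)] chain_carrier[OF assms(2)]
  by (simp add: chain_def)

lemma cost_append: "cost (ps @ qs) = cost ps + cost qs"
  by (simp add: cost_def)

lemma denominator:
  obtains n where "n > 0" "\<And>a b ps. chain a b ps \<Longrightarrow> cost ps \<in> multiples n"
proof -
  have "(snd \<circ> snd) ` steps \<subseteq> \<rat>" "\<And>x. x \<in> (snd \<circ> snd) ` steps \<Longrightarrow> 0 \<le> x"
    using steps_mem by force+
  then obtain n where n: "n > 0" "(snd \<circ> snd) ` steps \<subseteq> multiples n"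
    using finite_rat_multiples[of "(snd \<circ> snd) ` steps"] finite_steps by blast
  moreover have "cost ps \<in> multiples n" if "chain a b ps" for a b ps
    unfolding cost_def using that n by (intro multiples_sum_list) (auto simp: chain_def)
  ultimately show ?thesis using that by blast
qed

text \<open>All candidate values are multiples of one fraction, so the infimum is a minimum. Both
  separation of points and the formula for finitely generated metrics rest on this.\<close>

lemma gdist_attained:
  "gdist a b = 1 \<or> (\<exists>ps. chain a b ps \<and> gdist a b = cost ps)"
  and gdist_le_1: "gdist a b \<le> 1"
  and gdist_le_cost: "chain a b ps \<Longrightarrow> gdist a b \<le> cost ps"
  and gdist_nonneg: "0 \<le> gdist a b"
proof -
  let ?S = "insert 1 {cost ps |ps. chain a b ps}"
  obtain n where n': "n > 0" "\<And>a b ps. chain a b ps \<Longrightarrow> cost ps \<in> multiples n"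
    using denominator by blast
  then have n: "n > 0" "?S \<subseteq> multiples n" by auto
  obtain s where s: "s \<in> ?S" "\<forall>t\<in>?S. s \<le> t"
    using multiples_least[OF n(2) insert_not_empty n(1)] by (elim bexE)
  have "gdist a b = s"
    unfolding gdist_def using s by (intro cInf_eq_minimum) blast+
  then have g: "gdist a b \<in> ?S" "\<forall>t\<in>?S. gdist a b \<le> t" using s by simp_all
  show "gdist a b = 1 \<or> (\<exists>ps. chain a b ps \<and> gdist a b = cost ps)" using g(1) by blast
  show "gdist a b \<le> 1" using g(2) by blast
  show "gdist a b \<le> cost ps" if "chain a b ps" using g(2) that by blast
  show "0 \<le> gdist a b" using g(1) n(2) multiples_nonneg by blast
qed

lemma gdist_multiples:
  obtains n where "n > 0" "\<And>a b. gdist a b \<in> multiples n"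
proof -
  obtain n where "n > 0" "\<And>a b ps. chain a b ps \<Longrightarrow> cost ps \<in> multiples n"
    using denominator by blast
  then have "gdist a b \<in> multiples n" for a b
    using gdist_attained[of a b] by auto
  then show ?thesis using that \<open>n > 0\<close> by blast
qed

lemma gdist_le_step: "(a, b, e) \<in> steps \<Longrightarrow> gdist a b \<le> e"
  using gdist_le_cost[of a b "[(a, b, e)]"] steps_mem[of a b e] by (simp add: chain_def cost_def)

lemma chain_diag:
  assumes "a \<in> carrier G"
  obtains ps where "chain a a ps" "cost ps = 0"
proof -
  obtain xs where "set xs \<subseteq> C" "a = group_prod G xs"
    using generate_group_prod[of C a] C assms by auto
  then show ?thesis
    by (intro that[of "map (\<lambda>c. (c, c, 0)) xs"]) (auto simp: chain_def steps_def cost_def comp_def)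
qed

lemma gdist_refl: "a \<in> carrier G \<Longrightarrow> gdist a a = 0"
proof -
  assume "a \<in> carrier G"
  then obtain ps where "chain a a ps" "cost ps = 0" by (rule chain_diag)
  then show ?thesis using gdist_le_cost[of a a ps] gdist_nonneg[of a a] by simp
qed

lemma gdist_sym: "gdist a b = gdist b a"
proof -
  have "{cost ps |ps. chain a b ps} \<subseteq> {cost ps |ps. chain b a ps}" for a b
  proof safe
    fix ps assume "chain a b ps"
    then have "chain b a (map (\<lambda>(a, b, e). (b, a, e)) ps)"
      using steps_sym by (auto simp: chain_def comp_def case_prod_beta)
    moreover have "cost ps = cost (map (\<lambda>(a, b, e). (b, a, e)) ps)"
      by (simp add: cost_def comp_def case_prod_beta)
    ultimately show "\<exists>qs. cost ps = cost qs \<and> chain b a qs" by blast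
  qed
  then have "{cost ps |ps. chain a b ps} = {cost ps |ps. chain b a ps}"
    by (intro subset_antisym)
  then show ?thesis unfolding gdist_def by simp
qed

lemma gdist_mult:
  "gdist (a \<otimes> a') (b \<otimes> b') \<le> gdist a b + gdist a' b'"
proof (cases "gdist a b = 1 \<or> gdist a' b' = 1")
  case True
  then show ?thesis
    using gdist_le_1[of "a \<otimes> a'" "b \<otimes> b'"] gdist_nonneg[of a b] gdist_nonneg[of a' b'] by linarith
next
  case False
  then obtain ps qs where "chain a b ps" "gdist a b = cost ps" "chain a' b' qs" "gdist a' b' = cost qs"
    using gdist_attained by meson
  then show ?thesis using gdist_le_cost[OF chain_append] by (metis cost_append)
qed

text \<open>Chains can be multiplied but not joined end to end. The inequality comes from
  multiplying a chain from \<open>a\<close> to \<open>b\<close>, a diagonal chain for the inverse of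
  \<open>b\<close>, and a chain from \<open>b\<close> to \<open>c\<close>.\<close>

lemma gdist_triangle:
  assumes "a \<in> carrier G" "b \<in> carrier G" "c \<in> carrier G"
  shows "gdist a c \<le> gdist a b + gdist b c"
proof -
  have "gdist (a \<otimes> inv b \<otimes> b) (b \<otimes> inv b \<otimes> c) \<le> gdist a b + gdist (inv b) (inv b) + gdist b c"
    using gdist_mult[of "a \<otimes> inv b" b "b \<otimes> inv b" c] gdist_mult[of a "inv b" b "inv b"] by linarith
  then show ?thesis using assms by (simp add: m_assoc gdist_refl)
qed

text \<open>A minimal chain of cost 0 consists of steps of cost 0, and these are diagonal because
  relations have positive cost.\<close>

lemma gdist_zero:
  assumes "gdist a b = 0"
  shows "a = b"
proof -
  obtain ps where ps: "chain a b ps" "cost ps = 0" using gdist_attained[of a b] assms by auto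
  have "0 \<le> snd (snd q)" if "q \<in> set ps" for q
    using that ps steps_mem[of "fst q" "fst (snd q)" "snd (snd q)"] by (auto simp: chain_def)
  then have "\<forall>x\<in>set (map (\<lambda>q. snd (snd q)) ps). x = 0"
    using ps(2) by (subst sum_list_nonneg_eq_0_iff[symmetric]) (auto simp: cost_def)
  moreover have "fst q = (fst \<circ> snd) q" if "q \<in> set ps" for q
  proof -
    have "q \<in> steps" "snd (snd q) = 0" using that ps calculation by (auto simp: chain_def)
    then show ?thesis using steps_mem by (cases q) auto
  qed
  ultimately have "map fst ps = map (fst \<circ> snd) ps" by (intro map_cong) auto
  with ps(1) show ?thesis unfolding chain_def by metis
qed

lemma Metric_space_gdist: "Metric_space (carrier G) gdist"
proof
  show "0 \<le> gdist x y" "gdist x y = gdist y x" for x y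
    by (rule gdist_nonneg, rule gdist_sym)
qed (use gdist_zero gdist_refl gdist_triangle in auto)

text \<open>The defining formula refers to the metric itself on \<open>A\<close>, so it is checked
  in both directions: subadditivity bounds \<open>gdist\<close> by every factorization sum, and a
  minimal chain is itself a factorization over \<open>A\<close> whose steps cost at least their
  distance. For this \<open>A\<close> has to contain the endpoints of all relations.\<close>

lemma fg_metric_gdist: "fg_metric_bounded_by_1 G gdist"
proof -
  define P where "P = fst ` R \<union> (fst \<circ> snd) ` R"
  define A where "A = insert \<one> (C \<union> P \<union> m_inv G ` P)"
  have P: "P \<subseteq> carrier G" "finite P"
    using R by (auto simp: P_def dest!: R(2))
  have A_carrier: "A \<subseteq> carrier G"
    using C P by (auto simp: A_def)
  have A_fin: "finite A" using C P by (simp add: A_def)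
  have "m_inv G ` A \<subseteq> A"
    using C(3) P by (auto simp: A_def)
  moreover have "A \<subseteq> m_inv G ` A"
  proof
    fix x assume "x \<in> A"
    then have "inv x \<in> A" "x = inv (inv x)" using calculation A_carrier by auto
    then show "x \<in> m_inv G ` A" by blast
  qed
  ultimately have A_inv: "m_inv G ` A = A" by blast
  have "generate G C \<subseteq> generate G A" by (rule mono_generate) (auto simp: A_def)
  then have A_gen: "generate G A = carrier G"
    using C(4) generate_incl[OF A_carrier] by blast
  have steps_A: "a \<in> A \<and> b \<in> A" if "(a, b, e) \<in> steps" for a b e
    using that by (force simp: A_def P_def steps_def)
  obtain n where n: "n > 0" "\<And>a b. gdist a b \<in> multiples n" using gdist_multiples by blast
  have "\<exists>s\<in>factorization_sums G gdist A a b. (\<forall>t\<in>factorization_sums G gdist A a b. s \<le> t) \<and>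
      gdist a b = min 1 s" if ab: "a \<in> carrier G" "b \<in> carrier G" for a b
  proof -
    let ?S = "factorization_sums G gdist A a b"
    obtain xs ys where xs: "set xs \<subseteq> A" "a = group_prod G xs" and ys: "set ys \<subseteq> A" "b = group_prod G ys"
      using generate_group_prod[of A] A_carrier A_inv A_gen ab by (metis order_refl)
    \<comment> \<open>Factorizations of \<open>a\<close> and \<open>b\<close> may differ in length;
      padding each with units makes a common one, so the set of sums is nonempty and has a least
      element.\<close>
    let ?ps = "map (\<lambda>x. (x, \<one>)) xs @ map (\<lambda>y. (\<one>, y)) ys"
    have ones: "group_prod G (map (\<lambda>x. \<one>) zs) = \<one>" "set (map (\<lambda>x. \<one>) zs) \<subseteq> carrier G" for zs :: "'a list"
      by (induction zs) auto
    have xs': "set xs \<subseteq> carrier G" and ys': "set ys \<subseteq> carrier G"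
      using xs ys A_carrier by auto
    have "(\<Sum>(x, y)\<leftarrow>?ps. gdist x y) \<in> ?S"
      unfolding factorization_sums_def
    proof (rule CollectI, intro exI[of _ ?ps] conjI refl)
      show "set ?ps \<subseteq> A \<times> A" using xs ys by (auto simp: A_def)
      show "a = group_prod G (map fst ?ps)" "b = group_prod G (map snd ?ps)"
        using group_prod_append[OF xs' ones(2)[of ys]] group_prod_append[OF ones(2)[of xs] ys'] ones(1) ab xs(2) ys(2)
        by (simp_all add: comp_def)
    qed
    then have "?S \<noteq> {}" by blast
    moreover have "?S \<subseteq> multiples n"
      unfolding factorization_sums_def using n(2) by (force simp: case_prod_beta intro: multiples_sum_list)
    ultimately obtain s where s: "s \<in> ?S" "\<forall>t\<in>?S. s \<le> t"
      using multiples_least[OF _ _ n(1)] by metis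
    have le: "gdist (group_prod G (map fst ps)) (group_prod G (map snd ps)) \<le> (\<Sum>(x, y)\<leftarrow>ps. gdist x y)" for ps
    proof (induction ps)
      case Nil
      then show ?case by (simp add: gdist_refl)
    next
      case (Cons q ps)
      then show ?case
        using gdist_mult[of "fst q" "group_prod G (map fst ps)" "snd q" "group_prod G (map snd ps)"]
        by (simp add: case_prod_beta)
    qed
    have "gdist a b \<le> s"
      using s(1) le unfolding factorization_sums_def by blast
    then have 1: "gdist a b \<le> min 1 s" using gdist_le_1 by simp
    have 2: "min 1 s \<le> gdist a b"
    proof (cases "gdist a b = 1")
      case False
      then obtain ps where ps: "chain a b ps" "gdist a b = cost ps" using gdist_attained by blast
      let ?qs = "map (\<lambda>q. (fst q, fst (snd q))) ps"
      have "(\<Sum>(x, y)\<leftarrow>?qs. gdist x y) \<in> ?S"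
        unfolding factorization_sums_def
      proof (rule CollectI, intro exI[of _ ?qs] conjI refl)
        have "fst q \<in> A \<and> fst (snd q) \<in> A" if "q \<in> set ps" for q
          using that ps steps_A[of "fst q" "fst (snd q)" "snd (snd q)"] by (auto simp: chain_def)
        then show "set ?qs \<subseteq> A \<times> A" by auto
      qed (use ps in \<open>auto simp: chain_def comp_def\<close>)
      then have "s \<le> (\<Sum>(x, y)\<leftarrow>?qs. gdist x y)" using s by blast
      also have "\<dots> = (\<Sum>q\<leftarrow>ps. gdist (fst q) (fst (snd q)))" by (simp add: comp_def)
      also have "\<dots> \<le> cost ps"
        unfolding cost_def
      proof (rule sum_list_mono)
        fix q assume "q \<in> set ps"
        then have "(fst q, fst (snd q), snd (snd q)) \<in> steps" using ps by (auto simp: chain_def)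
        then show "gdist (fst q) (fst (snd q)) \<le> snd (snd q)" by (rule gdist_le_step)
      qed
      finally show ?thesis using ps by simp
    qed simp
    show ?thesis using s 1 2 by (intro bexI[of _ s]) auto
  qed
  then show ?thesis
    unfolding fg_metric_bounded_by_1_def
    using Metric_space_gdist A_fin A_carrier A_inv A_gen by (intro conjI exI[of _ A]) (auto simp: A_def)
qed

lemma rational_gdist: "rational_metric G gdist"
proof -
  obtain n where "\<And>a b. gdist a b \<in> multiples n" using gdist_multiples by blast
  then show ?thesis using multiples_rat unfolding rational_metric_def by blast
qed

end

section \<open>Extending objects of the category\<close>

text \<open>Diagonal pairs from factorizations of \<open>x\<close> and \<open>y\<close> can be put
  around any factorization pair at no cost, so translations do not increase distances; applying this
  to the inverse translations gives equality.\<close>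

lemma (in group) fg_metric_bi_invariant:
  assumes "fg_metric_bounded_by_1 G d"
  shows "bi_invariant_metric G d"
proof -
  from assms interpret Metric_space "carrier G" d by (simp add: fg_metric_bounded_by_1_def)
  obtain A where A: "A \<subseteq> carrier G" "m_inv G ` A = A" "generate G A = carrier G"
    and dA: "\<And>a b. a \<in> carrier G \<Longrightarrow> b \<in> carrier G \<Longrightarrow> \<exists>s\<in>factorization_sums G d A a b.
           (\<forall>t\<in>factorization_sums G d A a b. s \<le> t) \<and> d a b = min 1 s"
    using assms unfolding fg_metric_bounded_by_1_def by meson
  have le: "d (x \<otimes> a \<otimes> y) (x \<otimes> b \<otimes> y) \<le> d a b"
    if c: "x \<in> carrier G" "y \<in> carrier G" "a \<in> carrier G" "b \<in> carrier G" for x y a b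
  proof -
    obtain s where s: "s \<in> factorization_sums G d A a b" "d a b = min 1 s"
      using dA c by blast
    then obtain ps where ps: "set ps \<subseteq> A \<times> A" "a = group_prod G (map fst ps)"
      "b = group_prod G (map snd ps)" "s = (\<Sum>(x, y)\<leftarrow>ps. d x y)"
      unfolding factorization_sums_def by blast
    obtain xs ys where xs: "set xs \<subseteq> A" "x = group_prod G xs" and ys: "set ys \<subseteq> A" "y = group_prod G ys"
      using generate_group_prod[of A x] generate_group_prod[of A y] A c by auto
    let ?qs = "map (\<lambda>c. (c, c)) xs @ ps @ map (\<lambda>c. (c, c)) ys"
    have car: "set xs \<subseteq> carrier G" "set ys \<subseteq> carrier G" "set (map fst ps) \<subseteq> carrier G"
      "set (map snd ps) \<subseteq> carrier G"
      using xs ys ps(1) A(1) by fastforce+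
    have zero: "(\<Sum>c\<leftarrow>zs. d c c) = 0" if "set zs \<subseteq> carrier G" for zs
      using that by (induction zs) auto
    have "set ?qs \<subseteq> A \<times> A" using xs ys ps by auto
    moreover have "x \<otimes> a \<otimes> y = group_prod G (map fst ?qs)"
      "x \<otimes> b \<otimes> y = group_prod G (map snd ?qs)"
      using car xs(2) ys(2) ps(2,3) c by (simp_all add: comp_def group_prod_append m_assoc)
    moreover have "s = (\<Sum>(x, y)\<leftarrow>?qs. d x y)"
      using zero car ps(4) by (simp add: comp_def)
    ultimately have "s \<in> factorization_sums G d A (x \<otimes> a \<otimes> y) (x \<otimes> b \<otimes> y)"
      unfolding factorization_sums_def by blast
    moreover obtain s' where "\<forall>t\<in>factorization_sums G d A (x \<otimes> a \<otimes> y) (x \<otimes> b \<otimes> y). s' \<le> t"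
      "d (x \<otimes> a \<otimes> y) (x \<otimes> b \<otimes> y) = min 1 s'"
      using dA[of "x \<otimes> a \<otimes> y" "x \<otimes> b \<otimes> y"] c by blast
    ultimately show ?thesis using s(2) by force
  qed
  have "d (x \<otimes> a \<otimes> y) (x \<otimes> b \<otimes> y) = d a b"
    if c: "x \<in> carrier G" "y \<in> carrier G" "a \<in> carrier G" "b \<in> carrier G" for x y a b
  proof -
    have "inv x \<otimes> (x \<otimes> z \<otimes> y) \<otimes> inv y = z" if "z \<in> carrier G" for z
    proof -
      have "inv x \<otimes> (x \<otimes> z \<otimes> y) = z \<otimes> y"
        using that c by (simp add: m_assoc[symmetric])
      then show ?thesis using that c by (simp add: m_assoc)
    qed
    then show ?thesis
      using le[of "inv x" "inv y" "x \<otimes> a \<otimes> y" "x \<otimes> b \<otimes> y"] le[OF c] c by simp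
  qed
  then show ?thesis
    unfolding bi_invariant_metric_def using Metric_space_axioms by blast
qed

lemma fg_metric_le_1: "fg_metric_bounded_by_1 G d \<Longrightarrow> bounded_by_1 G d"
  unfolding fg_metric_bounded_by_1_def bounded_by_1_def by fastforce

lemma G1_object_bi_metric_group:
  "G1_object K \<Longrightarrow> bi_metric_group (grp K) (met K)"
  using group.fg_metric_bi_invariant group_free_group
  by (metis G1_object_def bi_metric_group.intro bi_metric_group_axioms.intro)

lemma group_prod_subset:
  "group_prod (free_group X) ws = group_prod (free_group Y) ws"
  by (simp add: group_prod_free_group)

lemma length_foldr_prepend: "length (foldr prepend u v) \<le> length u + length v"
  by (induction u) (auto simp: prepend_def)

lemma length_inv_free_group:
  "w \<in> carrier (free_group X) \<Longrightarrow> length (inv\<^bsub>free_group X\<^esub> w) = length w"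
  by (simp add: inv_free_group)

lemma generate_letters:
  "generate (free_group X) {[l] |l. fst l \<in> X} = carrier (free_group X)"
proof
  interpret group "free_group X" by (rule group_free_group)
  show "generate (free_group X) {[l] |l. fst l \<in> X} \<subseteq> carrier (free_group X)"
    by (rule generate_incl) (auto simp: carrier_free_group reduced_word_def)
  show "carrier (free_group X) \<subseteq> generate (free_group X) {[l] |l. fst l \<in> X}"
  proof
    fix w assume "w \<in> carrier (free_group X)"
    then show "w \<in> generate (free_group X) {[l] |l. fst l \<in> X}"
    proof (induction w)
      case Nil
      then show ?case using generate.one[of "free_group X"] by simp
    next
      case (Cons l w)
      then have w: "w \<in> generate (free_group X) {[l] |l. fst l \<in> X}" and l: "fst l \<in> X"
        by (auto simp: carrier_free_group reduced_word_Cons)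
      have "[l] \<in> generate (free_group X) {[l] |l. fst l \<in> X}"
        using l by (intro generate.incl) blast
      moreover have "l # w = [l] \<otimes>\<^bsub>free_group X\<^esub> w"
        using Cons.prems by (auto simp: carrier_free_group reduced_word_Cons prepend_def)
      ultimately show ?case using generate.eng[of "[l]" "free_group X" _ w] w by simp
    qed
  qed
qed

lemma finite_letters: "finite X \<Longrightarrow> finite {[l] |l :: 'a \<times> bool. fst l \<in> X}"
proof -
  assume "finite X"
  then have "finite ((\<lambda>l. [l]) ` (X \<times> (UNIV :: bool set)))" by simp
  moreover have "{[l] |l :: 'a \<times> bool. fst l \<in> X} \<subseteq> (\<lambda>l. [l]) ` (X \<times> UNIV)" by auto
  ultimately show ?thesis by (rule rev_finite_subset)
qed

lemma inv_letter:
  assumes "fst l \<in> X"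
  shows "inv\<^bsub>free_group X\<^esub> [l] = [letter_inv l]"
proof -
  have "[l] \<in> carrier (free_group X)" using assms by (auto simp: carrier_free_group reduced_word_def)
  then show ?thesis by (simp add: inv_free_group)
qed

lemma finite_words_of_length:
  assumes "finite X"
  shows "finite {w \<in> carrier (free_group X). length w \<le> r}"
proof -
  have "finite {w. set w \<subseteq> X \<times> (UNIV :: bool set) \<and> length w \<le> r}"
    using assms by (intro finite_lists_length_le) auto
  moreover have "{w \<in> carrier (free_group X). length w \<le> r} \<subseteq> {w. set w \<subseteq> X \<times> UNIV \<and> length w \<le> r}"
    by (force simp: carrier_free_group)
  ultimately show ?thesis by (rule rev_finite_subset)
qed

text \<open>The relations impose upper bounds only; all lower bounds come from the amalgam.
  Distances over \<open>X\<close> are met exactly, because the finite set \<open>A\<close>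
  determines \<open>d\<close>. Norms over \<open>Y\<close> are bounded below everywhere, up to
  truncation, but above only on the ball of radius \<open>r\<close>.\<close>

proposition extension_object:
  fixes X Y :: "nat set" and k y :: "nat \<Rightarrow> nat word"
  assumes K: "G1_object (X, d)" and Y: "finite Y" "X \<inter> Y = {}"
    and \<rho>: "bi_metric_group (free_group Y) \<rho>"
    and k: "k ` {1..m} \<subseteq> carrier (free_group X)" and y: "y ` {1..m} \<subseteq> carrier (free_group Y)"
    and close: "\<And>v. v \<in> carrier (F m) \<Longrightarrow>
        \<bar>\<rho> (word_eval (free_group Y) y v) [] - d (word_eval (free_group X) k v) []\<bar> \<le> \<epsilon> * real (length v)"
    and \<epsilon>: "\<epsilon> > 0" "\<epsilon> \<in> \<rat>" and \<eta>: "\<eta> > 0"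
  obtains D where "G1_object (X \<union> Y, D)"
    "\<And>a b. a \<in> carrier (free_group X) \<Longrightarrow> b \<in> carrier (free_group X) \<Longrightarrow> D a b = d a b"
    "\<And>i. i \<in> {1..m} \<Longrightarrow> D (y i) (k i) \<le> \<epsilon>"
    "\<And>g. g \<in> carrier (free_group Y) \<Longrightarrow> \<rho> g [] \<le> D g [] \<or> D g [] = 1"
    "\<And>g. g \<in> carrier (free_group Y) \<Longrightarrow> length g \<le> r \<Longrightarrow> D g [] \<le> \<rho> g [] + \<eta>"
proof -
  let ?G = "free_group (X \<union> Y)"
  have X: "finite X" and fg: "fg_metric_bounded_by_1 (free_group X) d"
    and rat: "rational_metric (free_group X) d"
    using K by (auto simp: G1_object_def)
  interpret dX: bi_metric_group "free_group X" d
    using G1_object_bi_metric_group[OF K] by simp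
  interpret \<rho>: bi_metric_group "free_group Y" \<rho> by (rule \<rho>)
  have sub: "carrier (free_group X) \<subseteq> carrier ?G" "carrier (free_group Y) \<subseteq> carrier ?G"
    unfolding subset_iff carrier_free_group by blast+

  define GX where "GX s = (if s then X else Y)" for s
  define DD where "DD s = (if s then d else \<rho>)" for s
  define p where "p s = (if s then word_eval (free_group X) k else word_eval (free_group Y) y)" for s
  have GX_Un: "GX True \<union> GX False = X \<union> Y" by (simp add: GX_def)
  \<comment> \<open>The exchanged elements are the words in \<open>m\<close> letters, evaluated at
    the tuple \<open>k\<close> on one side and at \<open>y\<close> on the other; the hypothesis
    \<open>close\<close> is the condition that such exchanges respect norms.\<close>
  interpret am: free_metric_amalgam GX DD "F m" p "\<lambda>v. \<epsilon> * real (length v)"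
  proof (intro free_metric_amalgam.intro metric_amalgam.intro free_metric_amalgam_axioms.intro)
    show "bi_metric_group (free_group (GX s)) (DD s)" for s
      using dX.bi_metric_group_axioms \<rho> by (simp add: GX_def DD_def)
    show "group (F m)" by (simp add: F_def group_free_group)
    show "p s \<in> hom (F m) (free_group (GX s))" for s
      using dX.word_eval_hom[OF k] \<rho>.word_eval_hom[OF y] by (simp add: p_def GX_def F_def)
    show "\<epsilon> * real (length \<one>\<^bsub>F m\<^esub>) = 0" by (simp add: F_def)
    show "\<epsilon> * real (length (inv\<^bsub>F m\<^esub> v)) = \<epsilon> * real (length v)" if "v \<in> carrier (F m)" for v
      using that by (simp add: F_def length_inv_free_group)
    show "\<epsilon> * real (length (v \<otimes>\<^bsub>F m\<^esub> w)) \<le> \<epsilon> * real (length v) + \<epsilon> * real (length w)" for v w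
      using length_foldr_prepend[of v w] \<epsilon> by (simp add: F_def flip: distrib_left of_nat_add)
    show "DD s \<one>\<^bsub>free_group (GX s)\<^esub> (p s v) \<le>
        DD (\<not> s) \<one>\<^bsub>free_group (GX (\<not> s))\<^esub> (p (\<not> s) v) + \<epsilon> * real (length v)"
      if v: "v \<in> carrier (F m)" for s v
      using close[OF v] dX.commute[of "[]"] \<rho>.commute[of "[]"]
      by (cases s) (simp_all add: DD_def p_def)
    show "GX True \<inter> GX False = {}" using Y by (simp add: GX_def)
  qed

  obtain A where A: "finite A" "A \<subseteq> carrier (free_group X)"
    and dA: "\<And>a b. a \<in> carrier (free_group X) \<Longrightarrow> b \<in> carrier (free_group X) \<Longrightarrow>
          \<exists>s\<in>factorization_sums (free_group X) d A a b.
           (\<forall>t\<in>factorization_sums (free_group X) d A a b. s \<le> t) \<and> d a b = min 1 s"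
    using fg unfolding fg_metric_bounded_by_1_def by meson
  \<comment> \<open>A strict rational upper approximation, hence positive even for the empty word,
    whose norm is 0.\<close>
  obtain \<sigma> where \<sigma>: "\<And>g. g \<in> carrier (free_group Y) \<Longrightarrow> \<sigma> g \<in> \<rat> \<and> \<rho> g [] < \<sigma> g \<and> \<sigma> g < \<rho> g [] + \<eta>"
  proof -
    have "\<exists>q\<in>\<rat>. \<rho> g [] < q \<and> q < \<rho> g [] + \<eta>" for g
      using \<eta> Rats_dense_in_real[of "\<rho> g []" "\<rho> g [] + \<eta>"] by auto
    then show ?thesis using that by metis
  qed
  define C where "C = {[l] |l :: nat \<times> bool. fst l \<in> X \<union> Y}"
  \<comment> \<open>Diagonal pairs over \<open>A\<close> are left out because relations need
    positive cost. The third family asks for closeness of the two tuples.\<close>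
  define R where "R = {(a, b, d a b) |a b. a \<in> A \<and> b \<in> A \<and> a \<noteq> b} \<union>
      (\<lambda>g. (g, [], \<sigma> g)) ` {g \<in> carrier (free_group Y). length g \<le> r} \<union>
      (\<lambda>i. (y i, k i, \<epsilon>)) ` {1..m}"
  interpret rm: relation_metric ?G C R
  proof (intro relation_metric.intro relation_metric_axioms.intro group_free_group)
    show "finite C" using X Y finite_letters[of "X \<union> Y"] by (simp add: C_def)
    show "C \<subseteq> carrier ?G" by (auto simp: C_def carrier_free_group reduced_word_def)
    show "m_inv ?G ` C \<subseteq> C" by (auto simp: C_def inv_letter letter_inv_def)
    show "generate ?G C = carrier ?G" unfolding C_def by (rule generate_letters)
    have "{(a, b, d a b) |a b. a \<in> A \<and> b \<in> A \<and> a \<noteq> b} \<subseteq> (\<lambda>(a, b). (a, b, d a b)) ` (A \<times> A)" by auto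
    then have "finite {(a, b, d a b) |a b. a \<in> A \<and> b \<in> A \<and> a \<noteq> b}"
      using A(1) by (meson finite_SigmaI finite_imageI finite_subset)
    then show "finite R"
      unfolding R_def using finite_words_of_length[OF Y(1)] by simp
    show "a \<in> carrier ?G \<and> b \<in> carrier ?G \<and> 0 < e \<and> e \<in> \<rat>" if "(a, b, e) \<in> R" for a b e
    proof -
      from that consider "a \<in> A" "b \<in> A" "a \<noteq> b" "e = d a b"
        | "a \<in> carrier (free_group Y)" "b = []" "e = \<sigma> a"
        | i where "i \<in> {1..m}" "a = y i" "b = k i" "e = \<epsilon>"
        unfolding R_def by blast
      then show ?thesis
      proof cases
        case 1
        then have "a \<in> carrier (free_group X)" "b \<in> carrier (free_group X)" using A by auto
        then show ?thesis using 1 sub dX.mdist_pos_less rat by (auto simp: rational_metric_def)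
      next
        case 2
        then have "0 < \<sigma> a" using \<sigma>[of a] \<rho>.nonneg[of a "[]"] by linarith
        then show ?thesis
          using 2 sub \<sigma>[of a] by (auto simp: carrier_free_group)
      next
        case 3
        then have "k i \<in> carrier (free_group X)" "y i \<in> carrier (free_group Y)" using k y by auto
        then show ?thesis using 3 \<epsilon> sub by blast
      qed
    qed
  qed

  have R_steps: "q \<in> R \<Longrightarrow> q \<in> rm.steps" for q
    by (simp add: rm.steps_def)
  have step_admissible: "\<exists>s r. am.admissible (s, a) (r, b) e" if "(a, b, e) \<in> rm.steps" for a b e
  proof -
    have sym: "am.admissible (r, b) (s, a) e" if "am.admissible (s, a) (r, b) e" for s r a b e
      using that am.G.commute unfolding am.admissible_def by force
    have R: "\<exists>s r. am.admissible (s, a) (r, b) e" if "(a, b, e) \<in> R" for a b e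
    proof -
      from that consider "a \<in> A" "b \<in> A" "a \<noteq> b" "e = d a b"
        | "a \<in> carrier (free_group Y)" "b = []" "e = \<sigma> a"
        | i where "i \<in> {1..m}" "a = y i" "b = k i" "e = \<epsilon>"
        unfolding R_def by blast
      then show ?thesis
      proof cases
        case 1
        then have "am.admissible (True, a) (True, b) e"
          using A by (auto simp: am.admissible_def GX_def DD_def)
        then show ?thesis by blast
      next
        case 2
        then have "am.admissible (False, a) (False, b) e"
          using \<sigma>[of a] by (auto simp: am.admissible_def GX_def DD_def carrier_free_group)
        then show ?thesis by blast
      next
        case 3
        then have c: "k i \<in> carrier (free_group X)" "y i \<in> carrier (free_group Y)" using k y by auto
        \<comment> \<open>The two tuple entries are the two images of a generator, a word of length
          1, so their exchange costs exactly \<epsilon>.\<close>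
        then have "p True (gen i) = k i" "p False (gen i) = y i"
          by (simp_all add: p_def)
        moreover have "gen i \<in> carrier (F m)" using 3 by (simp add: F_def)
        moreover have "length (gen i) = 1" by (simp add: gen_def)
        ultimately have "am.admissible (False, a) (True, b) e"
          using 3 c unfolding am.admissible_def by (auto simp: GX_def intro!: bexI[of _ "gen i"])
        then show ?thesis by blast
      qed
    qed
    from that consider "(a, b, e) \<in> R" | "(b, a, e) \<in> R" | "a \<in> C" "b = a" "e = 0"
      unfolding rm.steps_def by auto
    then show ?thesis
    proof cases
      case 1
      then show ?thesis by (rule R)
    next
      case 2
      then show ?thesis using R sym by blast
    next
      case 3
      then obtain l where l: "a = [l]" "fst l \<in> X \<union> Y" by (auto simp: C_def)
      define s where "s \<longleftrightarrow> fst l \<in> X"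
      have "a \<in> carrier (free_group (GX s))"
        using l by (auto simp: s_def GX_def carrier_free_group reduced_word_def)
      then have "am.admissible (s, a) (s, b) e"
        using 3 am.G.mdist_zero[of a s] by (simp add: am.admissible_def)
      then show ?thesis by blast
    qed
  qed
  \<comment> \<open>A distance different from 1 is the cost of a chain with admissible steps; here
    the amalgam rules out shortcuts through the other factor.\<close>
  have lower: "DD s a b \<le> rm.gdist a b \<or> rm.gdist a b = 1"
    if ab: "a \<in> carrier (free_group (GX s))" "b \<in> carrier (free_group (GX s))" for s a b
  proof (cases "rm.gdist a b = 1")
    case False
    then obtain ps where ps: "rm.chain a b ps" "rm.gdist a b = rm.cost ps"
      using rm.gdist_attained by blast
    have "DD s a b \<le> (\<Sum>q\<leftarrow>ps. snd (snd q))"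
      using ps step_admissible unfolding rm.chain_def
      by (intro am.dist_le_sum[OF _ ab]) (auto simp only: GX_Un)
    then show ?thesis using ps(2) by (simp add: rm.cost_def)
  qed simp
  have upper: "rm.gdist a b \<le> d a b"
    if ab: "a \<in> carrier (free_group X)" "b \<in> carrier (free_group X)" for a b
  proof -
    obtain s where s: "s \<in> factorization_sums (free_group X) d A a b" "d a b = min 1 s"
      using dA ab by blast
    then obtain ps where ps: "set ps \<subseteq> A \<times> A" "a = group_prod (free_group X) (map fst ps)"
      "b = group_prod (free_group X) (map snd ps)" "s = (\<Sum>(x, y)\<leftarrow>ps. d x y)"
      unfolding factorization_sums_def by blast
    \<comment> \<open>Each pair of a factorization over \<open>A\<close> is either diagonal or
      bounded by a relation of the first family.\<close>
    have "rm.gdist (group_prod ?G (map fst ps)) (group_prod ?G (map snd ps)) \<le> (\<Sum>(x, y)\<leftarrow>ps. d x y)"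
      using ps(1)
    proof (induction ps)
      case Nil
      then show ?case by (simp add: rm.gdist_refl del: one_free_group)
    next
      case (Cons q ps)
      obtain u v where q: "q = (u, v)" "u \<in> A" "v \<in> A" using Cons.prems by (cases q) auto
      have uv: "u \<in> carrier (free_group X)" "v \<in> carrier (free_group X)" using q A by auto
      have "rm.gdist u v \<le> d u v"
      proof (cases "u = v")
        case True
        then show ?thesis using rm.gdist_refl[of u] uv sub by auto
      next
        case False
        then have "(u, v, d u v) \<in> rm.steps"
          using q by (intro R_steps) (auto simp: R_def)
        then show ?thesis by (rule rm.gdist_le_step)
      qed
      moreover have "rm.gdist (group_prod ?G (map fst ps)) (group_prod ?G (map snd ps)) \<le> (\<Sum>(x, y)\<leftarrow>ps. d x y)"
        using Cons by auto
      ultimately show ?case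
        using rm.gdist_mult[of u "group_prod ?G (map fst ps)" v "group_prod ?G (map snd ps)"] q(1)
        by (simp del: mult_free_group)
    qed
    then have "rm.gdist a b \<le> s"
      unfolding ps group_prod_subset[of X _ "X \<union> Y"] .
    then show ?thesis using s(2) rm.gdist_le_1[of a b] by simp
  qed
  show ?thesis
  proof (rule that[of rm.gdist])
    show "G1_object (X \<union> Y, rm.gdist)"
      using X Y rm.fg_metric_gdist rm.rational_gdist by (simp add: G1_object_def)
    show "rm.gdist a b = d a b"
      if ab: "a \<in> carrier (free_group X)" "b \<in> carrier (free_group X)" for a b
    proof -
      have "d a b \<le> 1" using fg_metric_le_1[OF fg] ab by (simp add: bounded_by_1_def)
      then show ?thesis using upper[OF ab] lower[of a True b] ab by (auto simp: GX_def DD_def)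
    qed
    show "rm.gdist (y i) (k i) \<le> \<epsilon>" if "i \<in> {1..m}" for i
      using that by (intro rm.gdist_le_step R_steps) (auto simp: R_def)
    show "\<rho> g [] \<le> rm.gdist g [] \<or> rm.gdist g [] = 1" if "g \<in> carrier (free_group Y)" for g
      using that lower[of g False "[]"] by (simp add: GX_def DD_def carrier_free_group)
    show "rm.gdist g [] \<le> \<rho> g [] + \<eta>" if g: "g \<in> carrier (free_group Y)" "length g \<le> r" for g
    proof -
      have "(g, [], \<sigma> g) \<in> rm.steps" using g by (intro R_steps) (auto simp: R_def)
      from rm.gdist_le_step[OF this] show ?thesis using \<sigma>[OF g(1)] by simp
    qed
  qed
qed

section \<open>The extension property\<close>

definition extension_property ::
  "('c, 'z) monoid_scheme \<Rightarrow> ('c \<Rightarrow> 'c \<Rightarrow> real) \<Rightarrow> 'c set \<Rightarrow> bool" where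
  "extension_property HH dH H \<longleftrightarrow>
     (\<forall>(\<epsilon>::real) (\<epsilon>'::real) (m::nat) (n::nat) \<rho> \<iota>.
         \<epsilon> > \<epsilon>' \<and> \<epsilon>' > 0 \<and> m < n \<and>
         bi_invariant_metric (F n) \<rho> \<and> bounded_by_1 (F n) \<rho> \<and>
         \<iota> \<in> mon (F m) HH \<and> metric_dist m \<rho> (pullback \<iota> dH) < \<epsilon> \<longrightarrow>
         (\<exists>\<kappa>\<in>mon (F n) (HH\<lparr>carrier := H\<rparr>).
            (\<forall>i\<in>{1..m}. dH (\<kappa> (gen i)) (\<iota> (gen i)) < \<epsilon>) \<and>
            metric_dist n \<rho> (pullback \<kappa> dH) < \<epsilon>'))"

lemma group_F: "group (F n)"
  by (simp add: F_def group_free_group)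

lemma F_simps [simp]: "\<one>\<^bsub>F n\<^esub> = []" "gen i \<in> carrier (F n) \<longleftrightarrow> i \<in> {1..n}"
  by (simp_all add: F_def)

lemma F_mono: "m \<le> n \<Longrightarrow> carrier (F m) \<subseteq> carrier (F n)"
  by (fastforce simp: F_def carrier_free_group)

lemma Nil_in_F [simp]: "[] \<in> carrier (F n)"
  by (simp add: F_def carrier_free_group)

lemma (in Metric_space) dense_iff:
  "mtopology closure_of S = M \<longleftrightarrow> (\<forall>x\<in>M. \<forall>e>0. \<exists>y\<in>S \<inter> M. d x y < e)"
  unfolding metric_closure_of by (auto simp: in_mball)

lemma bi_metric_groupI: "group G \<Longrightarrow> bi_invariant_metric G d \<Longrightarrow> bi_metric_group G d"
  by (simp add: bi_metric_group_def bi_metric_group_axioms_def)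

lemma bi_metric_group_pullback:
  assumes "group G" "bi_metric_group H d" "h \<in> mon G H"
  shows "bi_metric_group G (pullback h d)"
proof -
  interpret H: bi_metric_group H d by fact
  interpret G: group G by fact
  have h: "h \<in> hom G H" "inj_on h (carrier G)" using assms(3) by (auto simp: mon_def)
  interpret h: group_hom G H h
    using h by (simp add: group_hom_def group_hom_axioms_def G.is_group H.is_group)
  have "Metric_space (carrier G) (pullback h d)"
  proof
    show "pullback h d x y = 0 \<longleftrightarrow> x = y" if "x \<in> carrier G" "y \<in> carrier G" for x y
      using that h(2) by (auto simp: pullback_def inj_on_def)
  qed (auto simp: pullback_def H.commute intro: H.triangle)
  moreover have "pullback h d (x \<otimes>\<^bsub>G\<^esub> a \<otimes>\<^bsub>G\<^esub> y) (x \<otimes>\<^bsub>G\<^esub> b \<otimes>\<^bsub>G\<^esub> y) = pullback h d a b"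
    if "x \<in> carrier G" "y \<in> carrier G" "a \<in> carrier G" "b \<in> carrier G" for x y a b
    using that by (simp add: pullback_def H.d_mult_left H.d_mult_right)
  ultimately show ?thesis
    using G.is_group by (intro bi_metric_groupI) (auto simp: bi_invariant_metric_def)
qed

lemma Nil_in_free_group [simp]: "[] \<in> carrier (free_group X)"
  by (simp add: carrier_free_group)

section \<open>Injective relabelling of free generators\<close>

lemma word_eval_free_group_gen:
  assumes "w \<in> carrier (free_group X)"
  shows "word_eval (free_group X) gen w = w"
proof -
  interpret group "free_group X" by (rule group_free_group)
  have "(\<lambda>x. x) \<in> hom (free_group X) (free_group X)" by (intro homI) auto
  from hom_eq_word_eval[OF this assms] show ?thesis by simp
qed

lemma word_eval_relabel_inverse:
  assumes "\<And>i. i \<in> I \<Longrightarrow> t i \<in> X" and "f ` X \<subseteq> carrier (free_group I)"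
    and "\<And>i. i \<in> I \<Longrightarrow> f (t i) = gen i" and w: "w \<in> carrier (free_group I)"
  shows "word_eval (free_group I) f (word_eval (free_group X) (gen \<circ> t) w) = w"
proof -
  interpret I: group "free_group I" by (rule group_free_group)
  interpret X: group "free_group X" by (rule group_free_group)
  have l: "fst l \<in> I" if "l \<in> set w" for l
    using w that by (auto simp: carrier_free_group)
  have "word_eval (free_group I) f (word_eval (free_group X) (gen \<circ> t) w) =
      word_eval (free_group I) (word_eval (free_group I) f \<circ> (gen \<circ> t)) w"
    using assms l I.word_eval_hom[OF assms(2)]
    by (intro word_eval_comp X.is_group I.is_group) auto
  also have "\<dots> = word_eval (free_group I) gen w"
    using l assms by (intro word_eval_cong) (auto simp: image_subset_iff)
  finally show ?thesis using word_eval_free_group_gen[OF w] by simp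
qed

text \<open>A retraction that undoes the relabelling and kills all other generators is a left
  inverse, whence injectivity.\<close>

lemma word_eval_relabel_mon:
  assumes "inj_on t I" "t ` I \<subseteq> X"
  shows "word_eval (free_group X) (gen \<circ> t) \<in> mon (free_group I) (free_group X)"
proof -
  interpret X: group "free_group X" by (rule group_free_group)
  define f where "f x = (if x \<in> t ` I then gen (inv_into I t x) else [])" for x
  have "word_eval (free_group I) f (word_eval (free_group X) (gen \<circ> t) w) = w"
    if "w \<in> carrier (free_group I)" for w
    using assms that
    by (intro word_eval_relabel_inverse) (auto simp: f_def inv_into_into)
  then have "inj_on (word_eval (free_group X) (gen \<circ> t)) (carrier (free_group I))"
    by (rule inj_on_inverseI)
  moreover have "word_eval (free_group X) (gen \<circ> t) \<in> hom (free_group I) (free_group X)"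
    using assms by (intro X.word_eval_hom) auto
  ultimately show ?thesis by (simp add: mon_def)
qed

text \<open>Keeps relabelled words inside the ball on which the new metric is bounded above.\<close>

lemma length_word_eval_relabel:
  assumes "\<And>l. l \<in> set w \<Longrightarrow> t (fst l) \<in> X"
  shows "length (word_eval (free_group X) (gen \<circ> t) w) \<le> length w"
  using assms
proof (induction w)
  case Nil
  then show ?case by (simp add: word_eval_def)
next
  case (Cons l w)
  interpret X: group "free_group X" by (rule group_free_group)
  let ?l = "if snd l then gen (t (fst l)) else inv\<^bsub>free_group X\<^esub> gen (t (fst l))"
  have "length ?l = 1"
    using Cons.prems by (simp add: inv_free_group_gen) (simp add: gen_def)
  moreover have "length (word_eval (free_group X) (gen \<circ> t) w) \<le> length w"
    by (rule Cons.IH) (use Cons.prems in auto)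
  moreover have "word_eval (free_group X) (gen \<circ> t) (l # w) =
      foldr prepend ?l (word_eval (free_group X) (gen \<circ> t) w)"
    by (simp only: X.word_eval_Cons mult_free_group comp_apply)
  ultimately show ?case
    using length_foldr_prepend[of ?l "word_eval (free_group X) (gen \<circ> t) w"]
    by (simp only: list.size)
qed

lemma hom_subgroup_iff:
  "h \<in> mon G (H\<lparr>carrier := S\<rparr>) \<longleftrightarrow> h \<in> mon G H \<and> h ` carrier G \<subseteq> S" if "S \<subseteq> carrier H"
  using that by (auto simp: mon_def hom_def Pi_iff)

section \<open>The completion of the limit has the extension property\<close>

locale fraisse_completion =
  fixes K :: "nat \<Rightarrow> G1_data" and \<phi> and G1 :: "('a, 'x) monoid_scheme" and d1 and \<psi>
    and GG :: "('b, 'y) monoid_scheme" and dG and j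
  assumes fraisse: "fraisse_sequence K \<phi>" and limit: "is_direct_limit K \<phi> G1 d1 \<psi>"
    and GG: "bi_metric_group GG dG"
    and j_hom: "j \<in> hom G1 GG" and j_iso: "isometric_on (carrier G1) d1 dG j"
    and j_dense: "dense_in GG dG (j ` carrier G1)"
begin

sublocale GG: bi_metric_group GG dG by (rule GG)

lemma group_G1: "group G1"
  using limit by (simp add: is_direct_limit_def)

sublocale G1: group G1 by (rule group_G1)
sublocale j: group_hom G1 GG j
  using j_hom by (simp add: group_hom_def group_hom_axioms_def G1.is_group GG.is_group)

lemma object: "G1_object (K n)"
  using fraisse by (simp add: fraisse_sequence_def)

sublocale K: bi_metric_group "grp (K n)" "met (K n)" for n
  by (rule G1_object_bi_metric_group[OF object])

lemma \<psi>_hom: "\<psi> n \<in> hom (grp (K n)) G1"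
  using limit by (simp add: is_direct_limit_def)

sublocale \<psi>: group_hom "grp (K n)" G1 "\<psi> n" for n
  using \<psi>_hom by (simp add: group_hom_def group_hom_axioms_def G1.is_group K.is_group)

lemma \<phi>: "G1_morphism (K n) (K (Suc n)) (\<phi> n)"
  using fraisse by (simp add: fraisse_sequence_def)

lemma \<phi>_closed: "x \<in> carrier (grp (K n)) \<Longrightarrow> \<phi> n x \<in> carrier (grp (K (Suc n)))"
  using \<phi>[of n] by (auto simp: G1_morphism_def mon_def hom_def)

lemma \<psi>_Suc: "x \<in> carrier (grp (K n)) \<Longrightarrow> \<psi> (Suc n) (\<phi> n x) = \<psi> n x"
  using limit by (simp add: is_direct_limit_def)

lemma bonding:
  assumes "x \<in> carrier (grp (K n))"
  shows "bonding \<phi> n k x \<in> carrier (grp (K (n + k))) \<and> \<psi> (n + k) (bonding \<phi> n k x) = \<psi> n x"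
  using assms by (induction k) (auto simp: \<phi>_closed \<psi>_Suc)

lemma dG_j: "x \<in> carrier G1 \<Longrightarrow> y \<in> carrier G1 \<Longrightarrow> dG (j x) (j y) = d1 x y"
  using j_iso by (simp add: isometric_on_def)

lemma d1_\<psi>: "x \<in> carrier (grp (K n)) \<Longrightarrow> y \<in> carrier (grp (K n)) \<Longrightarrow> d1 (\<psi> n x) (\<psi> n y) = met (K n) x y"
  using limit by (simp add: is_direct_limit_def isometric_on_def)

lemma \<psi>_range_mono: "m \<le> n \<Longrightarrow> \<psi> m ` carrier (grp (K m)) \<subseteq> \<psi> n ` carrier (grp (K n))"
  using bonding[of _ m "n - m"] by (force simp: image_iff)

lemma carrier_G1: "carrier G1 = (\<Union>n. \<psi> n ` carrier (grp (K n)))"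
  using limit by (simp add: is_direct_limit_def)

lemma common_level:
  assumes "finite S" "S \<subseteq> carrier G1"
  obtains n where "S \<subseteq> \<psi> n ` carrier (grp (K n))"
proof -
  have "\<exists>n. S \<subseteq> \<psi> n ` carrier (grp (K n))"
    using assms
  proof (induction S rule: finite_induct)
    case (insert x S)
    then obtain m n where "S \<subseteq> \<psi> n ` carrier (grp (K n))" "x \<in> \<psi> m ` carrier (grp (K m))"
      using carrier_G1 by auto
    then have "insert x S \<subseteq> \<psi> (max m n) ` carrier (grp (K (max m n)))"
      using \<psi>_range_mono[of m "max m n"] \<psi>_range_mono[of n "max m n"] by auto
    then show ?case by blast
  qed simp
  then show ?thesis using that by blast
qed

lemma inj_\<psi>: "inj_on (\<psi> n) (carrier (grp (K n)))"
proof (rule inj_onI)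
  fix x y assume xy: "x \<in> carrier (grp (K n))" "y \<in> carrier (grp (K n))" "\<psi> n x = \<psi> n y"
  then have "met (K n) x y = d1 (\<psi> n x) (\<psi> n x)" using d1_\<psi>[of x n y] by simp
  also have "\<dots> = 0" using d1_\<psi>[of x n x] xy by simp
  finally show "x = y" using xy by simp
qed

lemma d1_eq_0:
  assumes "x \<in> carrier G1" "y \<in> carrier G1"
  shows "d1 x y = 0 \<longleftrightarrow> x = y"
proof -
  obtain n where "{x, y} \<subseteq> \<psi> n ` carrier (grp (K n))" using common_level[of "{x, y}"] assms by auto
  then obtain u v where uv: "u \<in> carrier (grp (K n))" "v \<in> carrier (grp (K n))" "x = \<psi> n u" "y = \<psi> n v"
    by auto
  then have "d1 x y = 0 \<longleftrightarrow> u = v" using d1_\<psi> by simp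
  also have "\<dots> \<longleftrightarrow> x = y" using uv inj_\<psi>[of n] by (auto simp: inj_on_def)
  finally show ?thesis .
qed

lemma inj_j: "inj_on j (carrier G1)"
  using dG_j d1_eq_0 GG.zero by (intro inj_onI) (metis j.hom_closed)

text \<open>Two elements of \<open>G1\<close> come from a common level, whose metric is bounded by
  1, and density carries the bound to the completion.\<close>

lemma dG_le_1:
  assumes x: "x \<in> carrier GG" and y: "y \<in> carrier GG"
  shows "dG x y \<le> 1"
proof (rule field_le_epsilon)
  fix e :: real assume "e > 0"
  have dense: "\<exists>u\<in>carrier G1. dG z (j u) < e / 2" if "z \<in> carrier GG" for z
    using j_dense \<open>e > 0\<close> that unfolding dense_in_def GG.dense_iff by (force dest: bspec spec[of _ "e / 2"])
  obtain u v where u: "u \<in> carrier G1" "dG x (j u) < e / 2" and v: "v \<in> carrier G1" "dG y (j v) < e / 2"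
    using dense x y by meson
  obtain n where "{u, v} \<subseteq> \<psi> n ` carrier (grp (K n))" using common_level[of "{u, v}"] u v by auto
  then obtain u' v' where "u' \<in> carrier (grp (K n))" "v' \<in> carrier (grp (K n))" "u = \<psi> n u'" "v = \<psi> n v'"
    by auto
  moreover have "bounded_by_1 (grp (K n)) (met (K n))"
    using object[of n] fg_metric_le_1 by (auto simp: G1_object_def)
  ultimately have "dG (j u) (j v) \<le> 1" using u v d1_\<psi> by (auto simp: dG_j bounded_by_1_def)
  then show "dG x y \<le> 1 + e"
    using GG.triangle[of x "j u" y] GG.triangle[of "j u" "j v" y] u v x y GG.commute[of y "j v"] by simp
qed

lemma inclusion_morphism:
  assumes L: "G1_object (fst (K N) \<union> Y, D)"
    and D: "\<And>a b. a \<in> carrier (grp (K N)) \<Longrightarrow> b \<in> carrier (grp (K N)) \<Longrightarrow> D a b = met (K N) a b"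
  shows "G1_morphism (K N) (fst (K N) \<union> Y, D) id"
proof -
  have "carrier (grp (K N)) \<subseteq> carrier (free_group (fst (K N) \<union> Y))"
    unfolding subset_iff carrier_free_group by blast
  then have "id \<in> mon (grp (K N)) (free_group (fst (K N) \<union> Y))"
    by (auto simp: mon_def hom_def)
  then show ?thesis
    unfolding G1_morphism_def using L object D by (auto simp: isometric_on_def)
qed

text \<open>The amalgamation condition is applied to the identity of \<open>K N\<close> and the
  inclusion of \<open>K N\<close> into the larger object; followed by the canonical map, the
  resulting morphism embeds the larger object into \<open>G1\<close> over
  \<open>K N\<close>.\<close>

lemma lift_extension:
  assumes L: "G1_object (fst (K N) \<union> Y, D)"
    and D: "\<And>a b. a \<in> carrier (grp (K N)) \<Longrightarrow> b \<in> carrier (grp (K N)) \<Longrightarrow> D a b = met (K N) a b"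
  obtains h where "h \<in> mon (free_group (fst (K N) \<union> Y)) G1"
    "\<And>a b. a \<in> carrier (free_group (fst (K N) \<union> Y)) \<Longrightarrow> b \<in> carrier (free_group (fst (K N) \<union> Y)) \<Longrightarrow>
       d1 (h a) (h b) = D a b"
    "\<And>a. a \<in> carrier (grp (K N)) \<Longrightarrow> h a = \<psi> N a"
proof -
  let ?L = "free_group (fst (K N) \<union> Y)"
  have "G1_morphism (K N) (K N) id"
    using inclusion_morphism[of N "{}" "met (K N)"] object[of N] by simp
  then obtain m \<iota> where m: "m > N" "G1_morphism (fst (K N) \<union> Y, D) (K m) \<iota>"
    "\<And>x. x \<in> carrier (grp (K N)) \<Longrightarrow> \<iota> x = bonding \<phi> N (m - N) x"
    using fraisse inclusion_morphism[OF L D] unfolding fraisse_sequence_def by (metis id_apply)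
  have \<iota>: "\<iota> \<in> hom ?L (grp (K m))"
    "inj_on \<iota> (carrier ?L)"
    "isometric_on (carrier ?L) D (met (K m)) \<iota>"
    using m(2) by (auto simp: G1_morphism_def mon_def)
  have closed: "\<iota> x \<in> carrier (grp (K m))" if "x \<in> carrier ?L" for x
    using \<iota>(1) that by (auto simp: hom_def)
  show ?thesis
  proof (rule that[of "\<psi> m \<circ> \<iota>"])
    have "\<psi> m \<circ> \<iota> \<in> hom ?L G1"
      using \<iota>(1) \<psi>_hom by (rule Group.hom_compose)
    moreover have "inj_on (\<psi> m \<circ> \<iota>) (carrier ?L)"
      using \<iota>(2) inj_\<psi>[of m] closed by (intro comp_inj_on) (auto elim: inj_on_subset)
    ultimately show "\<psi> m \<circ> \<iota> \<in> mon ?L G1" by (simp add: mon_def)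
    show "d1 ((\<psi> m \<circ> \<iota>) a) ((\<psi> m \<circ> \<iota>) b) = D a b"
      if "a \<in> carrier ?L" "b \<in> carrier ?L" for a b
      using that closed \<iota>(3) by (simp add: d1_\<psi> isometric_on_def)
    show "(\<psi> m \<circ> \<iota>) a = \<psi> N a" if "a \<in> carrier (grp (K N))" for a
      using that m bonding[of a N "m - N"] by simp
  qed
qed

end

context fraisse_completion
begin

lemma dG_j_\<psi>:
  "x \<in> carrier (grp (K n)) \<Longrightarrow> y \<in> carrier (grp (K n)) \<Longrightarrow> dG (j (\<psi> n x)) (j (\<psi> n y)) = met (K n) x y"
  by (simp add: dG_j d1_\<psi>)

lemma extension_property_GG: "extension_property GG dG (j ` carrier G1)"
  unfolding extension_property_def
proof (intro allI impI, elim conjE)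
  fix \<epsilon> \<epsilon>' :: real and m n :: nat and \<rho> \<iota>
  assume \<epsilon>: "\<epsilon>' < \<epsilon>" "0 < \<epsilon>'" and mn: "m < n"
    and \<rho>: "bi_invariant_metric (F n) \<rho>" and \<rho>1: "bounded_by_1 (F n) \<rho>"
    and \<iota>: "\<iota> \<in> mon (F m) GG" and dist: "metric_dist m \<rho> (pullback \<iota> dG) < \<epsilon>"
  interpret \<rho>: bi_metric_group "F n" \<rho> using group_F \<rho> by (rule bi_metric_groupI)
  have Fm: "carrier (F m) \<subseteq> carrier (F n)" using mn by (intro F_mono) simp
  have \<rho>_bound: "0 \<le> \<rho> g [] \<and> \<rho> g [] \<le> 1" if "g \<in> carrier (F n)" for g
    using that \<rho>1 by (simp add: bounded_by_1_def)
  have \<iota>_hom: "\<iota> \<in> hom (F m) GG" using \<iota> by (simp add: mon_def)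
  interpret \<iota>: group_hom "F m" GG \<iota>
    using \<iota>_hom by (simp add: group_hom_def group_hom_axioms_def group_F GG.is_group)
  obtain e where e: "0 < e" "e < \<epsilon>"
    "\<And>g. g \<in> carrier (F m) \<Longrightarrow> \<bar>\<rho> g [] - dG (\<iota> g) \<one>\<^bsub>GG\<^esub>\<bar> \<le> e * real (length g)"
  proof (rule metric_dist_lessD[OF dist])
    show "0 \<le> \<rho> g [] \<and> \<rho> g [] \<le> 1" if "g \<in> carrier (F m)" for g
      using that Fm \<rho>_bound by auto
    show "0 \<le> pullback \<iota> dG g [] \<and> pullback \<iota> dG g [] \<le> 1" if "g \<in> carrier (F m)" for g
      using that dG_le_1 by (simp add: pullback_def)
    show "\<rho> [] [] = pullback \<iota> dG [] []" by (simp add: pullback_def)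
  next
    fix e assume "0 < e" "e < \<epsilon>"
      "\<And>g. g \<in> carrier (F m) \<Longrightarrow> \<bar>\<rho> g [] - pullback \<iota> dG g []\<bar> \<le> e * real (length g)"
    then show thesis using that[of e] \<iota>.hom_one by (simp add: pullback_def)
  qed
  \<comment> \<open>The slack below \<epsilon> is cut into three parts: one for the change of norms
    when \<iota> is moved into \<open>G1\<close>, one for choosing a rational constant, one for the
    distance between the old and the moved generators.\<close>
  define \<delta> where "\<delta> = (\<epsilon> - e) / 3"
  have \<delta>: "0 < \<delta>" "e + \<delta> < e + 2 * \<delta>" "e + 2 * \<delta> + \<delta> = \<epsilon>" using e by (auto simp: \<delta>_def field_simps)
  have "\<exists>x\<in>carrier G1. dG (\<iota> (gen i)) (j x) < \<delta>" if "i \<in> {1..m}" for i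
  proof -
    have "\<iota> (gen i) \<in> carrier GG" using that by simp
    then show ?thesis using j_dense \<delta>(1) unfolding dense_in_def GG.dense_iff by blast
  qed
  then obtain x where x: "\<And>i. i \<in> {1..m} \<Longrightarrow> x i \<in> carrier G1 \<and> dG (\<iota> (gen i)) (j (x i)) < \<delta>"
    by metis
  obtain N where "x ` {1..m} \<subseteq> \<psi> N ` carrier (grp (K N))"
  proof (rule common_level)
    show "x ` {1..m} \<subseteq> carrier G1" using x by blast
  qed auto
  then have "\<forall>i\<in>{1..m}. \<exists>k\<in>carrier (grp (K N)). x i = \<psi> N k" by blast
  then obtain k where k: "\<And>i. i \<in> {1..m} \<Longrightarrow> k i \<in> carrier (grp (K N)) \<and> x i = \<psi> N (k i)"
    by metis
  obtain X d where Xd: "K N = (X, d)" by (cases "K N")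
  have finX: "finite X" using object[of N] Xd by (simp add: G1_object_def)
  \<comment> \<open>The shift beyond the largest element of \<open>X\<close> makes the copies of the
    \<open>n\<close> generators fresh; the inserted 0 covers the case of empty
    \<open>X\<close>.\<close>
  define \<sigma> where "\<sigma> i = i + Suc (Max (insert 0 X))" for i
  define Y where "Y = \<sigma> ` {1..n}"
  have \<sigma>: "inj_on \<sigma> A" for A by (auto simp: \<sigma>_def inj_on_def)
  have XY: "X \<inter> Y = {}"
  proof -
    have "\<sigma> i \<notin> X" for i
    proof
      assume "\<sigma> i \<in> X"
      then have "\<sigma> i \<le> Max (insert 0 X)" using finX by (intro Max_ge) auto
      moreover have "Max (insert 0 X) < \<sigma> i" unfolding \<sigma>_def by linarith
      ultimately show False by linarith
    qed
    then show ?thesis by (auto simp: Y_def)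
  qed
  define \<tau> where "\<tau> = word_eval (F n) (gen \<circ> inv_into {1..n} \<sigma>)"
  define s where "s = word_eval (free_group Y) (gen \<circ> \<sigma>)"
  have inv_\<sigma>: "inv_into {1..n} \<sigma> (\<sigma> i) = i" if "i \<in> {1..n}" for i
    using \<sigma> that by (rule inv_into_f_f)
  have "inj_on (inv_into {1..n} \<sigma>) Y" "inv_into {1..n} \<sigma> ` Y \<subseteq> {1..n}"
    unfolding Y_def by (rule inj_on_inv_into, simp) (intro image_subsetI inv_into_into)
  then have \<tau>: "\<tau> \<in> mon (free_group Y) (F n)"
    unfolding \<tau>_def F_def by (rule word_eval_relabel_mon)
  have s: "s \<in> mon (F n) (free_group Y)"
    unfolding s_def F_def using \<sigma> by (rule word_eval_relabel_mon) (simp add: Y_def)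
  have \<tau>s: "\<tau> (s w) = w" if "w \<in> carrier (F n)" for w
    unfolding \<tau>_def s_def F_def
  proof (rule word_eval_relabel_inverse)
    show "\<sigma> i \<in> Y" if "i \<in> {1..n}" for i using that by (simp add: Y_def)
    show "(gen \<circ> inv_into {1..n} \<sigma>) ` Y \<subseteq> carrier (free_group {1..n})"
      using \<open>inv_into {1..n} \<sigma> ` Y \<subseteq> {1..n}\<close> by (simp only: image_subset_iff gen_in_free_group comp_apply)
    show "(gen \<circ> inv_into {1..n} \<sigma>) (\<sigma> i) = gen i" if "i \<in> {1..n}" for i
      by (simp only: comp_apply inv_\<sigma>[OF that])
  qed (use that in \<open>simp add: F_def\<close>)
  define \<rho>Y where "\<rho>Y = pullback \<tau> \<rho>"
  have \<rho>Y: "bi_metric_group (free_group Y) \<rho>Y"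
    unfolding \<rho>Y_def using group_free_group \<rho>.bi_metric_group_axioms \<tau> by (rule bi_metric_group_pullback)
  have s_closed: "s w \<in> carrier (free_group Y)" if "w \<in> carrier (F n)" for w
    using s that by (auto simp: mon_def hom_def)
  have \<tau>_Nil: "\<tau> [] = []" by (simp add: \<tau>_def word_eval_def)
  have s_Nil: "s [] = []" by (simp add: s_def word_eval_def)
  have \<rho>Y_s: "\<rho>Y (s w) [] = \<rho> w []" if "w \<in> carrier (F n)" for w
    using that \<tau>s \<tau>_Nil by (simp add: \<rho>Y_def pullback_def)
  define y where "y = gen \<circ> \<sigma>"
  \<comment> \<open>Moving the generators by less than \<delta> changes the norm of a word by at
    most \<delta> per letter, so the admissible constant grows from \<open>e\<close> to
    \<open>e + \<delta>\<close>.\<close>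
  have close: "\<bar>\<rho>Y (word_eval (free_group Y) y v) [] - d (word_eval (free_group X) k v) []\<bar> \<le> (e + \<delta>) * real (length v)"
    if v: "v \<in> carrier (F m)" for v
  proof -
    have l: "fst l \<in> {1..m}" if "l \<in> set v" for l
      using v that by (auto simp: F_def carrier_free_group)
    have "\<rho>Y (word_eval (free_group Y) y v) [] = \<rho> v []"
      using \<rho>Y_s[of v] v Fm by (auto simp: s_def y_def)
    moreover have "d (word_eval (free_group X) k v) [] = dG (word_eval GG (j \<circ> x) v) \<one>\<^bsub>GG\<^esub>"
    proof -
      let ?w = "word_eval (grp (K N)) k v"
      have w: "?w \<in> carrier (grp (K N))" using l k by (intro K.word_eval_closed) auto
      have "\<psi> N ?w = word_eval G1 (\<psi> N \<circ> k) v"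
        using l k by (intro word_eval_comp K.is_group G1.is_group \<psi>_hom) auto
      also have "j \<dots> = word_eval GG (j \<circ> (\<psi> N \<circ> k)) v"
        using l k by (intro word_eval_comp G1.is_group GG.is_group j_hom) auto
      also have "\<dots> = word_eval GG (j \<circ> x) v"
        using l k by (intro word_eval_cong) auto
      finally have "dG (word_eval GG (j \<circ> x) v) \<one>\<^bsub>GG\<^esub> = dG (j (\<psi> N ?w)) (j (\<psi> N \<one>\<^bsub>grp (K N)\<^esub>))"
        by (simp del: one_free_group)
      also have "\<dots> = met (K N) ?w \<one>\<^bsub>grp (K N)\<^esub>"
        using w K.one_closed by (rule dG_j_\<psi>)
      finally show ?thesis by (simp add: Xd)
    qed
    moreover have "\<iota> v = word_eval GG (\<iota> \<circ> gen) v"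
      using GG.hom_eq_word_eval[OF \<iota>_hom[unfolded F_def]] v by (simp add: F_def comp_def)
    moreover have "dG (word_eval GG (\<iota> \<circ> gen) v) (word_eval GG (j \<circ> x) v) \<le> \<delta> * real (length v)"
      using l x by (intro GG.word_eval_dist_le) (auto intro: less_imp_le)
    moreover have "\<bar>dG (word_eval GG (\<iota> \<circ> gen) v) \<one>\<^bsub>GG\<^esub> - dG (word_eval GG (j \<circ> x) v) \<one>\<^bsub>GG\<^esub>\<bar> \<le>
        dG (word_eval GG (\<iota> \<circ> gen) v) (word_eval GG (j \<circ> x) v)"
    proof -
      show ?thesis by (intro GG.norm_diff_le GG.word_eval_closed) (use l x in auto)
    qed
    ultimately show ?thesis using e(3)[OF v] by (simp add: algebra_simps)
  qed
  obtain \<epsilon>0 where \<epsilon>0: "\<epsilon>0 \<in> \<rat>" "e + \<delta> < \<epsilon>0" "\<epsilon>0 < e + 2 * \<delta>"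
    using Rats_dense_in_real[OF \<delta>(2)] by blast
  \<comment> \<open>For words longer than \<open>r\<close> the permitted error, \<epsilon>'/2 per
    letter, is at least 1 and holds for any two metrics bounded by 1. The factor 1/2 leaves the
    final inequality strict.\<close>
  define r where "r = nat \<lceil>2 / \<epsilon>'\<rceil>"
  obtain D where D: "G1_object (X \<union> Y, D)"
    "\<And>a b. a \<in> carrier (free_group X) \<Longrightarrow> b \<in> carrier (free_group X) \<Longrightarrow> D a b = d a b"
    "\<And>i. i \<in> {1..m} \<Longrightarrow> D (y i) (k i) \<le> \<epsilon>0"
    "\<And>g. g \<in> carrier (free_group Y) \<Longrightarrow> \<rho>Y g [] \<le> D g [] \<or> D g [] = 1"
    "\<And>g. g \<in> carrier (free_group Y) \<Longrightarrow> length g \<le> r \<Longrightarrow> D g [] \<le> \<rho>Y g [] + \<epsilon>' / 2"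
  proof (rule extension_object[of X d Y \<rho>Y k m y \<epsilon>0 "\<epsilon>' / 2" r])
    show "G1_object (X, d)" using object[of N] Xd by simp
    show "finite Y" by (simp add: Y_def)
    show "k ` {1..m} \<subseteq> carrier (free_group X)" using k Xd by auto
    show "y ` {1..m} \<subseteq> carrier (free_group Y)" using mn by (auto simp: y_def Y_def)
    show "\<bar>\<rho>Y (word_eval (free_group Y) y v) [] - d (word_eval (free_group X) k v) []\<bar> \<le> \<epsilon>0 * real (length v)"
      if "v \<in> carrier (F m)" for v
      using close[OF that] mult_right_mono[of "e + \<delta>" \<epsilon>0 "real (length v)"] \<epsilon>0 by simp
  qed (use XY \<rho>Y \<epsilon>0 e \<delta> \<epsilon> in auto)
  obtain h where h: "h \<in> mon (free_group (X \<union> Y)) G1"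
    "\<And>a b. a \<in> carrier (free_group (X \<union> Y)) \<Longrightarrow> b \<in> carrier (free_group (X \<union> Y)) \<Longrightarrow>
       d1 (h a) (h b) = D a b"
    "\<And>a. a \<in> carrier (free_group X) \<Longrightarrow> h a = \<psi> N a"
    using lift_extension[of N Y D] D(1,2) Xd by auto
  have sub: "carrier (free_group X) \<subseteq> carrier (free_group (X \<union> Y))"
    "carrier (free_group Y) \<subseteq> carrier (free_group (X \<union> Y))"
    unfolding subset_iff carrier_free_group by blast+
  have h_closed: "h a \<in> carrier G1" if "a \<in> carrier (free_group (X \<union> Y))" for a
    using h(1) that by (auto simp: mon_def hom_def)
  have hs_closed: "h (s w) \<in> carrier G1" if "w \<in> carrier (F n)" for w
    using that h_closed s_closed sub by blast
  interpret D: bi_metric_group "free_group (X \<union> Y)" D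
    using G1_object_bi_metric_group[OF D(1)] by simp
  have D1: "D a b \<le> 1" if "a \<in> carrier (free_group (X \<union> Y))" "b \<in> carrier (free_group (X \<union> Y))" for a b
    using that D(1) fg_metric_le_1 unfolding G1_object_def bounded_by_1_def by force
  define \<kappa> where "\<kappa> = j \<circ> (h \<circ> s)"
  have "h \<in> hom (free_group Y) G1"
  proof (rule homI)
    have "h \<in> hom (free_group (X \<union> Y)) G1" using h(1) by (simp add: mon_def)
    from hom_mult[OF this] show "h (a \<otimes>\<^bsub>free_group Y\<^esub> b) = h a \<otimes>\<^bsub>G1\<^esub> h b"
      if "a \<in> carrier (free_group Y)" "b \<in> carrier (free_group Y)" for a b
      using that sub by auto
  qed (use h_closed sub in auto)
  moreover have "s \<in> hom (F n) (free_group Y)" using s by (simp add: mon_def)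
  ultimately have "h \<circ> s \<in> hom (F n) G1" by (rule Group.hom_compose[rotated])
  then have \<kappa>_hom: "\<kappa> \<in> hom (F n) GG"
    unfolding \<kappa>_def using j_hom by (rule Group.hom_compose)
  have "inj_on (h \<circ> s) (carrier (F n))"
    using s h(1) s_closed sub by (intro comp_inj_on) (auto simp: mon_def intro: inj_on_subset)
  then have \<kappa>_inj: "inj_on \<kappa> (carrier (F n))"
    unfolding \<kappa>_def
    by (rule comp_inj_on[OF _ inj_on_subset[OF inj_j]]) (use h_closed s_closed sub in auto)
  have \<kappa>_range: "\<kappa> ` carrier (F n) \<subseteq> j ` carrier G1"
    using hs_closed by (auto simp: \<kappa>_def)
  have "j ` carrier G1 \<subseteq> carrier GG" by auto
  then have \<kappa>: "\<kappa> \<in> mon (F n) (GG\<lparr>carrier := j ` carrier G1\<rparr>)"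
    using \<kappa>_hom \<kappa>_inj \<kappa>_range by (subst hom_subgroup_iff) (auto simp: mon_def)
  have \<kappa>_D: "dG (\<kappa> v) (\<kappa> w) = D (s v) (s w)" if "v \<in> carrier (F n)" "w \<in> carrier (F n)" for v w
  proof -
    have "d1 (h (s v)) (h (s w)) = D (s v) (s w)" using that s_closed sub by (intro h(2)) blast+
    then show ?thesis using that hs_closed by (simp add: \<kappa>_def dG_j)
  qed
  have gens: "dG (\<kappa> (gen i)) (\<iota> (gen i)) < \<epsilon>" if i: "i \<in> {1..m}" for i
  proof -
    have "s (gen i) = y i"
    proof -
      interpret Y: group "free_group Y" by (rule group_free_group)
      have "(gen \<circ> \<sigma>) i \<in> carrier (free_group Y)" using i mn by (auto simp: Y_def)
      then show ?thesis unfolding s_def y_def by (rule Y.word_eval_gen)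
    qed
    then have \<kappa>_gen: "\<kappa> (gen i) = j (h (y i))" by (simp add: \<kappa>_def)
    have yi: "y i \<in> carrier (free_group (X \<union> Y))" using i mn sub by (auto simp: y_def Y_def)
    have ki: "k i \<in> carrier (free_group X)" "x i = h (k i)" using k[OF i] Xd h(3) by auto
    have "d1 (h (y i)) (h (k i)) = D (y i) (k i)" using yi ki sub by (intro h(2)) blast+
    then have "dG (j (h (y i))) (j (x i)) = D (y i) (k i)"
      using h_closed[OF yi] x[OF i] ki by (simp add: dG_j)
    then have "dG (\<kappa> (gen i)) (j (x i)) \<le> \<epsilon>0" using D(3)[OF i] \<kappa>_gen by simp
    moreover have "dG (j (x i)) (\<iota> (gen i)) < \<delta>" using x[OF i] GG.commute by metis
    moreover have "dG (\<kappa> (gen i)) (\<iota> (gen i)) \<le> dG (\<kappa> (gen i)) (j (x i)) + dG (j (x i)) (\<iota> (gen i))"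
      using x[OF i] yi h_closed i \<kappa>_gen by (intro GG.triangle) auto
    ultimately show ?thesis using \<epsilon>0 \<delta> by linarith
  qed
  have "\<bar>\<rho> g [] - pullback \<kappa> dG g []\<bar> \<le> \<epsilon>' / 2 * real (length g)" if g: "g \<in> carrier (F n)" for g
  proof -
    have 1: "pullback \<kappa> dG g [] = D (s g) []"
      using \<kappa>_D[OF g] s_Nil by (simp add: pullback_def)
    have sg: "s g \<in> carrier (free_group Y)" using s_closed[OF g] .
    have D01: "0 \<le> D (s g) []" "D (s g) [] \<le> 1" using D1[of "s g" "[]"] sg sub by auto
    have \<rho>01: "0 \<le> \<rho> g []" "\<rho> g [] \<le> 1" using \<rho>_bound[OF g] by auto
    \<comment> \<open>Truncation does no harm, since \<rho> is bounded by 1 as well.\<close>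
    have low: "\<rho> g [] \<le> D (s g) []" using D(4)[OF sg] \<rho>Y_s[OF g] \<rho>01 by auto
    show ?thesis
    proof (cases "g = []")
      case True
      then show ?thesis using 1 s_Nil by simp
    next
      case False
      then have len1: "1 \<le> real (length g)" by (cases g) auto
      show ?thesis
      proof (cases "length g \<le> r")
        case True
        have "length (s g) \<le> length g"
          unfolding s_def using g by (intro length_word_eval_relabel) (auto simp: Y_def F_def carrier_free_group)
        then have "D (s g) [] \<le> \<rho> g [] + \<epsilon>' / 2"
          using D(5)[OF sg] True \<rho>Y_s[OF g] by simp
        moreover have "\<epsilon>' / 2 * 1 \<le> \<epsilon>' / 2 * real (length g)"
          using len1 \<epsilon> by (intro mult_left_mono) auto
        ultimately show ?thesis using low 1 by simp
      next
        case False
        then have "2 / \<epsilon>' \<le> real (length g)" unfolding r_def by linarith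
        then have "1 \<le> \<epsilon>' / 2 * real (length g)" using \<epsilon> by (simp add: field_simps)
        moreover have "\<bar>\<rho> g [] - D (s g) []\<bar> \<le> 1" using low D01 \<rho>01 by linarith
        ultimately show ?thesis unfolding 1 by linarith
      qed
    qed
  qed
  then have "metric_dist n \<rho> (pullback \<kappa> dG) < \<epsilon>'"
    using \<epsilon> by (intro metric_dist_less[of "\<epsilon>' / 2"]) auto
  then show "\<exists>\<kappa>\<in>mon (F n) (GG\<lparr>carrier := j ` carrier G1\<rparr>).
      (\<forall>i\<in>{1..m}. dG (\<kappa> (gen i)) (\<iota> (gen i)) < \<epsilon>) \<and> metric_dist n \<rho> (pullback \<kappa> dG) < \<epsilon>'"
    using \<kappa> gens by blast
qed

section \<open>Freeness and infinite rank of the limit\<close>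

text \<open>Without relations all chains are diagonal, and the metric is the discrete one with value
  1. Its purpose is to provide objects of every finite rank.\<close>

lemma exists_object:
  assumes "finite X"
  shows "\<exists>D. G1_object (X, D)"
proof -
  interpret rm: relation_metric "free_group X" "{[l] |l :: nat \<times> bool. fst l \<in> X}" "{}"
  proof (intro relation_metric.intro relation_metric_axioms.intro group_free_group)
    show "finite {[l] |l :: nat \<times> bool. fst l \<in> X}" by (rule finite_letters[OF assms])
    show "{[l] |l :: nat \<times> bool. fst l \<in> X} \<subseteq> carrier (free_group X)"
      by (auto simp: carrier_free_group reduced_word_def)
    show "m_inv (free_group X) ` {[l] |l :: nat \<times> bool. fst l \<in> X} \<subseteq> {[l] |l. fst l \<in> X}"
      by (auto simp: inv_letter letter_inv_def)
    show "generate (free_group X) {[l] |l :: nat \<times> bool. fst l \<in> X} = carrier (free_group X)"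
      by (rule generate_letters)
  qed auto
  show ?thesis
    using assms rm.fg_metric_gdist rm.rational_gdist by (auto simp: G1_object_def)
qed

text \<open>Morphisms send generators to generators, so their images in the limit form an increasing
  union of finite free bases; any relation among them would already hold at one level.\<close>

lemma G1_free: "G1 \<cong> free_group (UNIV :: nat set)"
proof -
  define S where "S n = \<psi> n ` gen ` fst (K n)" for n
  have S_sub: "S n \<subseteq> carrier G1" for n
    by (auto simp: S_def intro!: \<psi>.hom_closed)
  have S_Suc: "S n \<subseteq> S (Suc n)" for n
  proof
    fix a assume "a \<in> S n"
    then obtain x where x: "x \<in> fst (K n)" "a = \<psi> n (gen x)" by (auto simp: S_def)
    moreover have "\<phi> n (gen x) \<in> gen ` fst (K (Suc n))"
      using \<phi>[of n] x unfolding G1_morphism_def by blast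
    ultimately have "\<psi> (Suc n) (\<phi> n (gen x)) \<in> S (Suc n)" unfolding S_def by blast
    moreover have "gen x \<in> carrier (grp (K n))" using x by simp
    ultimately show "a \<in> S (Suc n)"
      using \<psi>_Suc[of "gen x" n] x(2) by (simp only:)
  qed
  then have S_mono: "S m \<subseteq> S n" if "m \<le> n" for m n
    using that by (rule lift_Suc_mono_le)
  have fin: "finite (fst (K n))" for n
    using object[of n] by (simp add: G1_object_def)
  \<comment> \<open>The infinite rank comes from universality: an object on \<open>c\<close>
    generators embeds in some \<open>K n\<close>, and its generators go to distinct
    generators.\<close>
  have card: "\<exists>n. c \<le> card (S n)" for c
  proof -
    obtain D where "G1_object ({1..c}, D)" using exists_object[of "{1..c}"] by auto
    then obtain n f where f: "G1_morphism ({1..c}, D) (K n) f"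
      using fraisse unfolding fraisse_sequence_def by blast
    have inj: "inj_on f (gen ` {1..c})"
      using f by (auto simp: G1_morphism_def mon_def elim!: inj_on_subset)
    have inj_gen: "inj_on gen A" for A :: "nat set" by (auto simp: inj_on_def gen_def)
    have "c = card (f ` gen ` {1..c})"
      using inj inj_gen by (simp add: card_image)
    also have "\<dots> \<le> card (gen ` fst (K n))"
      using f fin by (intro card_mono) (auto simp: G1_morphism_def)
    also have "\<dots> = card (S n)"
      unfolding S_def
      by (rule card_image[symmetric], rule inj_on_subset[OF inj_\<psi>]) auto
    finally show ?thesis by blast
  qed
  have "infinite (\<Union>n. S n)"
  proof
    assume *: "finite (\<Union>n. S n)"
    obtain n where "Suc (card (\<Union>n. S n)) \<le> card (S n)" using card by blast
    moreover have "card (S n) \<le> card (\<Union>n. S n)" using * by (intro card_mono) auto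
    ultimately show False by simp
  qed
  moreover have "countable (\<Union>n. S n)"
    using fin by (intro countable_UN) (auto simp: S_def intro!: countable_finite)
  ultimately obtain b where b: "bij_betw b (UNIV :: nat set) (\<Union>n. S n)"
    using bij_betw_from_nat_into by blast
  have b_car: "b i \<in> carrier G1" for i
  proof -
    have "b i \<in> (\<Union>n. S n)" using b by (auto simp: bij_betw_def)
    then show ?thesis using S_sub by blast
  qed
  let ?FU = "free_group (UNIV :: nat set)"
  interpret FU: group ?FU by (rule group_free_group)
  let ?h = "word_eval G1 b"
  have h_hom: "?h \<in> hom ?FU G1" using b_car by (intro G1.word_eval_hom) auto
  interpret h: group_hom ?FU G1 ?h
    using h_hom by (simp add: group_hom_def group_hom_axioms_def G1.is_group FU.is_group)
  have "carrier G1 \<subseteq> ?h ` carrier ?FU"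
  proof
    fix a assume "a \<in> carrier G1"
    then obtain n w where w: "w \<in> carrier (grp (K n))" "a = \<psi> n w" using carrier_G1 by auto
    have l: "fst l \<in> fst (K n)" if "l \<in> set w" for l
      using w that by (auto simp: carrier_free_group)
    have "\<forall>x\<in>fst (K n). \<exists>i. b i = \<psi> n (gen x)"
    proof
      fix x assume "x \<in> fst (K n)"
      then have "\<psi> n (gen x) \<in> range b" using b by (auto simp: bij_betw_def S_def)
      then show "\<exists>i. b i = \<psi> n (gen x)" by (metis imageE)
    qed
    then obtain t where t: "\<And>x. x \<in> fst (K n) \<Longrightarrow> b (t x) = \<psi> n (gen x)" by metis
    have "a = word_eval G1 (\<lambda>x. \<psi> n (gen x)) w"
      using G1.hom_eq_word_eval[OF \<psi>_hom w(1)] w(2) by simp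
    also have "\<dots> = word_eval G1 (?h \<circ> (gen \<circ> t)) w"
      using l t b_car by (intro word_eval_cong) auto
    also have "\<dots> = ?h (word_eval ?FU (gen \<circ> t) w)"
      by (intro word_eval_comp[symmetric] FU.is_group G1.is_group h_hom) auto
    finally show "a \<in> ?h ` carrier ?FU" by (auto intro!: FU.word_eval_closed)
  qed
  moreover have "inj_on ?h (carrier ?FU)"
  proof (rule h.trivial_ker_imp_inj)
    have "kernel ?FU G1 ?h \<subseteq> {\<one>\<^bsub>?FU\<^esub>}"
    proof
      fix w assume "w \<in> kernel ?FU G1 ?h"
      then have w: "w \<in> carrier ?FU" "?h w = \<one>\<^bsub>G1\<^esub>" by (auto simp: kernel_def)
      define I where "I = fst ` set w"
      have "\<exists>n. \<forall>i\<in>I'. b i \<in> S n" if "finite I'" for I'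
        using that
      proof (induction I' rule: finite_induct)
        case (insert i I')
        obtain n where "\<forall>i\<in>I'. b i \<in> S n" using insert.IH by blast
        moreover obtain n' where "b i \<in> S n'"
        proof -
          have "b i \<in> (\<Union>n. S n)" using b by (auto simp: bij_betw_def)
          then show thesis using that by blast
        qed
        ultimately have "\<forall>i\<in>insert i I'. b i \<in> S (max n n')"
          using S_mono[of n "max n n'"] S_mono[of n' "max n n'"] by auto
        then show ?case by blast
      qed simp
      from this[of I] obtain n where "\<forall>i\<in>I. b i \<in> S n" unfolding I_def by blast
      then have "\<forall>i\<in>I. \<exists>x\<in>fst (K n). b i = \<psi> n (gen x)" by (auto simp: S_def)
      then obtain t where t: "\<And>i. i \<in> I \<Longrightarrow> t i \<in> fst (K n) \<and> b i = \<psi> n (gen (t i))" by metis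
      \<comment> \<open>The finitely many letters of \<open>w\<close> correspond to distinct
        generators of one level, so \<open>w\<close> becomes a word in the free group
        \<open>grp (K n)\<close>, on which \<open>\<psi> n\<close> is injective.\<close>
      have "inj_on t I"
        using b t by (intro inj_onI) (metis bij_betw_def injD)
      then have mon: "word_eval (grp (K n)) (gen \<circ> t) \<in> mon (free_group I) (grp (K n))"
        using t by (intro word_eval_relabel_mon) auto
      have wI: "w \<in> carrier (free_group I)" using w by (simp add: carrier_free_group I_def)
      let ?v = "word_eval (grp (K n)) (gen \<circ> t) w"
      have v: "?v \<in> carrier (grp (K n))" using mon wI by (auto simp: mon_def hom_def)
      have l: "fst l \<in> I" if "l \<in> set w" for l using that by (simp add: I_def)
      have "\<psi> n ?v = word_eval G1 (\<psi> n \<circ> (gen \<circ> t)) w"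
        using l t by (intro word_eval_comp K.is_group G1.is_group \<psi>_hom) auto
      also have "\<dots> = ?h w"
        using l t by (intro word_eval_cong) auto
      finally have "\<psi> n ?v = \<psi> n \<one>\<^bsub>grp (K n)\<^esub>" using w by (simp del: one_free_group)
      then have "?v = \<one>\<^bsub>grp (K n)\<^esub>"
        using inj_\<psi>[of n] v K.one_closed unfolding inj_on_def by blast
      then have "?v = word_eval (grp (K n)) (gen \<circ> t) []" by (simp add: word_eval_def)
      then show "w \<in> {\<one>\<^bsub>?FU\<^esub>}"
        using mon wI by (auto simp: mon_def inj_on_def)
    qed
    then show "kernel ?FU G1 ?h = {\<one>\<^bsub>?FU\<^esub>}"
      by (auto simp: kernel_def simp del: one_free_group)
  qed
  ultimately have "?h \<in> iso ?FU G1"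
    using h_hom by (auto simp: iso_def bij_betw_def)
  then show ?thesis using FU.iso_sym G1.iso_sym by (auto simp: is_iso_def dest: FU.iso_set_sym)
qed

lemma image_free: "GG\<lparr>carrier := j ` carrier G1\<rparr> \<cong> free_group (UNIV :: nat set)"
proof -
  have "j \<in> iso G1 (GG\<lparr>carrier := j ` carrier G1\<rparr>)"
    using j_hom inj_j by (auto simp: iso_def hom_def bij_betw_def)
  then have "GG\<lparr>carrier := j ` carrier G1\<rparr> \<cong> G1"
    using G1.iso_set_sym by (auto simp: is_iso_def)
  then show ?thesis using G1_free iso_trans by blast
qed

lemma subgroup_image: "subgroup (j ` carrier G1) GG"
  by (rule j.img_is_subgroup)

end

section \<open>Isometric isomorphisms\<close>

lemma metric_dist_cong:
  assumes "\<And>g. g \<in> carrier (F n) \<Longrightarrow> p g [] = p' g []" "\<And>g. g \<in> carrier (F n) \<Longrightarrow> q g [] = q' g []"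
  shows "metric_dist n p q = metric_dist n p' q'"
  unfolding metric_dist_def using assms by (simp cong: conj_cong ball_cong)

lemma metric_dist_commute: "metric_dist n p q = metric_dist n q p"
  unfolding metric_dist_def by (simp add: abs_minus_commute)

lemma extension_propertyE:
  assumes "extension_property HH dH H" "\<epsilon>' < \<epsilon>" "0 < \<epsilon>'" "m < n"
    "bi_invariant_metric (F n) \<rho>" "bounded_by_1 (F n) \<rho>"
    "\<iota> \<in> mon (F m) HH" "metric_dist m \<rho> (pullback \<iota> dH) < \<epsilon>"
  obtains \<kappa> where "\<kappa> \<in> mon (F n) (HH\<lparr>carrier := H\<rparr>)"
    "\<And>i. i \<in> {1..m} \<Longrightarrow> dH (\<kappa> (gen i)) (\<iota> (gen i)) < \<epsilon>"
    "metric_dist n \<rho> (pullback \<kappa> dH) < \<epsilon>'"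
proof -
  note assms(1)[unfolded extension_property_def, THEN spec[of _ \<epsilon>], THEN spec[of _ \<epsilon>'],
      THEN spec[of _ m], THEN spec[of _ n], THEN spec[of _ \<rho>], THEN spec[of _ \<iota>]]
  then obtain \<kappa> where "\<kappa> \<in> mon (F n) (HH\<lparr>carrier := H\<rparr>)"
    "\<forall>i\<in>{1..m}. dH (\<kappa> (gen i)) (\<iota> (gen i)) < \<epsilon>"
    "metric_dist n \<rho> (pullback \<kappa> dH) < \<epsilon>'"
    using assms(2-) by (elim impE bexE) simp_all
  then show ?thesis using that[of \<kappa>] by blast
qed

definition generic_subgroup :: "('c, 'z) monoid_scheme \<Rightarrow> ('c \<Rightarrow> 'c \<Rightarrow> real) \<Rightarrow> 'c set \<Rightarrow> bool" where
  "generic_subgroup HH dH H \<longleftrightarrow> subgroup H HH \<and> HH\<lparr>carrier := H\<rparr> \<cong> free_group (UNIV :: nat set) \<and>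
     dense_in HH dH H \<and> extension_property HH dH H"

text \<open>An extension problem in \<open>HH\<close> is pulled back along the inverse isometry,
  solved in \<open>GG\<close> and pushed forward; the relevant distances are unchanged.\<close>

lemma generic_subgroup_transport:
  assumes GG: "bi_metric_group GG dG" and HH: "bi_metric_group HH dH"
    and g: "g \<in> iso GG HH" and iso: "isometric_on (carrier GG) dG dH g"
    and J: "generic_subgroup GG dG J"
  shows "generic_subgroup HH dH (g ` J)"
proof -
  interpret GG: bi_metric_group GG dG by (rule GG)
  interpret HH: bi_metric_group HH dH by (rule HH)
  have bij: "bij_betw g (carrier GG) (carrier HH)" and hom: "g \<in> hom GG HH"
    using g by (auto simp: iso_def)
  interpret g: group_hom GG HH g
    using hom by (simp add: group_hom_def group_hom_axioms_def GG.is_group HH.is_group)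
  have subJ: "subgroup J GG" and J_car: "J \<subseteq> carrier GG"
    using J subgroup.subset by (auto simp: generic_subgroup_def)
  have dg: "dH (g x) (g y) = dG x y" if "x \<in> carrier GG" "y \<in> carrier GG" for x y
    using iso that by (simp add: isometric_on_def)
  define f where "f = inv_into (carrier GG) g"
  have f_hom: "f \<in> hom HH GG" and f_bij: "bij_betw f (carrier HH) (carrier GG)"
    using GG.iso_set_sym[OF g] by (auto simp: f_def iso_def)
  have gf: "g (f x) = x" "f x \<in> carrier GG" if "x \<in> carrier HH" for x
    using bij that f_bij by (auto simp: f_def bij_betw_def f_inv_into_f)
  have "subgroup (g ` J) HH" using subJ by (rule g.subgroup_img_is_subgroup)
  moreover have "HH\<lparr>carrier := g ` J\<rparr> \<cong> free_group (UNIV :: nat set)"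
  proof -
    have "g \<in> hom (GG\<lparr>carrier := J\<rparr>) (HH\<lparr>carrier := g ` J\<rparr>)"
      using J_car by (intro homI) (auto simp: subset_iff)
    moreover have "bij_betw g J (g ` J)"
      using bij J_car by (meson bij_betw_subset)
    ultimately have "g \<in> iso (GG\<lparr>carrier := J\<rparr>) (HH\<lparr>carrier := g ` J\<rparr>)"
      by (simp add: iso_def)
    moreover have "group (GG\<lparr>carrier := J\<rparr>)"
      using subJ GG.subgroup_imp_group by blast
    ultimately have "HH\<lparr>carrier := g ` J\<rparr> \<cong> GG\<lparr>carrier := J\<rparr>"
      using group.iso_set_sym by (fastforce simp: is_iso_def)
    then show ?thesis using J iso_trans by (auto simp: generic_subgroup_def)
  qed
  moreover have "dense_in HH dH (g ` J)"
    unfolding dense_in_def HH.dense_iff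
  proof (intro ballI allI impI)
    fix x and e :: real assume x: "x \<in> carrier HH" "e > 0"
    then obtain y where y: "y \<in> J" "dG (f x) y < e"
      using J gf[of x] unfolding generic_subgroup_def dense_in_def GG.dense_iff by blast
    then have "dH (g (f x)) (g y) < e" using dg[of "f x" y] gf x J_car by auto
    moreover have "g y \<in> g ` J \<inter> carrier HH" using y J_car by auto
    ultimately show "\<exists>z\<in>g ` J \<inter> carrier HH. dH x z < e"
      using gf x by auto
  qed
  moreover have "extension_property HH dH (g ` J)"
    unfolding extension_property_def
  proof (intro allI impI, elim conjE)
    fix \<epsilon> \<epsilon>' :: real and m n :: nat and \<rho> \<iota>
    assume \<epsilon>: "\<epsilon>' < \<epsilon>" "0 < \<epsilon>'" and mn: "m < n"
      and \<rho>: "bi_invariant_metric (F n) \<rho>" "bounded_by_1 (F n) \<rho>"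
      and \<iota>: "\<iota> \<in> mon (F m) HH" and dist: "metric_dist m \<rho> (pullback \<iota> dH) < \<epsilon>"
    have \<iota>_car: "\<iota> v \<in> carrier HH" if "v \<in> carrier (F m)" for v
      using \<iota> that by (auto simp: mon_def hom_def)
    have "f \<circ> \<iota> \<in> hom (F m) GG"
      using \<iota> f_hom by (auto simp: mon_def intro: Group.hom_compose)
    moreover have "inj_on (f \<circ> \<iota>) (carrier (F m))"
      using \<iota> f_bij \<iota>_car by (auto simp: mon_def bij_betw_def inj_on_def)
    ultimately have fmon: "f \<circ> \<iota> \<in> mon (F m) GG" by (simp add: mon_def)
    have "pullback (f \<circ> \<iota>) dG v [] = pullback \<iota> dH v []" if "v \<in> carrier (F m)" for v
      using dg[of "f (\<iota> v)" "f (\<iota> [])"] that \<iota>_car gf by (simp add: pullback_def)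
    then have dist': "metric_dist m \<rho> (pullback (f \<circ> \<iota>) dG) < \<epsilon>"
      using dist metric_dist_cong[of m \<rho> \<rho> "pullback (f \<circ> \<iota>) dG" "pullback \<iota> dH"] by simp
    have ext: "extension_property GG dG J" using J by (simp add: generic_subgroup_def)
    obtain \<kappa> where \<kappa>: "\<kappa> \<in> mon (F n) (GG\<lparr>carrier := J\<rparr>)"
      "\<And>i. i \<in> {1..m} \<Longrightarrow> dG (\<kappa> (gen i)) ((f \<circ> \<iota>) (gen i)) < \<epsilon>"
      "metric_dist n \<rho> (pullback \<kappa> dG) < \<epsilon>'"
      by (rule extension_propertyE[OF ext \<epsilon> mn \<rho> fmon dist']) blast
    have \<kappa>_mon: "\<kappa> \<in> mon (F n) GG" and \<kappa>_J: "\<kappa> ` carrier (F n) \<subseteq> J"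
      using \<kappa>(1) unfolding hom_subgroup_iff[OF J_car] by blast+
    then have \<kappa>_car: "\<kappa> v \<in> carrier GG" if "v \<in> carrier (F n)" for v
      using that J_car by auto
    have "g \<circ> \<kappa> \<in> hom (F n) HH"
      using \<kappa>_mon hom by (auto simp: mon_def intro: Group.hom_compose)
    moreover have "inj_on (g \<circ> \<kappa>) (carrier (F n))"
      using \<kappa>_mon bij \<kappa>_car by (auto simp: mon_def bij_betw_def inj_on_def)
    moreover have "g ` J \<subseteq> carrier HH" using J_car by auto
    ultimately have 1: "g \<circ> \<kappa> \<in> mon (F n) (HH\<lparr>carrier := g ` J\<rparr>)"
      using \<kappa>_J by (subst hom_subgroup_iff) (auto simp: mon_def)
    have 2: "dH ((g \<circ> \<kappa>) (gen i)) (\<iota> (gen i)) < \<epsilon>" if "i \<in> {1..m}" for i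
    proof -
      have "\<kappa> (gen i) \<in> carrier GG" "\<iota> (gen i) \<in> carrier HH"
        using that mn \<kappa>_car \<iota>_car by auto
      then show ?thesis
        using \<kappa>(2)[OF that] dg[of "\<kappa> (gen i)" "f (\<iota> (gen i))"] gf by simp
    qed
    have "pullback (g \<circ> \<kappa>) dH v [] = pullback \<kappa> dG v []" if "v \<in> carrier (F n)" for v
      using dg[of "\<kappa> v" "\<kappa> []"] that \<kappa>_car by (simp add: pullback_def)
    then have "metric_dist n \<rho> (pullback (g \<circ> \<kappa>) dH) < \<epsilon>'"
      using \<kappa>(3) metric_dist_cong[of n \<rho> \<rho> "pullback (g \<circ> \<kappa>) dH" "pullback \<kappa> dG"] by simp
    with 1 2 show "\<exists>\<kappa>\<in>mon (F n) (HH\<lparr>carrier := g ` J\<rparr>).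
        (\<forall>i\<in>{1..m}. dH (\<kappa> (gen i)) (\<iota> (gen i)) < \<epsilon>) \<and> metric_dist n \<rho> (pullback \<kappa> dH) < \<epsilon>'"
      by blast
  qed
  ultimately show ?thesis by (simp add: generic_subgroup_def)
qed

section \<open>Extending isometries from dense images to complete groups\<close>

lemma (in Metric_space) geometric_limit:
  assumes "mcomplete" and "\<And>n. \<sigma> n \<in> M" and "0 \<le> C"
    and step: "\<And>n. d (\<sigma> n) (\<sigma> (Suc n)) \<le> C * (1/2) ^ n"
  obtains x where "x \<in> M" "\<And>n. d (\<sigma> n) x \<le> 2 * C * (1/2) ^ n"
proof -
  \<comment> \<open>The exact partial sum of the geometric series; the subtracted term pays for the
    next step of the induction.\<close>
  have tail: "d (\<sigma> n) (\<sigma> (n + k)) \<le> 2 * C * (1/2) ^ n - 2 * C * (1/2) ^ (n + k)" for n k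
  proof (induction k)
    case (Suc k)
    have "d (\<sigma> n) (\<sigma> (n + Suc k)) \<le> d (\<sigma> n) (\<sigma> (n + k)) + d (\<sigma> (n + k)) (\<sigma> (Suc (n + k)))"
      using triangle assms(2) by simp
    then show ?case using Suc step[of "n + k"] by simp
  qed (use assms(2) in simp)
  then have tail': "d (\<sigma> n) (\<sigma> (n + k)) \<le> 2 * C * (1/2) ^ n" for n k
    using assms(3) by (smt (verit) mult_nonneg_nonneg zero_le_power divide_nonneg_nonneg)
  have "(\<lambda>n. 2 * C * (1/2) ^ n) \<longlonglongrightarrow> 2 * C * 0"
    by (intro tendsto_intros LIMSEQ_power_zero) simp
  then have lim0: "(\<lambda>n. 2 * C * (1/2) ^ n) \<longlonglongrightarrow> 0" by simp
  have "MCauchy \<sigma>"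
    unfolding MCauchy_def
  proof (intro conjI allI impI)
    show "range \<sigma> \<subseteq> M" using assms(2) by auto
    fix e :: real assume "e > 0"
    then obtain N where "\<And>n. n \<ge> N \<Longrightarrow> 2 * C * (1/2) ^ n < e"
      using order_tendstoD(2)[OF lim0] by (auto simp: eventually_sequentially)
    then have N: "\<And>n k. n \<ge> N \<Longrightarrow> d (\<sigma> n) (\<sigma> (n + k)) < e"
      using tail' by (meson le_less_trans)
    show "\<exists>N. \<forall>n n'. N \<le> n \<longrightarrow> N \<le> n' \<longrightarrow> d (\<sigma> n) (\<sigma> n') < e"
    proof (intro exI[of _ N] allI impI)
      fix n n' assume "N \<le> n" "N \<le> n'"
      then show "d (\<sigma> n) (\<sigma> n') < e"
        using N[of n "n' - n"] N[of n' "n - n'"] commute[of "\<sigma> n" "\<sigma> n'"] by (cases "n \<le> n'") auto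
    qed
  qed
  then obtain x where x: "limitin mtopology \<sigma> x sequentially"
    using assms(1) unfolding mcomplete_def by blast
  then have xM: "x \<in> M" using limitin_mspace by blast
  have "d (\<sigma> n) x \<le> 2 * C * (1/2) ^ n" for n
  proof (rule field_le_epsilon)
    fix e :: real assume "e > 0"
    then obtain N where "\<And>k. k \<ge> N \<Longrightarrow> d (\<sigma> k) x < e"
      using x unfolding limitin_metric eventually_sequentially by blast
    then have "d (\<sigma> (n + N)) x < e" by simp
    moreover have "d (\<sigma> n) x \<le> d (\<sigma> n) (\<sigma> (n + N)) + d (\<sigma> (n + N)) x"
      using triangle assms(2) xM by simp
    ultimately show "d (\<sigma> n) x \<le> 2 * C * (1/2) ^ n + e" using tail'[of n N] by linarith
  qed
  then show ?thesis using that xM by blast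
qed

text \<open>The two homomorphisms induce the same distance function on \<open>W\<close>. It may be a
  pseudometric, so the correspondence between the images is read off from distances rather than from
  elements of \<open>W\<close>.\<close>

locale dense_isometry =
  HH: bi_metric_group HH dH + GG: bi_metric_group GG dG + W: group W
  for HH :: "('a, 'x) monoid_scheme" and dH and GG :: "('b, 'y) monoid_scheme" and dG
    and W :: "('w, 'v) monoid_scheme" +
  fixes P Q
  assumes P: "P \<in> hom W HH" and Q: "Q \<in> hom W GG"
    and isometric: "\<And>u v. u \<in> carrier W \<Longrightarrow> v \<in> carrier W \<Longrightarrow> dH (P u) (P v) = dG (Q u) (Q v)"
    and P_dense: "\<And>x e. x \<in> carrier HH \<Longrightarrow> 0 < e \<Longrightarrow> \<exists>w\<in>carrier W. dH x (P w) < e"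
    and Q_dense: "\<And>y e. y \<in> carrier GG \<Longrightarrow> 0 < e \<Longrightarrow> \<exists>w\<in>carrier W. dG y (Q w) < e"
begin

sublocale P: group_hom W HH P
  using P by (simp add: group_hom_def group_hom_axioms_def W.is_group HH.is_group)
sublocale Q: group_hom W GG Q
  using Q by (simp add: group_hom_def group_hom_axioms_def W.is_group GG.is_group)

text \<open>The closure of the pairs (\<open>P w\<close>, \<open>Q w\<close>) in the product. It is
  symmetric in the two groups, and with completeness it becomes the graph of an isomorphism.\<close>

definition related :: "'a \<Rightarrow> 'b \<Rightarrow> bool" where
  "related x y \<longleftrightarrow> x \<in> carrier HH \<and> y \<in> carrier GG \<and>
     (\<forall>e>0. \<exists>w\<in>carrier W. dH x (P w) < e \<and> dG y (Q w) < e)"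

lemma related_dist:
  assumes "related x y" "related x' y'"
  shows "dH x x' = dG y y'"
proof -
  have car: "x \<in> carrier HH" "y \<in> carrier GG" "x' \<in> carrier HH" "y' \<in> carrier GG"
    using assms by (auto simp: related_def)
  have "\<bar>dH x x' - dG y y'\<bar> \<le> 0 + e" if "e > 0" for e
  proof -
    have "e / 4 > 0" using that by simp
    then obtain w where w: "w \<in> carrier W" "dH x (P w) < e / 4" "dG y (Q w) < e / 4"
      using assms(1) unfolding related_def by blast
    obtain w' where w': "w' \<in> carrier W" "dH x' (P w') < e / 4" "dG y' (Q w') < e / 4"
      using assms(2) \<open>e / 4 > 0\<close> unfolding related_def by blast
    have c: "P w \<in> carrier HH" "P w' \<in> carrier HH" "Q w \<in> carrier GG" "Q w' \<in> carrier GG"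
      using w w' by auto
    have "dH x x' \<le> dH x (P w) + dH (P w) (P w') + dH x' (P w')"
      using HH.triangle[of x "P w" x'] HH.triangle[of "P w" "P w'" x'] HH.commute[of x' "P w'"] car c by simp
    moreover have "dH (P w) (P w') \<le> dH x (P w) + dH x x' + dH x' (P w')"
      using HH.triangle[of "P w" x "P w'"] HH.triangle[of x x' "P w'"] HH.commute[of x "P w"] car c by simp
    moreover have "dG y y' \<le> dG y (Q w) + dG (Q w) (Q w') + dG y' (Q w')"
      using GG.triangle[of y "Q w" y'] GG.triangle[of "Q w" "Q w'" y'] GG.commute[of y' "Q w'"] car c by simp
    moreover have "dG (Q w) (Q w') \<le> dG y (Q w) + dG y y' + dG y' (Q w')"
      using GG.triangle[of "Q w" y "Q w'"] GG.triangle[of y y' "Q w'"] GG.commute[of y "Q w"] car c by simp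
    moreover have "dH (P w) (P w') = dG (Q w) (Q w')" using w w' isometric by simp
    ultimately show ?thesis using w w' by linarith
  qed
  then have "\<bar>dH x x' - dG y y'\<bar> \<le> 0" by (rule field_le_epsilon)
  then show ?thesis by simp
qed

lemma related_mult:
  assumes "related x y" "related x' y'"
  shows "related (x \<otimes>\<^bsub>HH\<^esub> x') (y \<otimes>\<^bsub>GG\<^esub> y')"
proof -
  have car: "x \<in> carrier HH" "y \<in> carrier GG" "x' \<in> carrier HH" "y' \<in> carrier GG"
    using assms by (auto simp: related_def)
  have "\<exists>w\<in>carrier W. dH (x \<otimes>\<^bsub>HH\<^esub> x') (P w) < e \<and> dG (y \<otimes>\<^bsub>GG\<^esub> y') (Q w) < e" if "e > 0" for e
  proof -
    have "e / 2 > 0" using that by simp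
    then obtain w where w: "w \<in> carrier W" "dH x (P w) < e / 2" "dG y (Q w) < e / 2"
      using assms(1) unfolding related_def by blast
    obtain w' where w': "w' \<in> carrier W" "dH x' (P w') < e / 2" "dG y' (Q w') < e / 2"
      using assms(2) \<open>e / 2 > 0\<close> unfolding related_def by blast
    have "dH (x \<otimes>\<^bsub>HH\<^esub> x') (P w \<otimes>\<^bsub>HH\<^esub> P w') \<le> dH x (P w) + dH x' (P w')"
      using car w w' by (intro HH.d_mult_le) auto
    moreover have "dG (y \<otimes>\<^bsub>GG\<^esub> y') (Q w \<otimes>\<^bsub>GG\<^esub> Q w') \<le> dG y (Q w) + dG y' (Q w')"
      using car w w' by (intro GG.d_mult_le) auto
    ultimately show ?thesis
      using w w' by (intro bexI[of _ "w \<otimes>\<^bsub>W\<^esub> w'"]) auto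
  qed
  then show ?thesis using car by (simp add: related_def)
qed

lemma related_total:
  assumes "Metric_space.mcomplete (carrier GG) dG" and x: "x \<in> carrier HH"
  shows "\<exists>y. related x y"
proof -
  have "\<forall>n. \<exists>w\<in>carrier W. dH x (P w) < (1/2) ^ n" using P_dense x by simp
  then obtain w where w: "\<And>n. w n \<in> carrier W" "\<And>n. dH x (P (w n)) < (1/2) ^ n" by metis
  \<comment> \<open>Consecutive approximants lie within the sum of their errors, so the limit has
    rate 4 times a power of 1/2; this accounts for the e / 4 below.\<close>
  have "dG (Q (w n)) (Q (w (Suc n))) \<le> 2 * (1/2) ^ n" for n
  proof -
    have "dG (Q (w n)) (Q (w (Suc n))) = dH (P (w n)) (P (w (Suc n)))" using w isometric by simp
    also have "\<dots> \<le> dH x (P (w n)) + dH x (P (w (Suc n)))"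
      using HH.triangle[of "P (w n)" x "P (w (Suc n))"] HH.commute[of x "P (w n)"] x w(1) by simp
    also have "\<dots> \<le> (1/2) ^ n + (1/2) ^ Suc n" using w(2) by (intro add_mono less_imp_le)
    also have "\<dots> \<le> 2 * (1/2) ^ n" by simp
    finally show ?thesis .
  qed
  then obtain y where y: "y \<in> carrier GG" "\<And>n. dG (Q (w n)) y \<le> 2 * 2 * (1/2) ^ n"
    using GG.geometric_limit[OF assms(1), of "\<lambda>n. Q (w n)" 2] w(1) by auto
  have "\<exists>w\<in>carrier W. dH x (P w) < e \<and> dG y (Q w) < e" if e: "e > 0" for e
  proof -
    obtain n where n: "(1/2) ^ n < e / 4" using real_arch_pow_inv[of "e / 4" "1/2"] e by auto
    then have "dH x (P (w n)) < e" using w(2)[of n] e by linarith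
    moreover have "dG y (Q (w n)) < e" using y(2)[of n] GG.commute[of y "Q (w n)"] n by linarith
    ultimately show ?thesis using w(1) by blast
  qed
  then show ?thesis using x y(1) by (auto simp: related_def)
qed

end

theorem (in dense_isometry) isometrically_isomorphic_completions:
  assumes cH: "Metric_space.mcomplete (carrier HH) dH" and cG: "Metric_space.mcomplete (carrier GG) dG"
  shows "isometrically_isomorphic HH dH GG dG"
proof -
  \<comment> \<open>With the roles exchanged the relation is the same, so totality from the other
    side is surjectivity.\<close>
  interpret sym: dense_isometry GG dG HH dH W Q P
    using P Q isometric P_dense Q_dense by unfold_locales auto
  have sym: "sym.related y x \<longleftrightarrow> related x y" for x y
    unfolding sym.related_def related_def by metis
  have "\<forall>x\<in>carrier HH. \<exists>y. related x y" using related_total[OF cG] by blast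
  then obtain f where f: "\<And>x. x \<in> carrier HH \<Longrightarrow> related x (f x)" by metis
  have f_car: "f x \<in> carrier GG" if "x \<in> carrier HH" for x
    using f[OF that] by (simp add: related_def)
  have unique: "y = y'" if "related x y" "related x y'" for x y y'
    using related_dist[OF that] that by (auto simp: related_def)
  have dist: "dG (f x) (f x') = dH x x'" if "x \<in> carrier HH" "x' \<in> carrier HH" for x x'
    using related_dist[OF f f] that by simp
  have "f \<in> hom HH GG"
    using f_car unique[OF f related_mult[OF f f]] by (intro homI) auto
  moreover have "inj_on f (carrier HH)"
  proof (rule inj_onI)
    fix x y assume "x \<in> carrier HH" "y \<in> carrier HH" "f x = f y"
    then show "x = y" using dist[of x y] f_car[of x] by simp
  qed
  moreover have "carrier GG \<subseteq> f ` carrier HH"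
  proof
    fix y assume "y \<in> carrier GG"
    then obtain x where x: "related x y" using sym.related_total[OF cH] sym by blast
    then have "x \<in> carrier HH" by (simp add: related_def)
    then show "y \<in> f ` carrier HH" using unique[OF x f] by blast
  qed
  ultimately have "f \<in> iso HH GG"
    using f_car by (auto simp: iso_def bij_betw_def)
  then show ?thesis
    using dist unfolding isometrically_isomorphic_def isometric_on_def by blast
qed

section \<open>Perturbing tuples into free ones\<close>

lemma reduced_word_append:
  "reduced_word (u @ v) \<longleftrightarrow>
     reduced_word u \<and> reduced_word v \<and> (u = [] \<or> v = [] \<or> hd v \<noteq> letter_inv (last u))"
  by (auto simp: reduced_word_def successively_append_iff)

lemma foldr_prepend_append:
  "reduced_word (u @ v) \<Longrightarrow> foldr prepend u v = u @ v"
  by (induction u) (auto simp: reduced_word_Cons prepend_def)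

text \<open>The letters in \<open>x ` I\<close> are fresh: they survive in every product of the elements
  \<open>b\<^sub>i x\<^sub>i\<^sup>-\<^sup>1 u x\<^sub>i\<close> and their inverses, since between two of them either a
  nontrivial word in the old letters remains, or their indices differ.\<close>

locale fresh_conjugates =
  fixes A :: "'a set" and I :: "'i set" and x :: "'i \<Rightarrow> 'a" and b :: "'i \<Rightarrow> 'a word" and u :: "'a word"
  assumes fresh: "\<And>i. i \<in> I \<Longrightarrow> x i \<notin> A" and inj: "inj_on x I"
    and b: "\<And>i. i \<in> I \<Longrightarrow> b i \<in> carrier (free_group A)" "\<And>i. i \<in> I \<Longrightarrow> b i \<noteq> []"
    and u: "u \<in> carrier (free_group A)" "u \<noteq> []"
begin

definition conjugate :: "'i \<Rightarrow> 'a word \<Rightarrow> 'a word" where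
  "conjugate i w = (x i, False) # w @ [(x i, True)]"

definition element :: "'i \<Rightarrow> 'a word" where
  "element i = b i @ conjugate i u"

sublocale U: group "free_group (UNIV :: 'a set)" by (rule group_free_group)
sublocale A: group "free_group A" by (rule group_free_group)

lemma old_word: "w \<in> carrier (free_group A) \<Longrightarrow> w \<noteq> [] \<Longrightarrow> fst (hd w) \<in> A \<and> fst (last w) \<in> A"
  by (auto simp: carrier_free_group)

lemma append_conjugate_reduced:
  assumes i: "i \<in> I" and w: "w \<in> carrier (free_group A)" "w \<noteq> []"
    and v: "reduced_word v" "v = [] \<or> hd v \<noteq> (x i, False)"
  shows "reduced_word (conjugate i w @ v)"
proof -
  have "fst (hd w) \<noteq> x i" "fst (last w) \<noteq> x i" using old_word[OF w] fresh[OF i] by auto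
  then show ?thesis
    using w v by (auto simp: conjugate_def reduced_word_Cons reduced_word_append carrier_free_group
        letter_inv_def hd_append)
qed

lemma element_reduced: "i \<in> I \<Longrightarrow> reduced_word (element i)"
  using append_conjugate_reduced[OF _ u, of i "[]"] b[of i] old_word[of "b i"] fresh[of i]
  by (auto simp: element_def conjugate_def reduced_word_append carrier_free_group letter_inv_def)

lemma element_closed: "i \<in> I \<Longrightarrow> element i \<in> carrier (free_group UNIV)"
  using element_reduced by (simp add: carrier_free_group)

definition reverse :: "'a word \<Rightarrow> 'a word" where
  "reverse w = rev (map letter_inv w)"

lemma reverse_old:
  "w \<in> carrier (free_group A) \<Longrightarrow> w \<noteq> [] \<Longrightarrow> reverse w \<in> carrier (free_group A) \<and> reverse w \<noteq> []"
  using A.inv_closed[of w] by (simp add: reverse_def inv_free_group)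

lemma inv_element:
  assumes "i \<in> I"
  shows "inv\<^bsub>free_group UNIV\<^esub> element i = conjugate i (reverse u) @ reverse (b i)"
  using element_closed[OF assms]
  by (simp add: inv_free_group element_def conjugate_def reverse_def letter_inv_def)

text \<open>The induction needs to know how a value begins: an inverse fresh letter, preceded either
  by all of \<open>b i\<close> or by nothing. This shows that the value is nontrivial and also
  decides whether the next factor on the left can cancel into it.\<close>

lemma word_eval_shape:
  assumes "w \<in> carrier (free_group I)" "w \<noteq> []"
  shows "\<exists>rest. word_eval (free_group UNIV) element w =
    (if snd (hd w) then b (fst (hd w)) else []) @ (x (fst (hd w)), False) # rest"
  using assms
proof (induction w)
  case Nil
  then show ?case by simp
next
  case (Cons l w)
  obtain i e where l: "l = (i, e)" by (cases l)
  have i: "i \<in> I" and w: "w \<in> carrier (free_group I)" and hd_w: "w \<noteq> [] \<Longrightarrow> hd w \<noteq> (i, \<not> e)"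
    using Cons.prems l by (auto simp: carrier_free_group reduced_word_Cons letter_inv_def)
  let ?W = "word_eval (free_group UNIV) element w"
  have W: "reduced_word ?W"
  proof -
    have "?W \<in> carrier (free_group UNIV)"
      using w element_closed by (intro U.word_eval_closed) (auto simp: carrier_free_group)
    then show ?thesis by (simp add: carrier_free_group)
  qed
  let ?k = "fst (hd w)"
  have kI: "?k \<in> I" if "w \<noteq> []" using w that by (auto simp: carrier_free_group)
  have IH: "\<exists>rest. ?W = (if snd (hd w) then b ?k else []) @ (x ?k, False) # rest" if "w \<noteq> []"
    using Cons.IH[OF w that] .
  have xk: "x ?k \<noteq> x i" if "w \<noteq> []" "?k \<noteq> i"
    using inj i kI that by (auto simp: inj_on_def)
  show ?case
  proof (cases e)
    case True
    \<comment> \<open>The new factor ends in the fresh letter \<open>x i\<close>. It could cancel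
      only against an inverse factor of the same index, which is excluded since \<open>l # w\<close>
      is reduced.\<close>
    have "?W = [] \<or> hd ?W \<noteq> (x i, False)"
    proof (cases "w = []")
      case False
      obtain rest where rest: "?W = (if snd (hd w) then b ?k else []) @ (x ?k, False) # rest"
        using IH[OF False] by blast
      show ?thesis
      proof (cases "snd (hd w)")
        case True
        then show ?thesis
          using rest old_word[OF b[OF kI[OF False]]] b(2)[OF kI[OF False]] fresh[OF i] by auto
      next
        case snd: False
        then have "?k \<noteq> i" using hd_w[OF False] \<open>e\<close> by (cases "hd w") auto
        then show ?thesis using rest snd xk[OF False] by auto
      qed
    qed simp
    then have 1: "reduced_word (conjugate i u @ ?W)"
      using append_conjugate_reduced[OF i u W] by simp
    have "b i \<noteq> []" "fst (last (b i)) \<in> A" using b[OF i] old_word by auto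
    then have "reduced_word (b i @ conjugate i u @ ?W)"
      using 1 b[OF i] fresh[OF i]
      by (subst reduced_word_append) (auto simp: conjugate_def carrier_free_group letter_inv_def)
    then have "foldr prepend (element i) ?W = b i @ conjugate i u @ ?W"
      using foldr_prepend_append[of "element i" ?W] by (simp add: element_def)
    then show ?thesis
      using l True by (simp add: U.word_eval_Cons conjugate_def)
  next
    case False
    let ?u = "reverse u" and ?b = "reverse (b i)"
    have uA: "?u \<in> carrier (free_group A)" "?u \<noteq> []" using reverse_old[OF u] by auto
    have bA: "?b \<in> carrier (free_group A)" "?b \<noteq> []" using reverse_old[OF b[OF i]] by auto
    let ?V = "foldr prepend ?b ?W"
    have V: "reduced_word ?V" using W by (rule reduced_foldr_prepend)
    have "?V = [] \<or> hd ?V \<noteq> (x i, False)"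
    proof (cases "w = []")
      case True
      then have "?V = ?b" using bA by (simp add: foldr_prepend_Nil carrier_free_group)
      then show ?thesis using old_word[OF bA] fresh[OF i] by auto
    next
      case ne: False
      obtain rest where rest: "?W = (if snd (hd w) then b ?k else []) @ (x ?k, False) # rest"
        using IH[OF ne] by blast
      let ?X = "(x ?k, False) # rest"
      have X: "reduced_word ?X" using W rest by (auto simp: reduced_word_append split: if_splits)
      have app: "foldr prepend c ?X = c @ ?X" if "c \<in> carrier (free_group A)" for c
      proof -
        have "reduced_word (c @ ?X)"
          using that X old_word[OF that] fresh[OF kI[OF ne]]
          by (cases "c = []") (auto simp: reduced_word_append carrier_free_group letter_inv_def)
        then show ?thesis by (rule foldr_prepend_append)
      qed
      show ?thesis
      proof (cases "snd (hd w)")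
        case True
        \<comment> \<open>The indices differ, but \<open>b i\<close> and \<open>b ?k\<close> may
          coincide, so \<open>?c\<close> can be trivial; then distinct fresh letters meet and do not
          cancel.\<close>
        let ?c = "foldr prepend ?b (b ?k)"
        have "?k \<noteq> i" using hd_w[OF ne] True \<open>\<not> e\<close> by (cases "hd w") auto
        have c: "?c \<in> carrier (free_group A)"
          using A.m_closed[OF bA(1) b(1)[OF kI[OF ne]]] by simp
        have "?W = foldr prepend (b ?k) ?X"
          using rest True app[OF b(1)[OF kI[OF ne]]] by simp
        then have "?V = foldr prepend ?c ?X"
          using foldr_prepend_assoc[OF X, of ?b "b ?k"] by simp
        then have "?V = ?c @ ?X" using app[OF c] by simp
        then show ?thesis
          using old_word[OF c] fresh[OF i] xk[OF ne \<open>?k \<noteq> i\<close>] by (cases "?c = []") auto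
      next
        case False
        \<comment> \<open>Two inverse factors, possibly of the same index: here nontriviality of
          \<open>b i\<close> separates the fresh letters.\<close>
        then have "?V = ?b @ ?X" using rest app[OF bA(1)] by simp
        then show ?thesis using old_word[OF bA] bA fresh[OF i] by auto
      qed
    qed
    then have "reduced_word (conjugate i ?u @ ?V)"
      using append_conjugate_reduced[OF i uA V] by simp
    then have "foldr prepend (conjugate i ?u) ?V = conjugate i ?u @ ?V"
      by (rule foldr_prepend_append)
    then have "word_eval (free_group UNIV) element (l # w) = conjugate i ?u @ ?V"
      using l False inv_element[OF i] by (simp add: U.word_eval_Cons)
    then show ?thesis using l False by (simp add: conjugate_def)
  qed
qed

theorem word_eval_element_mon: "word_eval (free_group UNIV) element \<in> mon (free_group I) (free_group UNIV)"
proof -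
  have hom: "word_eval (free_group UNIV) element \<in> hom (free_group I) (free_group UNIV)"
    using element_closed by (intro U.word_eval_hom) auto
  then interpret h: group_hom "free_group I" "free_group UNIV" "word_eval (free_group UNIV) element"
    by (simp add: group_hom_def group_hom_axioms_def group_free_group)
  have "w = []" if w: "w \<in> carrier (free_group I)" "word_eval (free_group UNIV) element w = []" for w
  proof (rule ccontr)
    assume "w \<noteq> []"
    from word_eval_shape[OF w(1) this] w(2) show False by auto
  qed
  then have "inj_on (word_eval (free_group UNIV) element) (carrier (free_group I))"
    by (subst h.inj_on_one_iff) auto
  then show ?thesis using hom by (simp add: mon_def)
qed

end

section \<open>Back and forth\<close>

locale generic_group = bi_metric_group HH dH
  for HH :: "('c, 'z) monoid_scheme" (structure) and dH +
  fixes H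
  assumes generic: "generic_subgroup HH dH H"
    and complete: "mcomplete"
    and le_1: "\<And>x y. x \<in> carrier HH \<Longrightarrow> y \<in> carrier HH \<Longrightarrow> dH x y \<le> 1"
begin

lemma H_subgroup: "subgroup H HH"
  and H_free: "HH\<lparr>carrier := H\<rparr> \<cong> free_group (UNIV :: nat set)"
  and H_dense_in: "dense_in HH dH H" and H_extension: "extension_property HH dH H"
  using generic by (auto simp: generic_subgroup_def)

lemma H_carrier: "H \<subseteq> carrier HH"
  by (rule subgroup.subset[OF H_subgroup])

lemma H_dense:
  assumes "x \<in> carrier HH" "0 < e"
  obtains y where "y \<in> H" "dH x y < e"
  using H_dense_in assms unfolding dense_in_def dense_iff by blast

lemma monH: "\<kappa> \<in> mon (F n) (HH\<lparr>carrier := H\<rparr>) \<longleftrightarrow> \<kappa> \<in> mon (F n) HH \<and> \<kappa> ` carrier (F n) \<subseteq> H"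
  by (rule hom_subgroup_iff[OF H_carrier])

lemma hom_F_one: "\<kappa> \<in> hom (F n) HH \<Longrightarrow> \<kappa> [] = \<one>"
  using hom_one[of \<kappa> "F n" HH] group_F is_group by simp

text \<open>A rescaled discrete metric on \<open>F 1\<close> is approximately realised by extending
  the trivial monomorphism of \<open>F 0\<close>; the image of the generator is nontrivial by
  injectivity.\<close>

lemma small_element:
  assumes "0 < \<delta>"
  obtains u where "u \<in> H" "u \<noteq> \<one>" "dH u \<one> < \<delta>"
proof -
  \<comment> \<open>The norm of the image is off from \<open>c\<close> by less than
    \<open>c\<close>, hence below 2c and so below \<delta>. Being below 1 makes \<open>c\<close> a
    legal \<epsilon>' for \<epsilon> = 1.\<close>
  define c where "c = min (\<delta> / 2) (1 / 2)"
  have c: "0 < c" "c \<le> \<delta> / 2" "c < 1" using assms by (auto simp: c_def)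
  define \<rho> :: "nat word \<Rightarrow> nat word \<Rightarrow> real" where "\<rho> a b = (if a = b then 0 else c)" for a b
  interpret F: group "F k" for k by (rule group_F)
  have "Metric_space (carrier (F 1)) \<rho>"
    using c by unfold_locales (auto simp: \<rho>_def)
  moreover have "\<rho> (x \<otimes>\<^bsub>F 1\<^esub> a \<otimes>\<^bsub>F 1\<^esub> y) (x \<otimes>\<^bsub>F 1\<^esub> b \<otimes>\<^bsub>F 1\<^esub> y) = \<rho> a b"
    if "x \<in> carrier (F 1)" "y \<in> carrier (F 1)" "a \<in> carrier (F 1)" "b \<in> carrier (F 1)" for x y a b
    using that by (auto simp: \<rho>_def)
  ultimately have \<rho>: "bi_invariant_metric (F 1) \<rho>" "bounded_by_1 (F 1) \<rho>"
    using c by (auto simp: bi_invariant_metric_def bounded_by_1_def \<rho>_def)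
  have F0: "carrier (F 0) = {[]}" by (auto simp: F_def carrier_free_group)
  have \<iota>: "(\<lambda>_. \<one>) \<in> mon (F 0) HH" by (auto simp: mon_def hom_def F0)
  have dist: "metric_dist 0 \<rho> (pullback (\<lambda>_. \<one>) dH) < 1"
    by (rule metric_dist_less[of "1/2"]) (auto simp: F0 \<rho>_def pullback_def)
  have c01: "c < 1" "0 < c" "(0::nat) < 1" using c by auto
  obtain \<kappa> where \<kappa>: "\<kappa> \<in> mon (F 1) (HH\<lparr>carrier := H\<rparr>)" "metric_dist 1 \<rho> (pullback \<kappa> dH) < c"
    by (rule extension_propertyE[OF H_extension c01 \<rho> \<iota> dist]) blast
  have \<kappa>_mon: "\<kappa> \<in> mon (F 1) HH" and \<kappa>_H: "\<kappa> ` carrier (F 1) \<subseteq> H" using \<kappa>(1) monH by auto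
  have \<kappa>_car: "\<kappa> g \<in> carrier HH" if "g \<in> carrier (F 1)" for g
    using \<kappa>_H H_carrier that by auto
  have \<kappa>_one: "\<kappa> [] = \<one>" using \<kappa>_mon hom_F_one by (auto simp: mon_def)
  obtain e where e: "0 < e" "e < c" "\<And>g. g \<in> carrier (F 1) \<Longrightarrow> \<bar>\<rho> g [] - pullback \<kappa> dH g []\<bar> \<le> e * real (length g)"
  proof (rule metric_dist_lessD[OF \<kappa>(2)])
    show "0 \<le> \<rho> g [] \<and> \<rho> g [] \<le> 1" for g using c by (auto simp: \<rho>_def)
    show "0 \<le> pullback \<kappa> dH g [] \<and> pullback \<kappa> dH g [] \<le> 1" if "g \<in> carrier (F 1)" for g
      using that le_1 \<kappa>_car by (simp add: pullback_def)
    show "\<rho> [] [] = pullback \<kappa> dH [] []" using \<kappa>_one by (simp add: \<rho>_def pullback_def)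
  qed blast
  have g: "gen 1 \<in> carrier (F 1)" by simp
  have "\<bar>\<rho> (gen 1) [] - dH (\<kappa> (gen 1)) \<one>\<bar> \<le> e"
    using e(3)[OF g] \<kappa>_one by (simp add: pullback_def gen_def)
  moreover have "\<rho> (gen 1) [] = c" by (simp add: \<rho>_def gen_def)
  ultimately have "dH (\<kappa> (gen 1)) \<one> < \<delta>" using e c by linarith
  moreover have "\<kappa> (gen 1) \<noteq> \<one>"
  proof
    assume "\<kappa> (gen 1) = \<one>"
    then have "gen 1 = ([] :: nat word)"
      using \<kappa>_mon \<kappa>_one g Nil_in_F[of 1] unfolding mon_def inj_on_def by fastforce
    then show False by (simp add: gen_def)
  qed
  ultimately show ?thesis using that \<kappa>_H g by blast
qed

lemma free_tuple_near:
  fixes a :: "nat \<Rightarrow> 'c"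
  assumes a: "\<And>i. i \<in> {1..n} \<Longrightarrow> a i \<in> carrier HH" and \<delta>: "0 < \<delta>"
  obtains \<kappa> where "\<kappa> \<in> mon (F n) (HH\<lparr>carrier := H\<rparr>)" "\<And>i. i \<in> {1..n} \<Longrightarrow> dH (\<kappa> (gen i)) (a i) < \<delta>"
proof -
  let ?H = "HH\<lparr>carrier := H\<rparr>" and ?FU = "free_group (UNIV :: nat set)"
  have gH: "group ?H" using H_subgroup subgroup_imp_group by blast
  have \<delta>4: "0 < \<delta> / 4" "0 < \<delta> / 2" using \<delta> by auto
  obtain u where uH: "u \<in> H" "u \<noteq> \<one>" "dH u \<one> < \<delta> / 4" using small_element[OF \<delta>4(1)] .
  \<comment> \<open>The construction with fresh letters needs nontrivial elements; a trivial
    approximant is replaced by \<open>u\<close>, which costs another quarter of \<delta>.\<close>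
  have "\<exists>b\<in>H. b \<noteq> \<one> \<and> dH (a i) b < \<delta> / 2" if i: "i \<in> {1..n}" for i
  proof -
    obtain b where b: "b \<in> H" "dH (a i) b < \<delta> / 4" using H_dense[OF a[OF i] \<delta>4(1)] .
    show ?thesis
    proof (cases "b = \<one>")
      case True
      have "dH (a i) u \<le> dH (a i) \<one> + dH \<one> u"
        using a[OF i] uH(1) H_carrier by (intro triangle) auto
      then have "dH (a i) u < \<delta> / 2" using b True uH(3) commute[of \<one> u] by simp
      then show ?thesis using uH by blast
    next
      case False
      then show ?thesis using b \<delta> by (intro bexI[of _ b]) auto
    qed
  qed
  then obtain b where bH: "\<And>i. i \<in> {1..n} \<Longrightarrow> b i \<in> H \<and> b i \<noteq> \<one> \<and> dH (a i) (b i) < \<delta> / 2" by metis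
  obtain \<theta> where \<theta>: "\<theta> \<in> iso ?FU ?H"
    using H_free group.iso_sym[OF gH] by (auto simp: is_iso_def)
  have \<theta>_hom: "\<theta> \<in> hom ?FU HH" and \<theta>_bij: "bij_betw \<theta> (carrier ?FU) H"
    using \<theta> H_carrier by (auto simp: iso_def hom_def)
  interpret \<theta>: group_hom ?FU HH \<theta>
    using \<theta>_hom by (simp add: group_hom_def group_hom_axioms_def group_free_group is_group)
  define \<theta>' where "\<theta>' = inv_into (carrier ?FU) \<theta>"
  have \<theta>': "\<theta>' y \<in> carrier ?FU" "\<theta> (\<theta>' y) = y" if "y \<in> H" for y
    using \<theta>_bij that by (auto simp: \<theta>'_def bij_betw_def inv_into_into f_inv_into_f)
  have \<theta>'_ne: "\<theta>' y \<noteq> []" if "y \<in> H" "y \<noteq> \<one>" for y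
    using \<theta>'(2)[OF that(1)] that(2) \<theta>.hom_one by auto
  define A where "A = fst ` (\<Union>i\<in>{1..n}. set (\<theta>' (b i))) \<union> fst ` set (\<theta>' u)"
  have "finite A" by (simp add: A_def)
  \<comment> \<open>These letters exceed all letters occurring in the preimages of \<open>u\<close>
    and of the \<open>b i\<close>.\<close>
  define x where "x i = i + Suc (Max (insert 0 A))" for i
  interpret fresh_conjugates A "{1..n}" x "\<lambda>i. \<theta>' (b i)" "\<theta>' u"
  proof
    show "x i \<notin> A" for i
    proof
      assume "x i \<in> A"
      then have "x i \<le> Max (insert 0 A)" using \<open>finite A\<close> by (intro Max_ge) auto
      moreover have "Max (insert 0 A) < x i" unfolding x_def by linarith
      ultimately show False by linarith
    qed
    show "inj_on x {1..n}" by (auto simp: x_def inj_on_def)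
    show "\<theta>' (b i) \<in> carrier (free_group A)" "\<theta>' (b i) \<noteq> []" if "i \<in> {1..n}" for i
    proof -
      have "fst ` set (\<theta>' (b i)) \<subseteq> A" using that unfolding A_def by blast
      then show "\<theta>' (b i) \<in> carrier (free_group A)" "\<theta>' (b i) \<noteq> []"
        using \<theta>'(1)[of "b i"] \<theta>'_ne[of "b i"] bH[OF that] by (auto simp: carrier_free_group)
    qed
    show "\<theta>' u \<in> carrier (free_group A)" "\<theta>' u \<noteq> []"
      using \<theta>'(1)[of u] \<theta>'_ne[of u] uH by (auto simp: carrier_free_group A_def)
  qed
  let ?e = "word_eval ?FU element"
  have e_mon: "?e \<in> mon (F n) ?FU" using word_eval_element_mon by (simp add: F_def)
  have e_car: "?e g \<in> carrier ?FU" if "g \<in> carrier (F n)" for g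
    using e_mon that by (auto simp: mon_def hom_def)
  have "\<theta> \<circ> ?e \<in> hom (F n) HH"
    using e_mon \<theta>_hom by (auto simp: mon_def intro: Group.hom_compose)
  moreover have "inj_on (\<theta> \<circ> ?e) (carrier (F n))"
    using e_mon \<theta>_bij e_car by (auto simp: mon_def bij_betw_def inj_on_def)
  moreover have "(\<theta> \<circ> ?e) ` carrier (F n) \<subseteq> H"
    using e_car \<theta>_bij by (auto simp: bij_betw_def)
  ultimately have "\<theta> \<circ> ?e \<in> mon (F n) HH \<and> (\<theta> \<circ> ?e) ` carrier (F n) \<subseteq> H" by (simp add: mon_def)
  then have "\<theta> \<circ> ?e \<in> mon (F n) ?H" by (simp only: monH)
  moreover have "dH ((\<theta> \<circ> ?e) (gen i)) (a i) < \<delta>" if i: "i \<in> {1..n}" for i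
  proof -
    let ?z = "gen (x i)"
    have bi: "b i \<in> H" "b i \<in> carrier HH" using bH[OF i] H_carrier by auto
    have uu: "u \<in> carrier HH" using uH H_carrier by auto
    have zc: "?z \<in> carrier ?FU" by simp
    have "element i = \<theta>' (b i) \<otimes>\<^bsub>?FU\<^esub> (inv\<^bsub>?FU\<^esub> ?z \<otimes>\<^bsub>?FU\<^esub> (\<theta>' u \<otimes>\<^bsub>?FU\<^esub> ?z))"
    proof -
      have red: "reduced_word (\<theta>' (b i) @ ([(x i, False)] @ (\<theta>' u @ [(x i, True)])))"
        using element_reduced[OF i] by (simp add: element_def conjugate_def)
      then have "reduced_word ([(x i, False)] @ (\<theta>' u @ [(x i, True)]))" "reduced_word (\<theta>' u @ [(x i, True)])"
        unfolding reduced_word_append[of "\<theta>' (b i)"] reduced_word_append[of "[(x i, False)]"] by blast+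
      then show ?thesis
        using foldr_prepend_append[OF red] foldr_prepend_append[of "[(x i, False)]"]
          foldr_prepend_append[of "\<theta>' u" "[(x i, True)]"] inv_free_group_gen[of "x i" UNIV]
        by (simp add: element_def conjugate_def gen_def del: foldr.simps)
    qed
    then have "\<theta> (element i) = b i \<otimes> (inv \<theta> ?z \<otimes> (u \<otimes> \<theta> ?z))"
      using \<theta>'[OF bi(1)] \<theta>'[OF uH(1)] zc by (simp del: mult_free_group)
    moreover have "?e (gen i) = element i"
      using element_closed[OF i] by (intro group.word_eval_gen[OF group_free_group])
    ultimately have \<kappa>: "(\<theta> \<circ> ?e) (gen i) = b i \<otimes> (inv \<theta> ?z \<otimes> (u \<otimes> \<theta> ?z))" by simp
    have z: "\<theta> ?z \<in> carrier HH" using zc by (rule \<theta>.hom_closed)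
    \<comment> \<open>Conjugating \<open>u\<close> by a fresh generator, however far that generator
      is from the unit, leaves its norm unchanged.\<close>
    have "dH (b i \<otimes> (inv \<theta> ?z \<otimes> (u \<otimes> \<theta> ?z))) (b i \<otimes> (inv \<theta> ?z \<otimes> (\<one> \<otimes> \<theta> ?z))) = dH u \<one>"
      using bi uu z by (simp only: d_mult_left d_mult_right m_closed inv_closed one_closed)
    moreover have "b i \<otimes> (inv \<theta> ?z \<otimes> (\<one> \<otimes> \<theta> ?z)) = b i" using bi z by simp
    ultimately have "dH ((\<theta> \<circ> ?e) (gen i)) (b i) < \<delta> / 4" using \<kappa> uH(3) by simp
    moreover have "dH (b i) (a i) < \<delta> / 2" using bH[OF i] commute[of "a i" "b i"] by simp
    moreover have "dH ((\<theta> \<circ> ?e) (gen i)) (a i) \<le> dH ((\<theta> \<circ> ?e) (gen i)) (b i) + dH (b i) (a i)"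
      using \<kappa> bi uu z a[OF i] by (intro triangle) auto
    ultimately show ?thesis using \<delta> by linarith
  qed
  ultimately show ?thesis using that by blast
qed

lemma H_enumeration: "\<exists>hs :: nat \<Rightarrow> 'c. range hs = H"
proof -
  let ?FU = "free_group (UNIV :: nat set)"
  have gH: "group (HH\<lparr>carrier := H\<rparr>)" using H_subgroup subgroup_imp_group by blast
  obtain \<theta> where "\<theta> \<in> iso ?FU (HH\<lparr>carrier := H\<rparr>)"
    using H_free group.iso_sym[OF gH] by (auto simp: is_iso_def)
  then have "H = \<theta> ` carrier ?FU" by (auto simp: iso_def bij_betw_def)
  moreover have "countable (carrier ?FU)" by simp
  ultimately have "countable H" by simp
  moreover have "H \<noteq> {}" using subgroup.one_closed[OF H_subgroup] by auto
  ultimately have "range (from_nat_into H) = H" by (intro range_from_nat_into)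
  then show ?thesis by blast
qed

end

locale back_and_forth = HH: generic_group HH dH H + GG: generic_group GG dG J
  for HH :: "('a, 'x) monoid_scheme" and dH H and GG :: "('b, 'y) monoid_scheme" and dG J
begin

definition matched :: "nat \<Rightarrow> (nat word \<Rightarrow> 'a) \<Rightarrow> (nat word \<Rightarrow> 'b) \<Rightarrow> real \<Rightarrow> bool" where
  "matched k \<alpha> \<beta> e \<longleftrightarrow> \<alpha> \<in> mon (F k) (HH\<lparr>carrier := H\<rparr>) \<and> \<beta> \<in> mon (F k) (GG\<lparr>carrier := J\<rparr>) \<and>
     metric_dist k (pullback \<alpha> dH) (pullback \<beta> dG) < e"

lemma matchedD:
  assumes "matched k \<alpha> \<beta> \<epsilon>"
  shows "\<alpha> \<in> mon (F k) HH" "\<alpha> ` carrier (F k) \<subseteq> H" "\<beta> \<in> mon (F k) GG" "\<beta> ` carrier (F k) \<subseteq> J"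
    "\<And>g. g \<in> carrier (F k) \<Longrightarrow> \<alpha> g \<in> carrier HH" "\<And>g. g \<in> carrier (F k) \<Longrightarrow> \<beta> g \<in> carrier GG"
    "\<alpha> [] = \<one>\<^bsub>HH\<^esub>" "\<beta> [] = \<one>\<^bsub>GG\<^esub>"
    "\<And>g. g \<in> carrier (F k) \<Longrightarrow> \<alpha> g = word_eval HH (\<alpha> \<circ> gen) g"
    "\<And>g. g \<in> carrier (F k) \<Longrightarrow> \<beta> g = word_eval GG (\<beta> \<circ> gen) g"
    "\<exists>e. 0 < e \<and> e < \<epsilon> \<and> (\<forall>g\<in>carrier (F k). \<bar>dH (\<alpha> g) \<one>\<^bsub>HH\<^esub> - dG (\<beta> g) \<one>\<^bsub>GG\<^esub>\<bar> \<le> e * real (length g))"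
proof -
  show \<alpha>: "\<alpha> \<in> mon (F k) HH" and \<alpha>H: "\<alpha> ` carrier (F k) \<subseteq> H"
    using assms unfolding matched_def HH.monH by blast+
  show \<beta>: "\<beta> \<in> mon (F k) GG" and \<beta>J: "\<beta> ` carrier (F k) \<subseteq> J"
    using assms unfolding matched_def GG.monH by blast+
  have hom: "\<alpha> \<in> hom (F k) HH" "\<beta> \<in> hom (F k) GG" using \<alpha> \<beta> by (auto simp: mon_def)
  show \<alpha>c: "\<alpha> g \<in> carrier HH" if "g \<in> carrier (F k)" for g using hom that by (auto simp: hom_def)
  show \<beta>c: "\<beta> g \<in> carrier GG" if "g \<in> carrier (F k)" for g using hom that by (auto simp: hom_def)
  show one: "\<alpha> [] = \<one>\<^bsub>HH\<^esub>" "\<beta> [] = \<one>\<^bsub>GG\<^esub>" using hom HH.hom_F_one GG.hom_F_one by auto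
  show "\<alpha> g = word_eval HH (\<alpha> \<circ> gen) g" if "g \<in> carrier (F k)" for g
    using HH.hom_eq_word_eval[OF hom(1)[unfolded F_def]] that by (simp add: F_def comp_def)
  show "\<beta> g = word_eval GG (\<beta> \<circ> gen) g" if "g \<in> carrier (F k)" for g
    using GG.hom_eq_word_eval[OF hom(2)[unfolded F_def]] that by (simp add: F_def comp_def)
  have dist: "metric_dist k (pullback \<alpha> dH) (pullback \<beta> dG) < \<epsilon>" using assms by (simp add: matched_def)
  obtain e where e: "0 < e" "e < \<epsilon>"
    "\<And>g. g \<in> carrier (F k) \<Longrightarrow> \<bar>pullback \<alpha> dH g [] - pullback \<beta> dG g []\<bar> \<le> e * real (length g)"
  proof (rule metric_dist_lessD[OF dist])
    show "0 \<le> pullback \<alpha> dH g [] \<and> pullback \<alpha> dH g [] \<le> 1" if "g \<in> carrier (F k)" for g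
      using \<alpha>c[OF that] HH.le_1[of "\<alpha> g" "\<alpha> []"] \<alpha>c[of "[]"] by (simp add: pullback_def)
    show "0 \<le> pullback \<beta> dG g [] \<and> pullback \<beta> dG g [] \<le> 1" if "g \<in> carrier (F k)" for g
      using \<beta>c[OF that] GG.le_1[of "\<beta> g" "\<beta> []"] \<beta>c[of "[]"] by (simp add: pullback_def)
    show "pullback \<alpha> dH [] [] = pullback \<beta> dG [] []" using one by (simp add: pullback_def)
  qed blast
  then show "\<exists>e. 0 < e \<and> e < \<epsilon> \<and>
      (\<forall>g\<in>carrier (F k). \<bar>dH (\<alpha> g) \<one>\<^bsub>HH\<^esub> - dG (\<beta> g) \<one>\<^bsub>GG\<^esub>\<bar> \<le> e * real (length g))"
    using one by (intro exI[of _ e]) (auto simp: pullback_def)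
qed

text \<open>The tuple of \<alpha> extended by \<open>h\<close> is perturbed into a free tuple. Its
  pulled-back metric on \<open>F (Suc k)\<close> is still close to \<beta> on \<open>F k\<close>, so
  the extension property of \<open>GG\<close> moves \<beta> to a partner of the new tuple with the
  better accuracy \<epsilon>'.\<close>

lemma half_step:
  assumes m: "matched k \<alpha> \<beta> \<epsilon>" and \<epsilon>: "\<epsilon>' < \<epsilon>" "0 < \<epsilon>'" and h: "h \<in> carrier HH"
  shows "\<exists>\<alpha>' \<beta>'. matched (Suc k) \<alpha>' \<beta>' \<epsilon>' \<and>
    (\<forall>i\<in>{1..k}. dH (\<alpha>' (gen i)) (\<alpha> (gen i)) < \<epsilon>) \<and> (\<forall>i\<in>{1..k}. dG (\<beta>' (gen i)) (\<beta> (gen i)) < \<epsilon>) \<and>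
    dH (\<alpha>' (gen (Suc k))) h < \<epsilon>"
proof -
  note m = matchedD[OF m]
  obtain e where e: "0 < e" "e < \<epsilon>"
    "\<And>g. g \<in> carrier (F k) \<Longrightarrow> \<bar>dH (\<alpha> g) \<one>\<^bsub>HH\<^esub> - dG (\<beta> g) \<one>\<^bsub>GG\<^esub>\<bar> \<le> e * real (length g)"
    using m(11) by blast
  \<comment> \<open>A perturbation by \<delta> raises the admissible constant to
    \<open>e + \<delta>\<close>, which must remain below \<epsilon>.\<close>
  define \<delta> where "\<delta> = (\<epsilon> - e) / 2"
  have \<delta>: "0 < \<delta>" "e + \<delta> < \<epsilon>" "\<delta> < \<epsilon>" using e by (auto simp: \<delta>_def field_simps)
  define a where "a i = (if i \<in> {1..k} then \<alpha> (gen i) else h)" for i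
  have a: "a i \<in> carrier HH" for i using h m(5)[of "gen i"] by (simp add: a_def)
  obtain \<alpha>' where \<alpha>': "\<alpha>' \<in> mon (F (Suc k)) (HH\<lparr>carrier := H\<rparr>)"
    "\<And>i. i \<in> {1..Suc k} \<Longrightarrow> dH (\<alpha>' (gen i)) (a i) < \<delta>"
    using HH.free_tuple_near[of "Suc k" a \<delta>] a \<delta>(1) by blast
  have \<alpha>'_mon: "\<alpha>' \<in> mon (F (Suc k)) HH" using \<alpha>'(1) unfolding HH.monH by blast
  then have \<alpha>'_hom: "\<alpha>' \<in> hom (F (Suc k)) HH" by (simp add: mon_def)
  then have \<alpha>'c: "\<alpha>' g \<in> carrier HH" if "g \<in> carrier (F (Suc k))" for g
    using that by (auto simp: hom_def)
  have Fk: "carrier (F k) \<subseteq> carrier (F (Suc k))" by (rule F_mono) simp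
  have near: "\<bar>dH (\<alpha>' g) \<one>\<^bsub>HH\<^esub> - dG (\<beta> g) \<one>\<^bsub>GG\<^esub>\<bar> \<le> (e + \<delta>) * real (length g)" if g: "g \<in> carrier (F k)" for g
  proof -
    have l: "fst l \<in> {1..k}" if "l \<in> set g" for l
      using g that by (auto simp: F_def carrier_free_group)
    have \<alpha>'g: "\<alpha>' g = word_eval HH (\<alpha>' \<circ> gen) g"
      using HH.hom_eq_word_eval[OF \<alpha>'_hom[unfolded F_def]] g Fk by (auto simp: F_def comp_def)
    have "dH (\<alpha>' g) (\<alpha> g) \<le> \<delta> * real (length g)"
      unfolding \<alpha>'g m(9)[OF g]
    proof (rule HH.word_eval_dist_le)
      fix l' assume "l' \<in> set g"
      then have i: "fst l' \<in> {1..k}" by (rule l)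
      then have "dH (\<alpha>' (gen (fst l'))) (\<alpha> (gen (fst l'))) < \<delta>"
        using \<alpha>'(2)[of "fst l'"] by (auto simp: a_def)
      moreover have "gen (fst l') \<in> carrier (F k)" using i by simp
      ultimately show "(\<alpha>' \<circ> gen) (fst l') \<in> carrier HH \<and> (\<alpha> \<circ> gen) (fst l') \<in> carrier HH \<and>
          dH ((\<alpha>' \<circ> gen) (fst l')) ((\<alpha> \<circ> gen) (fst l')) \<le> \<delta>"
        using \<alpha>'c m(5) Fk by auto
    qed
    moreover have "\<bar>dH (\<alpha>' g) \<one>\<^bsub>HH\<^esub> - dH (\<alpha> g) \<one>\<^bsub>HH\<^esub>\<bar> \<le> dH (\<alpha>' g) (\<alpha> g)"
      by (rule HH.norm_diff_le) (use g Fk \<alpha>'c m(5) in auto)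
    ultimately show ?thesis using e(3)[OF g] by (simp add: algebra_simps)
  qed
  let ?\<rho> = "pullback \<alpha>' dH"
  have "bi_metric_group (F (Suc k)) ?\<rho>"
    using group_F HH.bi_metric_group_axioms \<alpha>'_mon by (rule bi_metric_group_pullback)
  then have \<rho>: "bi_invariant_metric (F (Suc k)) ?\<rho>" by (rule bi_metric_group.bi_invariant)
  have \<rho>1: "bounded_by_1 (F (Suc k)) ?\<rho>"
    using \<alpha>'c HH.le_1 by (simp add: bounded_by_1_def pullback_def)
  have "\<alpha>' [] = \<one>\<^bsub>HH\<^esub>" using HH.hom_F_one[OF \<alpha>'_hom] .
  then have dist: "metric_dist k ?\<rho> (pullback \<beta> dG) < \<epsilon>"
    using near e(1) \<delta> m(8) by (intro metric_dist_less[of "e + \<delta>"]) (auto simp: pullback_def)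
  obtain \<beta>' where \<beta>': "\<beta>' \<in> mon (F (Suc k)) (GG\<lparr>carrier := J\<rparr>)"
    "\<And>i. i \<in> {1..k} \<Longrightarrow> dG (\<beta>' (gen i)) (\<beta> (gen i)) < \<epsilon>"
    "metric_dist (Suc k) ?\<rho> (pullback \<beta>' dG) < \<epsilon>'"
    by (rule extension_propertyE[OF GG.H_extension \<epsilon> lessI \<rho> \<rho>1 m(3) dist]) blast
  have "dH (\<alpha>' (gen i)) (\<alpha> (gen i)) < \<epsilon>" if "i \<in> {1..k}" for i
    using \<alpha>'(2)[of i] that \<delta>(3) by (auto simp: a_def)
  moreover have "dH (\<alpha>' (gen (Suc k))) h < \<epsilon>"
    using \<alpha>'(2)[of "Suc k"] \<delta>(3) by (auto simp: a_def)
  ultimately show ?thesis using \<alpha>'(1) \<beta>' unfolding matched_def by blast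
qed

end

sublocale back_and_forth \<subseteq> sym: back_and_forth GG dG J HH dH H
  by unfold_locales

context back_and_forth
begin

lemma sym_matched: "sym.matched k \<beta> \<alpha> e \<longleftrightarrow> matched k \<alpha> \<beta> e"
  unfolding matched_def sym.matched_def by (auto simp: metric_dist_commute)

text \<open>Approximation at stage \<open>n\<close> is only up to a power of 1/2, so each element of
  the enumerations must be treated again at arbitrarily late stages, and at stages of both
  parities.\<close>

definition target :: "nat \<Rightarrow> nat" where
  "target n = fst (prod_decode (n div 2))"

lemma target_infinitely_often: "\<exists>n\<ge>N. target n = l \<and> (even n \<longleftrightarrow> p)"
proof -
  let ?n = "2 * prod_encode (l, N) + (if p then 0 else 1)"
  have "N \<le> ?n" using le_prod_encode_2[of N l] by simp
  then show ?thesis by (intro exI[of _ ?n]) (auto simp: target_def)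
qed

text \<open>Even stages add an element of \<open>H\<close>, odd stages an element of
  \<open>J\<close>. Stage \<open>n\<close> uses \<epsilon> = \<open>(1/2) ^ n\<close> and
  \<epsilon>' = \<open>(1/2) ^ Suc n\<close>, so its output is the input of the next stage and the
  displacements are summable.\<close>

lemma approximating_sequences:
  assumes hs: "range hs = H" and js: "range js = J"
  shows "\<exists>\<alpha> \<beta>. \<forall>n. matched n (\<alpha> n) (\<beta> n) ((1/2) ^ n) \<and>
    (\<forall>i\<in>{1..n}. dH (\<alpha> (Suc n) (gen i)) (\<alpha> n (gen i)) < (1/2) ^ n) \<and>
    (\<forall>i\<in>{1..n}. dG (\<beta> (Suc n) (gen i)) (\<beta> n (gen i)) < (1/2) ^ n) \<and>
    (even n \<longrightarrow> dH (\<alpha> (Suc n) (gen (Suc n))) (hs (target n)) < (1/2) ^ n) \<and>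
    (odd n \<longrightarrow> dG (\<beta> (Suc n) (gen (Suc n))) (js (target n)) < (1/2) ^ n)"
proof -
  let ?M = "\<lambda>n s. matched n (fst s) (snd s) ((1/2) ^ n)"
  let ?S = "\<lambda>n s s'. (\<forall>i\<in>{1..n}. dH (fst s' (gen i)) (fst s (gen i)) < (1/2) ^ n) \<and>
      (\<forall>i\<in>{1..n}. dG (snd s' (gen i)) (snd s (gen i)) < (1/2) ^ n) \<and>
      (even n \<longrightarrow> dH (fst s' (gen (Suc n))) (hs (target n)) < (1/2) ^ n) \<and>
      (odd n \<longrightarrow> dG (snd s' (gen (Suc n))) (js (target n)) < (1/2) ^ n)"
  have "\<exists>f. \<forall>n. ?M n (f n) \<and> ?S n (f n) (f (Suc n))"
  proof (rule dependent_nat_choice)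
    have F0: "carrier (F 0) = {[]}" by (auto simp: F_def carrier_free_group)
    \<comment> \<open>On the trivial group \<open>F 0\<close> every positive constant is admissible,
      hence 1/2.\<close>
    have "matched 0 (\<lambda>_. \<one>\<^bsub>HH\<^esub>) (\<lambda>_. \<one>\<^bsub>GG\<^esub>) 1"
      unfolding matched_def HH.monH GG.monH
      using subgroup.one_closed[OF HH.H_subgroup] subgroup.one_closed[OF GG.H_subgroup]
      by (auto simp: mon_def hom_def F0 pullback_def intro: metric_dist_less[of "1/2"])
    then show "\<exists>s. ?M 0 s" by (intro exI[of _ "((\<lambda>_. \<one>\<^bsub>HH\<^esub>), (\<lambda>_. \<one>\<^bsub>GG\<^esub>))"]) simp
  next
    fix s n assume s: "?M n s"
    have pow: "(1/2) ^ Suc n < (1/2 :: real) ^ n" "0 < (1/2 :: real) ^ Suc n" by auto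
    have hsc: "hs l \<in> carrier HH" and jsc: "js l \<in> carrier GG" for l
      using hs js HH.H_carrier GG.H_carrier by auto
    show "\<exists>s'. ?M (Suc n) s' \<and> ?S n s s'"
    proof (cases "even n")
      case True
      from half_step[OF s pow hsc[of "target n"]] obtain \<alpha>' \<beta>' where
        "matched (Suc n) \<alpha>' \<beta>' ((1/2) ^ Suc n)"
        "\<forall>i\<in>{1..n}. dH (\<alpha>' (gen i)) (fst s (gen i)) < (1/2) ^ n"
        "\<forall>i\<in>{1..n}. dG (\<beta>' (gen i)) (snd s (gen i)) < (1/2) ^ n"
        "dH (\<alpha>' (gen (Suc n))) (hs (target n)) < (1/2) ^ n" by blast
      then show ?thesis using True by (intro exI[of _ "(\<alpha>', \<beta>')"]) simp
    next
      case False
      from sym.half_step[OF s[folded sym_matched] pow jsc[of "target n"]] obtain \<alpha>' \<beta>' where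
        "sym.matched (Suc n) \<beta>' \<alpha>' ((1/2) ^ Suc n)"
        "\<forall>i\<in>{1..n}. dH (\<alpha>' (gen i)) (fst s (gen i)) < (1/2) ^ n"
        "\<forall>i\<in>{1..n}. dG (\<beta>' (gen i)) (snd s (gen i)) < (1/2) ^ n"
        "dG (\<beta>' (gen (Suc n))) (js (target n)) < (1/2) ^ n" by blast
      then show ?thesis using False by (intro exI[of _ "(\<alpha>', \<beta>')"]) (simp add: sym_matched)
    qed
  qed
  then obtain f where f: "\<forall>n. ?M n (f n) \<and> ?S n (f n) (f (Suc n))" ..
  show ?thesis
    by (rule exI[of _ "\<lambda>n. fst (f n)"], rule exI[of _ "\<lambda>n. snd (f n)"]) (rule f)
qed

end

section \<open>Passing to the limit\<close>

lemma (in bi_metric_group) limit_of_generators: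
  fixes \<alpha> :: "nat \<Rightarrow> nat word \<Rightarrow> 'a"
  assumes "mcomplete" and car: "\<And>n i. i \<in> {1..n} \<Longrightarrow> \<alpha> n (gen i) \<in> carrier G"
    and step: "\<And>n i. i \<in> {1..n} \<Longrightarrow> d (\<alpha> (Suc n) (gen i)) (\<alpha> n (gen i)) < (1/2) ^ n"
  shows "\<exists>a. \<forall>i\<ge>1. a i \<in> carrier G \<and> (\<forall>n\<ge>i. d (\<alpha> n (gen i)) (a i) \<le> 2 * (1/2) ^ n)"
proof -
  have "\<exists>x\<in>carrier G. \<forall>n\<ge>i. d (\<alpha> n (gen i)) x \<le> 2 * (1/2) ^ n" if i: "1 \<le> i" for i
  proof -
    have "\<alpha> (n + i) (gen i) \<in> carrier G" for n using car[of i "n + i"] i by simp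
    \<comment> \<open>The generator \<open>i\<close> exists only from stage \<open>i\<close> on, so
      its sequence is shifted and the initial error becomes a power with exponent
      \<open>i\<close>.\<close>
    moreover have "d (\<alpha> (n + i) (gen i)) (\<alpha> (Suc n + i) (gen i)) \<le> (1/2) ^ i * (1/2) ^ n" for n
      using step[of i "n + i"] i commute[of "\<alpha> (n + i) (gen i)"] by (simp add: power_add mult.commute)
    ultimately obtain x where x: "x \<in> carrier G"
      "\<And>n. d (\<alpha> (n + i) (gen i)) x \<le> 2 * (1/2) ^ i * (1/2) ^ n"
      using geometric_limit[OF assms(1), of "\<lambda>n. \<alpha> (n + i) (gen i)" "(1/2) ^ i"] by auto
    have "d (\<alpha> n (gen i)) x \<le> 2 * (1/2) ^ n" if "n \<ge> i" for n
    proof -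
      have "(1/2 :: real) ^ i * (1/2) ^ (n - i) = (1/2) ^ n"
        using that by (simp flip: power_add)
      then show ?thesis using x(2)[of "n - i"] that by (simp add: mult.assoc)
    qed
    then show ?thesis using x(1) by blast
  qed
  then show ?thesis by metis
qed

lemma (in generic_group) limits_dense:
  fixes \<alpha> :: "nat \<Rightarrow> nat word \<Rightarrow> 'c" and a :: "nat \<Rightarrow> 'c"
  assumes hs: "range hs = H"
    and hits: "\<And>N l. \<exists>n\<ge>N. dH (\<alpha> (Suc n) (gen (Suc n))) (hs l) < (1/2) ^ n"
    and \<alpha>: "\<And>n. \<alpha> (Suc n) (gen (Suc n)) \<in> carrier HH" and a: "\<And>n. a (Suc n) \<in> carrier HH"
    and lim: "\<And>n. dH (\<alpha> (Suc n) (gen (Suc n))) (a (Suc n)) \<le> 2 * (1/2) ^ Suc n"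
    and x: "x \<in> carrier HH" "0 < e"
  shows "\<exists>n. dH x (a (Suc n)) < e"
proof -
  have "(\<lambda>n. 2 * (1/2 :: real) ^ n) \<longlonglongrightarrow> 2 * 0"
    by (intro tendsto_intros LIMSEQ_power_zero) simp
  from order_tendstoD(2)[OF this, of "e / 2"] obtain N where N: "\<And>n. n \<ge> N \<Longrightarrow> 2 * (1/2) ^ n < e / 2"
    using x(2) by (auto simp: eventually_sequentially)
  have e2: "0 < e / 2" using x(2) by simp
  obtain y where y: "y \<in> H" "dH x y < e / 2" using H_dense[OF x(1) e2] .
  then obtain l where l: "y = hs l" using hs by auto
  obtain n where n: "n \<ge> N" "dH (\<alpha> (Suc n) (gen (Suc n))) (hs l) < (1/2) ^ n" using hits by blast
  have yc: "y \<in> carrier HH" using y H_carrier by auto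
  \<comment> \<open>The entry added at a late stage \<open>n\<close> is within
    \<open>(1/2) ^ n\<close> of \<open>y\<close>, and its limit is again within
    \<open>(1/2) ^ n\<close> of it; \<open>N\<close> bounds the sum by half of
    \<open>e\<close>.\<close>
  have "dH x (a (Suc n)) \<le> dH x y + dH y (\<alpha> (Suc n) (gen (Suc n))) + dH (\<alpha> (Suc n) (gen (Suc n))) (a (Suc n))"
    using triangle[OF x(1) yc a, of n] triangle[OF yc \<alpha> a, of n n] by linarith
  moreover have "dH y (\<alpha> (Suc n) (gen (Suc n))) < (1/2) ^ n" using n(2) l commute by metis
  moreover have "dH (\<alpha> (Suc n) (gen (Suc n))) (a (Suc n)) \<le> (1/2) ^ n" using lim[of n] by simp
  ultimately have "dH x (a (Suc n)) < e" using y(2) N[OF n(1)] by linarith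
  then show ?thesis ..
qed

context back_and_forth
begin

text \<open>The limit tuples may satisfy relations, so they are compared through evaluation
  homomorphisms from a free group of infinite rank. The induced norms agree because the errors at
  stage \<open>n\<close> tend to 0 for each fixed word.\<close>

theorem isometrically_isomorphic: "isometrically_isomorphic HH dH GG dG"
proof -
  obtain hs :: "nat \<Rightarrow> 'a" where hs: "range hs = H" using HH.H_enumeration by blast
  obtain js :: "nat \<Rightarrow> 'b" where js: "range js = J" using GG.H_enumeration by blast
  obtain \<alpha> \<beta> where \<alpha>\<beta>: "\<forall>n. matched n (\<alpha> n) (\<beta> n) ((1/2) ^ n) \<and>
    (\<forall>i\<in>{1..n}. dH (\<alpha> (Suc n) (gen i)) (\<alpha> n (gen i)) < (1/2) ^ n) \<and>
    (\<forall>i\<in>{1..n}. dG (\<beta> (Suc n) (gen i)) (\<beta> n (gen i)) < (1/2) ^ n) \<and>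
    (even n \<longrightarrow> dH (\<alpha> (Suc n) (gen (Suc n))) (hs (target n)) < (1/2) ^ n) \<and>
    (odd n \<longrightarrow> dG (\<beta> (Suc n) (gen (Suc n))) (js (target n)) < (1/2) ^ n)"
    using approximating_sequences[OF hs js] by (elim exE)
  have m: "\<And>n. matched n (\<alpha> n) (\<beta> n) ((1/2) ^ n)"
    and \<alpha>_step: "\<And>n i. i \<in> {1..n} \<Longrightarrow> dH (\<alpha> (Suc n) (gen i)) (\<alpha> n (gen i)) < (1/2) ^ n"
    and \<beta>_step: "\<And>n i. i \<in> {1..n} \<Longrightarrow> dG (\<beta> (Suc n) (gen i)) (\<beta> n (gen i)) < (1/2) ^ n"
    and \<alpha>_target: "\<And>n. even n \<Longrightarrow> dH (\<alpha> (Suc n) (gen (Suc n))) (hs (target n)) < (1/2) ^ n"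
    and \<beta>_target: "\<And>n. odd n \<Longrightarrow> dG (\<beta> (Suc n) (gen (Suc n))) (js (target n)) < (1/2) ^ n"
    using \<alpha>\<beta> by blast+
  have \<alpha>c: "\<alpha> n (gen i) \<in> carrier HH" and \<beta>c: "\<beta> n (gen i) \<in> carrier GG" if "i \<in> {1..n}" for n i
    using matchedD(5,6)[OF m[of n], of "gen i"] that by simp_all
  have "\<exists>a. \<forall>i\<ge>1. a i \<in> carrier HH \<and> (\<forall>n\<ge>i. dH (\<alpha> n (gen i)) (a i) \<le> 2 * (1/2) ^ n)"
    by (rule HH.limit_of_generators[OF HH.complete]) (fact \<alpha>c \<alpha>_step)+
  then obtain a where "\<forall>i\<ge>1. a i \<in> carrier HH \<and> (\<forall>n\<ge>i. dH (\<alpha> n (gen i)) (a i) \<le> 2 * (1/2) ^ n)" ..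
  then have a: "\<And>i. 1 \<le> i \<Longrightarrow> a i \<in> carrier HH"
    "\<And>i n. i \<in> {1..n} \<Longrightarrow> dH (\<alpha> n (gen i)) (a i) \<le> 2 * (1/2) ^ n"
    by simp_all
  have "\<exists>b. \<forall>i\<ge>1. b i \<in> carrier GG \<and> (\<forall>n\<ge>i. dG (\<beta> n (gen i)) (b i) \<le> 2 * (1/2) ^ n)"
    by (rule GG.limit_of_generators[OF GG.complete]) (fact \<beta>c \<beta>_step)+
  then obtain b where "\<forall>i\<ge>1. b i \<in> carrier GG \<and> (\<forall>n\<ge>i. dG (\<beta> n (gen i)) (b i) \<le> 2 * (1/2) ^ n)" ..
  then have b: "\<And>i. 1 \<le> i \<Longrightarrow> b i \<in> carrier GG"
    "\<And>i n. i \<in> {1..n} \<Longrightarrow> dG (\<beta> n (gen i)) (b i) \<le> 2 * (1/2) ^ n"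
    by simp_all
  let ?W = "free_group {i :: nat. 0 < i}"
  interpret W: group ?W by (rule group_free_group)
  let ?P = "word_eval HH a" and ?Q = "word_eval GG b"
  have P_hom: "?P \<in> hom ?W HH" using a(1) by (intro HH.word_eval_hom) auto
  have Q_hom: "?Q \<in> hom ?W GG" using b(1) by (intro GG.word_eval_hom) auto
  interpret P: group_hom ?W HH ?P
    using P_hom by (simp add: group_hom_def group_hom_axioms_def group_free_group HH.is_group)
  interpret Q: group_hom ?W GG ?Q
    using Q_hom by (simp add: group_hom_def group_hom_axioms_def group_free_group GG.is_group)
  have norm_eq: "dH (?P w) \<one>\<^bsub>HH\<^esub> = dG (?Q w) \<one>\<^bsub>GG\<^esub>" if w: "w \<in> carrier ?W" for w
  proof -
    have wpos: "1 \<le> fst l" if "l \<in> set w" for l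
      using w that by (auto simp: carrier_free_group)
    define N where "N = Max (insert 0 (fst ` set w))"
    have le: "fst l \<le> N" if "l \<in> set w" for l
      unfolding N_def using that by (intro Max_ge) auto
    \<comment> \<open>The constant 5 is 1 for the mismatch of the two tuples at stage
      \<open>n\<close> plus 2 on each side for the distance to the limits.\<close>
    have bound: "\<bar>dH (?P w) \<one>\<^bsub>HH\<^esub> - dG (?Q w) \<one>\<^bsub>GG\<^esub>\<bar> \<le> 5 * real (length w) * (1/2) ^ n" if n: "n \<ge> N" for n
    proof -
      have l: "fst l \<in> {1..n}" if "l \<in> set w" for l
        using wpos[OF that] le[OF that] n by simp
      have wF: "w \<in> carrier (F n)" using w l by (auto simp: F_def carrier_free_group)
      note mn = matchedD[OF m[of n]]
      obtain e where e: "e < (1/2) ^ n"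
        "\<bar>dH (\<alpha> n w) \<one>\<^bsub>HH\<^esub> - dG (\<beta> n w) \<one>\<^bsub>GG\<^esub>\<bar> \<le> e * real (length w)"
        using mn(11) wF by blast
      have "e * real (length w) \<le> (1/2) ^ n * real (length w)"
        using e(1) by (intro mult_right_mono) auto
      moreover have "dH (\<alpha> n w) (?P w) \<le> 2 * (1/2) ^ n * real (length w)"
        unfolding mn(9)[OF wF]
      proof (rule HH.word_eval_dist_le)
        fix k assume "k \<in> set w"
        then have "fst k \<in> {1..n}" by (rule l)
        then show "(\<alpha> n \<circ> gen) (fst k) \<in> carrier HH \<and> a (fst k) \<in> carrier HH \<and>
            dH ((\<alpha> n \<circ> gen) (fst k)) (a (fst k)) \<le> 2 * (1/2) ^ n"
          using \<alpha>c a by simp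
      qed
      moreover have "dG (\<beta> n w) (?Q w) \<le> 2 * (1/2) ^ n * real (length w)"
        unfolding mn(10)[OF wF]
      proof (rule GG.word_eval_dist_le)
        fix k assume "k \<in> set w"
        then have "fst k \<in> {1..n}" by (rule l)
        then show "(\<beta> n \<circ> gen) (fst k) \<in> carrier GG \<and> b (fst k) \<in> carrier GG \<and>
            dG ((\<beta> n \<circ> gen) (fst k)) (b (fst k)) \<le> 2 * (1/2) ^ n"
          using \<beta>c b by simp
      qed
      moreover have "\<bar>dH (\<alpha> n w) \<one>\<^bsub>HH\<^esub> - dH (?P w) \<one>\<^bsub>HH\<^esub>\<bar> \<le> dH (\<alpha> n w) (?P w)"
        by (rule HH.norm_diff_le[OF mn(5)[OF wF] P.hom_closed[OF w]])
      moreover have "\<bar>dG (\<beta> n w) \<one>\<^bsub>GG\<^esub> - dG (?Q w) \<one>\<^bsub>GG\<^esub>\<bar> \<le> dG (\<beta> n w) (?Q w)"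
        by (rule GG.norm_diff_le[OF mn(6)[OF wF] Q.hom_closed[OF w]])
      ultimately have "\<bar>dH (?P w) \<one>\<^bsub>HH\<^esub> - dG (?Q w) \<one>\<^bsub>GG\<^esub>\<bar> \<le>
          (1/2) ^ n * real (length w) + 2 * (1/2) ^ n * real (length w) + 2 * (1/2) ^ n * real (length w)"
        using e(2) by linarith
      then show ?thesis by (simp add: algebra_simps)
    qed
    have "(\<lambda>n. 5 * real (length w) * (1/2) ^ n) \<longlonglongrightarrow> 5 * real (length w) * 0"
      by (intro tendsto_intros LIMSEQ_power_zero) simp
    then have "\<bar>dH (?P w) \<one>\<^bsub>HH\<^esub> - dG (?Q w) \<one>\<^bsub>GG\<^esub>\<bar> \<le> 5 * real (length w) * 0"
      by (rule LIMSEQ_le_const) (use bound in blast)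
    then show ?thesis by simp
  qed
  interpret dense_isometry HH dH GG dG ?W ?P ?Q
  proof
    show "dH (?P u) (?P v) = dG (?Q u) (?Q v)" if "u \<in> carrier ?W" "v \<in> carrier ?W" for u v
    proof -
      have "dH (?P u) (?P v) = dH (?P (u \<otimes>\<^bsub>?W\<^esub> inv\<^bsub>?W\<^esub> v)) \<one>\<^bsub>HH\<^esub>"
        using that HH.d_norm(2)[of "?P u" "?P v"] by (simp del: mult_free_group)
      also have "\<dots> = dG (?Q (u \<otimes>\<^bsub>?W\<^esub> inv\<^bsub>?W\<^esub> v)) \<one>\<^bsub>GG\<^esub>"
        using that by (intro norm_eq W.m_closed W.inv_closed)
      also have "\<dots> = dG (?Q u) (?Q v)"
        using that GG.d_norm(2)[of "?Q u" "?Q v"] by (simp del: mult_free_group)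
      finally show ?thesis .
    qed
  next
    show "\<exists>w\<in>carrier ?W. dH x (?P w) < e" if "x \<in> carrier HH" "0 < e" for x e
    proof -
      have "\<exists>n. dH x (a (Suc n)) < e"
      proof (rule HH.limits_dense[where \<alpha> = \<alpha>, OF hs])
        show "\<exists>n\<ge>N. dH (\<alpha> (Suc n) (gen (Suc n))) (hs l) < (1/2) ^ n" for N l
          using target_infinitely_often[of N l True] \<alpha>_target by auto
        show "dH (\<alpha> (Suc n) (gen (Suc n))) (a (Suc n)) \<le> 2 * (1/2) ^ Suc n" for n
          by (rule a(2)) simp
      qed (use \<alpha>c a(1) that in auto)
      then obtain n where "dH x (a (Suc n)) < e" ..
      then show ?thesis using a(1) by (intro bexI[of _ "gen (Suc n)"]) auto
    qed
    show "\<exists>w\<in>carrier ?W. dG x (?Q w) < e" if "x \<in> carrier GG" "0 < e" for x e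
    proof -
      have "\<exists>n. dG x (b (Suc n)) < e"
      proof (rule GG.limits_dense[where \<alpha> = \<beta>, OF js])
        show "\<exists>n\<ge>N. dG (\<beta> (Suc n) (gen (Suc n))) (js l) < (1/2) ^ n" for N l
          using target_infinitely_often[of N l False] \<beta>_target by auto
        show "dG (\<beta> (Suc n) (gen (Suc n))) (b (Suc n)) \<le> 2 * (1/2) ^ Suc n" for n
          by (rule b(2)) simp
      qed (use \<beta>c b(1) that in auto)
      then obtain n where "dG x (b (Suc n)) < e" ..
      then show ?thesis using b(1) by (intro bexI[of _ "gen (Suc n)"]) auto
    qed
  qed (use P_hom Q_hom in auto)
  show ?thesis
    using HH.complete GG.complete by (rule isometrically_isomorphic_completions)
qed

end

theorem theorem1p19:
  fixes G1 :: "('a, 'x) monoid_scheme" and d1 :: "'a \<Rightarrow> 'a \<Rightarrow> real"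
    and GG :: "('b, 'y) monoid_scheme" and dG :: "'b \<Rightarrow> 'b \<Rightarrow> real"
    and HH :: "('c, 'z) monoid_scheme" and dH :: "'c \<Rightarrow> 'c \<Rightarrow> real"
  assumes "fraisse_limit G1 d1"
    and "metric_completion G1 d1 GG dG"
    and "group HH"
    and "bi_invariant_metric HH dH"
    and "bounded_by_1 HH dH"
    and "Metric_space.mcomplete (carrier HH) dH"
    and "separable_space (Metric_space.mtopology (carrier HH) dH)"
  shows "isometrically_isomorphic HH dH GG dG \<longleftrightarrow>
    (\<exists>H. subgroup H HH \<and> HH\<lparr>carrier := H\<rparr> \<cong> free_group (UNIV :: nat set) \<and> dense_in HH dH H \<and>
      (\<forall>(\<epsilon>::real) (\<epsilon>'::real) (m::nat) (n::nat) \<rho> \<iota>.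
         \<epsilon> > \<epsilon>' \<and> \<epsilon>' > 0 \<and> m < n \<and>
         bi_invariant_metric (F n) \<rho> \<and> bounded_by_1 (F n) \<rho> \<and>
         \<iota> \<in> mon (F m) HH \<and> metric_dist m \<rho> (pullback \<iota> dH) < \<epsilon> \<longrightarrow>
         (\<exists>\<kappa>\<in>mon (F n) (HH\<lparr>carrier := H\<rparr>).
            (\<forall>i\<in>{1..m}. dH (\<kappa> (gen i)) (\<iota> (gen i)) < \<epsilon>) \<and>
            metric_dist n \<rho> (pullback \<kappa> dH) < \<epsilon>')))"
proof -
  obtain K \<phi> \<psi> where K: "fraisse_sequence K \<phi>" "is_direct_limit K \<phi> G1 d1 \<psi>"
    using assms(1) unfolding fraisse_limit_def by blast
  obtain j where j: "j \<in> hom G1 GG" "isometric_on (carrier G1) d1 dG j" "dense_in GG dG (j ` carrier G1)"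
    and complete: "bi_metric_group GG dG" "Metric_space.mcomplete (carrier GG) dG"
    using assms(2) bi_metric_groupI unfolding metric_completion_def by blast
  interpret fraisse_completion K \<phi> G1 d1 \<psi> GG dG j
    using K complete(1) j by (rule fraisse_completion.intro)
  let ?J = "j ` carrier G1"
  have J: "generic_subgroup GG dG ?J"
    using subgroup_image image_free j_dense extension_property_GG by (simp add: generic_subgroup_def)
  have HH: "bi_metric_group HH dH"
    using assms(3,4) by (rule bi_metric_groupI)
  interpret HH: bi_metric_group HH dH by (rule HH)
  have "isometrically_isomorphic HH dH GG dG \<longleftrightarrow> (\<exists>H. generic_subgroup HH dH H)"
  proof
    assume "isometrically_isomorphic HH dH GG dG"
    then obtain f where f: "f \<in> iso HH GG" "isometric_on (carrier HH) dH dG f"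
      unfolding isometrically_isomorphic_def by blast
    \<comment> \<open>The generic subgroup at hand lies in \<open>GG\<close>, so it has to be
      carried back along the inverse.\<close>
    define g where "g = inv_into (carrier HH) f"
    have g: "g \<in> iso GG HH" using HH.iso_set_sym[OF f(1)] by (simp add: g_def)
    have "g y \<in> carrier HH \<and> f (g y) = y" if "y \<in> carrier GG" for y
      using f(1) that by (auto simp: g_def iso_def bij_betw_def inv_into_into f_inv_into_f)
    then have "isometric_on (carrier GG) dG dH g"
      using f(2) unfolding isometric_on_def by metis
    then show "\<exists>H. generic_subgroup HH dH H"
      using generic_subgroup_transport[OF complete(1) HH g _ J] by blast
  next
    assume "\<exists>H. generic_subgroup HH dH H"
    then obtain H where H: "generic_subgroup HH dH H" ..
    have "generic_group HH dH H"
      using HH H assms(5,6)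
      by (intro generic_group.intro generic_group_axioms.intro) (auto simp: bounded_by_1_def)
    moreover have "generic_group GG dG ?J"
      by (intro generic_group.intro generic_group_axioms.intro complete J dG_le_1)
    ultimately have "back_and_forth HH dH H GG dG ?J" by (rule back_and_forth.intro)
    then show "isometrically_isomorphic HH dH GG dG"
      by (rule back_and_forth.isometrically_isomorphic)
  qed
  then show ?thesis
    unfolding generic_subgroup_def extension_property_def .
qed

end
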